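(* Let $M^2\hookrightarrow (N^n,h)$ be a biconservative surface into an $n$-dimensional Riemannian manifold. Then: (a) $Q(z,\bar z)$ is holomorphic if and only if $|H|$ is constant; (b) $S_2$ is a Codazzi tensor if and only if $|H|$ is constant.
   Context: The surface $M^2$ is isometrically immersed by $\varphi:M^2\hookrightarrow (N^n,h)$, with induced metric $g=\varphi^*h=\langle\,,\rangle$. $B$ is the second fundamental form, $H=\frac12\,\mathrm{trace}\,B$ is the mean curvature vector field, and $A_H$ is the shape operator in the direction of $H$, i.e. $\langle A_H X,Y\rangle=\langle B(X,Y),H\rangle$ for tangent $X,Y$. The stress-bienergy tensor of $\varphi$ is the symmetric $(0,2)$-tensor $S_2=-2|H|^2 g+4A_H$ on $M^2$, i.e. $S_2(X,Y)=-2|H|^2\langle X,Y\rangle+4\langle A_H X,Y\rangle$. The surface is called biconservative if $\mathrm{div}\, S_2=0$, where $(\mathrm{div}\,S_2)(Y)=\sum_i(\nabla_{e_i}S_2)(e_i,Y)$ for a local orthonormal frame $\{e_i\}$ on $M^2$ and $\nabla$ the Levi-Civita connection of $g$. In local isothermal coordinates $(x,y)$ on $M^2$ (so $g=\lambda^2(dx^2+dy^2)$ with $\lambda>0$), put $z=x+\mathrm{i}y$, $\partial_z=\frac12(\partial_x-\mathrm{i}\partial_y)$, $\partial_{\bar z}=\frac12(\partial_x+\mathrm{i}\partial_y)$, extend $B$, $A_H$ and $\langle\,,\rangle$ complex (bi)linearly, and define the local complex-valued function $Q(z,\bar z)=\langle B(\partial_z,\partial_z),H\rangle=\langle A_H(\partial_z),\partial_z\rangle$.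 "$Q$ is holomorphic" means $\partial_{\bar z}Q=0$ in such local isothermal coordinates. A symmetric $(0,2)$-tensor field $T$ on $M^2$ is a Codazzi tensor if $(\nabla_XT)(Y,Z)=(\nabla_YT)(X,Z)$ for all tangent vector fields $X,Y,Z$.
   Formalization: The surface M is assumed connected; otherwise "|H| is constant" can fail, e.g. two disjoint round spheres of different radii in R^3 have Q = 0 and S_2 Codazzi, but |H| takes two values. *)

theory Defs
  imports "HOL-Analysis.Analysis"
begin

section \<open>Smooth maps between Euclidean spaces\<close>

primrec cont_diff_on ::
  "nat \<Rightarrow> 'a::real_normed_vector set \<Rightarrow> ('a \<Rightarrow> 'b::real_normed_vector) \<Rightarrow> bool" where
  "cont_diff_on 0 S f = continuous_on S f"
| "cont_diff_on (Suc k) S f =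
     ((\<forall>x\<in>S. f differentiable (at x)) \<and>
      (\<forall>v. cont_diff_on k S (\<lambda>x. frechet_derivative f (at x) v)))"

text \<open>Only meant for open sets \<open>S\<close>.\<close>

definition smooth_on ::
  "'a::real_normed_vector set \<Rightarrow> ('a \<Rightarrow> 'b::real_normed_vector) \<Rightarrow> bool" where
  "smooth_on S f \<longleftrightarrow> (\<forall>k. cont_diff_on k S f)"

definition dd ::
  "('a::real_normed_vector \<Rightarrow> 'b::real_normed_vector) \<Rightarrow> 'a \<Rightarrow> 'a \<Rightarrow> 'b" where
  "dd f x v = frechet_derivative f (at x) v"


section \<open>Manifolds and Riemannian metrics\<close>

text \<open>A chart is a coordinate domain together with a coordinate map, whose values outside the
  domain are irrelevant. The dimension of the manifold is \<open>CARD('n)\<close>.\<close>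

type_synonym ('p, 'n) chart = "'p set \<times> ('p \<Rightarrow> real ^ 'n)"

abbreviation cdom :: "('p, 'n::finite) chart \<Rightarrow> 'p set" where "cdom \<equiv> fst"
abbreviation cmap :: "('p, 'n::finite) chart \<Rightarrow> 'p \<Rightarrow> real ^ 'n" where "cmap \<equiv> snd"

definition cimg :: "('p, 'n::finite) chart \<Rightarrow> (real ^ 'n) set" where
  "cimg c = cmap c ` cdom c"

definition cinv :: "('p, 'n::finite) chart \<Rightarrow> real ^ 'n \<Rightarrow> 'p" where
  "cinv c = inv_into (cdom c) (cmap c)"

definition transition ::
  "('p, 'n::finite) chart \<Rightarrow> ('p, 'n) chart \<Rightarrow> real ^ 'n \<Rightarrow> real ^ 'n" where
  "transition c d = cmap d \<circ> cinv c"

definition is_chart :: "'p topology \<Rightarrow> ('p, 'n::finite) chart \<Rightarrow> bool" where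
  "is_chart T c \<longleftrightarrow> openin T (cdom c) \<and> open (cimg c) \<and>
     homeomorphic_map (subtopology T (cdom c)) (top_of_set (cimg c)) (cmap c)"

definition compatible :: "('p, 'n::finite) chart \<Rightarrow> ('p, 'n) chart \<Rightarrow> bool" where
  "compatible c d \<longleftrightarrow>
     smooth_on (cmap c ` (cdom c \<inter> cdom d)) (transition c d) \<and>
     smooth_on (cmap d ` (cdom c \<inter> cdom d)) (transition d c)"

text \<open>The tensor field \<open>metric M\<close> is given by its local representations:
  \<open>metric M c x u v\<close> is the inner product of the tangent vectors with components \<open>u\<close>, \<open>v\<close>
  with respect to the chart \<open>c\<close>, at the point with coordinates \<open>x\<close> in \<open>c\<close>.\<close>

record ('p, 'n) riem_mfd =
  top_of :: "'p topology"
  atlas :: "('p, 'n::finite) chart set"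
  metric :: "('p, 'n) chart \<Rightarrow> real ^ 'n \<Rightarrow> real ^ 'n \<Rightarrow> real ^ 'n \<Rightarrow> real"

text \<open>The atlas is required to be maximal, so that isothermal charts belong to it.\<close>

definition smooth_manifold :: "('p, 'n::finite) riem_mfd \<Rightarrow> bool" where
  "smooth_manifold M \<longleftrightarrow>
     Hausdorff_space (top_of M) \<and> second_countable (top_of M) \<and>
     (\<Union>c\<in>atlas M. cdom c) = topspace (top_of M) \<and>
     (\<forall>c\<in>atlas M. is_chart (top_of M) c) \<and>
     (\<forall>c\<in>atlas M. \<forall>d\<in>atlas M. compatible c d) \<and>
     (\<forall>c. is_chart (top_of M) c \<and> (\<forall>d\<in>atlas M. compatible c d) \<longrightarrow> c \<in> atlas M)"

definition riemannian_metric :: "('p, 'n::finite) riem_mfd \<Rightarrow> bool" where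
  "riemannian_metric M \<longleftrightarrow>
     (\<forall>c\<in>atlas M.
        (\<forall>u v. smooth_on (cimg c) (\<lambda>x. metric M c x u v)) \<and>
        (\<forall>x\<in>cimg c. bilinear (metric M c x) \<and>
           (\<forall>u v. metric M c x u v = metric M c x v u) \<and>
           (\<forall>u. u \<noteq> 0 \<longrightarrow> metric M c x u u > 0))) \<and>
     (\<forall>c\<in>atlas M. \<forall>d\<in>atlas M. \<forall>p\<in>cdom c \<inter> cdom d. \<forall>u v.
        metric M c (cmap c p) u v =
        metric M d (cmap d p) (dd (transition c d) (cmap c p) u)
                              (dd (transition c d) (cmap c p) v))"

definition riemannian_manifold :: "('p, 'n::finite) riem_mfd \<Rightarrow> bool" where
  "riemannian_manifold M \<longleftrightarrow> smooth_manifold M \<and> riemannian_metric M"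


section \<open>Isometric immersions\<close>

definition local_rep ::
  "('p \<Rightarrow> 'q) \<Rightarrow> ('p, 'm::finite) chart \<Rightarrow> ('q, 'n::finite) chart \<Rightarrow> real ^ 'm \<Rightarrow> real ^ 'n" where
  "local_rep \<phi> c d = cmap d \<circ> \<phi> \<circ> cinv c"

definition local_dom ::
  "('p \<Rightarrow> 'q) \<Rightarrow> ('p, 'm::finite) chart \<Rightarrow> ('q, 'n::finite) chart \<Rightarrow> (real ^ 'm) set" where
  "local_dom \<phi> c d = cmap c ` {p \<in> cdom c. \<phi> p \<in> cdom d}"

definition smooth_map ::
  "('p \<Rightarrow> 'q) \<Rightarrow> ('p, 'm::finite) riem_mfd \<Rightarrow> ('q, 'n::finite) riem_mfd \<Rightarrow> bool" where
  "smooth_map \<phi> M N \<longleftrightarrow> continuous_map (top_of M) (top_of N) \<phi> \<and>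
     (\<forall>c\<in>atlas M. \<forall>d\<in>atlas N. smooth_on (local_dom \<phi> c d) (local_rep \<phi> c d))"

definition immersion ::
  "('p \<Rightarrow> 'q) \<Rightarrow> ('p, 'm::finite) riem_mfd \<Rightarrow> ('q, 'n::finite) riem_mfd \<Rightarrow> bool" where
  "immersion \<phi> M N \<longleftrightarrow> smooth_map \<phi> M N \<and>
     (\<forall>c\<in>atlas M. \<forall>d\<in>atlas N. \<forall>x\<in>local_dom \<phi> c d. inj (dd (local_rep \<phi> c d) x))"

definition isometric_immersion ::
  "('p \<Rightarrow> 'q) \<Rightarrow> ('p, 'm::finite) riem_mfd \<Rightarrow> ('q, 'n::finite) riem_mfd \<Rightarrow> bool" where
  "isometric_immersion \<phi> M N \<longleftrightarrow> immersion \<phi> M N \<and>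
     (\<forall>c\<in>atlas M. \<forall>d\<in>atlas N. \<forall>x\<in>local_dom \<phi> c d. \<forall>u v.
        metric M c x u v =
        metric N d (local_rep \<phi> c d x) (dd (local_rep \<phi> c d) x u) (dd (local_rep \<phi> c d) x v))"


section \<open>Local Riemannian geometry in coordinates\<close>

text \<open>In this section \<open>g\<close> (and \<open>h\<close>) are metrics on open subsets of Euclidean spaces, and
  vector fields and tensors are given by their components in the coordinate frame.\<close>

type_synonym 'n lmetric = "real ^ 'n \<Rightarrow> real ^ 'n \<Rightarrow> real ^ 'n \<Rightarrow> real"

definition ginv :: "'n::finite lmetric \<Rightarrow> real ^ 'n \<Rightarrow> real ^ 'n ^ 'n" where
  "ginv g x = matrix_inv (\<chi> i j. g x (axis i 1) (axis j 1))"

text \<open>Raising an index: the vector \<open>w\<close> with \<open>g x w t = \<alpha> t\<close> for all \<open>t\<close>, for a linear form \<open>\<alpha>\<close>.\<close>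

definition sharp :: "'n::finite lmetric \<Rightarrow> real ^ 'n \<Rightarrow> (real ^ 'n \<Rightarrow> real) \<Rightarrow> real ^ 'n" where
  "sharp g x \<alpha> = ginv g x *v (\<chi> l. \<alpha> (axis l 1))"

text \<open>\<open>christoffel g x (axis i 1) (axis j 1) $ k\<close> is the Christoffel symbol
  \<open>\<Gamma>\<^sup>k\<^sub>i\<^sub>j = 1/2 \<Sum>\<^sub>l g\<^sup>k\<^sup>l (\<partial>\<^sub>i g\<^sub>j\<^sub>l + \<partial>\<^sub>j g\<^sub>i\<^sub>l - \<partial>\<^sub>l g\<^sub>i\<^sub>j)\<close>.\<close>

definition christoffel ::
  "'n::finite lmetric \<Rightarrow> real ^ 'n \<Rightarrow> real ^ 'n \<Rightarrow> real ^ 'n \<Rightarrow> real ^ 'n" where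
  "christoffel g x u v = sharp g x
     (\<lambda>t. (dd (\<lambda>y. g y v t) x u + dd (\<lambda>y. g y u t) x v - dd (\<lambda>y. g y u v) x t) / 2)"

text \<open>Levi-Civita covariant derivative of the vector field \<open>W\<close> along the map \<open>f\<close>, in the
  direction of the vector \<open>u\<close>.\<close>

definition cov_along ::
  "'n::finite lmetric \<Rightarrow> (real ^ 'm \<Rightarrow> real ^ 'n) \<Rightarrow> real ^ 'm \<Rightarrow> (real ^ 'm \<Rightarrow> real ^ 'n) \<Rightarrow>
   real ^ 'm::finite \<Rightarrow> real ^ 'n" where
  "cov_along h f u W x = dd W x u + christoffel h (f x) (dd f x u) (W x)"

definition cov ::
  "'m::finite lmetric \<Rightarrow> (real ^ 'm \<Rightarrow> real ^ 'm) \<Rightarrow> (real ^ 'm \<Rightarrow> real ^ 'm) \<Rightarrow>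
   real ^ 'm \<Rightarrow> real ^ 'm" where
  "cov g X Y x = dd Y x (X x) + christoffel g x (X x) (Y x)"

text \<open>\<open>(\<nabla>\<^sub>X T)(Y, Z)\<close> for a (0,2)-tensor field \<open>T\<close>.\<close>

definition cov_tensor ::
  "'m::finite lmetric \<Rightarrow> 'm lmetric \<Rightarrow> (real ^ 'm \<Rightarrow> real ^ 'm) \<Rightarrow> (real ^ 'm \<Rightarrow> real ^ 'm) \<Rightarrow>
   (real ^ 'm \<Rightarrow> real ^ 'm) \<Rightarrow> real ^ 'm \<Rightarrow> real" where
  "cov_tensor g T X Y Z x =
     dd (\<lambda>y. T y (Y y) (Z y)) x (X x) - T x (cov g X Y x) (Z x) - T x (Y x) (cov g X Z x)"

definition orthonormal_frame_on ::
  "'m::finite lmetric \<Rightarrow> (real ^ 'm) set \<Rightarrow> ('m \<Rightarrow> real ^ 'm \<Rightarrow> real ^ 'm) \<Rightarrow> bool" where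
  "orthonormal_frame_on g V E \<longleftrightarrow>
     (\<forall>i. smooth_on V (E i)) \<and>
     (\<forall>x\<in>V. \<forall>i j. g x (E i x) (E j x) = (if i = j then 1 else 0))"

definition div_tensor ::
  "'m::finite lmetric \<Rightarrow> ('m \<Rightarrow> real ^ 'm \<Rightarrow> real ^ 'm) \<Rightarrow> 'm lmetric \<Rightarrow>
   (real ^ 'm \<Rightarrow> real ^ 'm) \<Rightarrow> real ^ 'm \<Rightarrow> real" where
  "div_tensor g E T Y x = (\<Sum>i\<in>UNIV. cov_tensor g T (E i) (E i) Y x)"

text \<open>The second fundamental form of the isometric immersion \<open>f\<close>, by the Gauss formula
  \<open>B(X, Y) = \<nabla>\<^sup>N\<^sub>X df(Y) - df(\<nabla>\<^sub>X Y)\<close>. Since \<open>B\<close> is tensorial, tangent vectors \<open>u\<close>, \<open>v\<close> at \<open>x\<close>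
  may be extended to vector fields with constant components.\<close>

definition sff ::
  "'m::finite lmetric \<Rightarrow> 'n::finite lmetric \<Rightarrow> (real ^ 'm \<Rightarrow> real ^ 'n) \<Rightarrow>
   real ^ 'm \<Rightarrow> real ^ 'm \<Rightarrow> real ^ 'm \<Rightarrow> real ^ 'n" where
  "sff g h f x u v =
     cov_along h f u (\<lambda>y. dd f y v) x - dd f x (cov g (\<lambda>_. u) (\<lambda>_. v) x)"

text \<open>\<open>H = 1/2 trace B\<close>: the factor 1/2 is the normalization for surfaces.\<close>

definition mean_curv ::
  "2 lmetric \<Rightarrow> 'n::finite lmetric \<Rightarrow> (real ^ 2 \<Rightarrow> real ^ 'n) \<Rightarrow> real ^ 2 \<Rightarrow> real ^ 'n" where
  "mean_curv g h f x = (1/2) *\<^sub>R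
     (\<Sum>i\<in>UNIV. \<Sum>j\<in>UNIV. (ginv g x $ i $ j) *\<^sub>R sff g h f x (axis i 1) (axis j 1))"

definition mean_curv_norm ::
  "2 lmetric \<Rightarrow> 'n::finite lmetric \<Rightarrow> (real ^ 2 \<Rightarrow> real ^ 'n) \<Rightarrow> real ^ 2 \<Rightarrow> real" where
  "mean_curv_norm g h f x = sqrt (h (f x) (mean_curv g h f x) (mean_curv g h f x))"

definition shape_op_H ::
  "2 lmetric \<Rightarrow> 'n::finite lmetric \<Rightarrow> (real ^ 2 \<Rightarrow> real ^ 'n) \<Rightarrow>
   real ^ 2 \<Rightarrow> real ^ 2 \<Rightarrow> real ^ 2" where
  "shape_op_H g h f x u = sharp g x (\<lambda>v. h (f x) (sff g h f x u v) (mean_curv g h f x))"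

definition stress_bienergy ::
  "2 lmetric \<Rightarrow> 'n::finite lmetric \<Rightarrow> (real ^ 2 \<Rightarrow> real ^ 'n) \<Rightarrow> 2 lmetric" where
  "stress_bienergy g h f x u v =
     - 2 * (mean_curv_norm g h f x)\<^sup>2 * g x u v + 4 * g x (shape_op_H g h f x u) v"

text \<open>Complex bilinear extensions of a scalar-valued and of a vector-valued real bilinear map,
  and the complexification of a real vector.\<close>

definition cext ::
  "(real ^ 'n \<Rightarrow> real ^ 'n \<Rightarrow> real) \<Rightarrow> complex ^ 'n::finite \<Rightarrow> complex ^ 'n \<Rightarrow> complex" where
  "cext \<beta> Z W =
     (\<Sum>i\<in>UNIV. \<Sum>j\<in>UNIV. Z $ i * W $ j * complex_of_real (\<beta> (axis i 1) (axis j 1)))"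

definition cext_vec ::
  "(real ^ 'm \<Rightarrow> real ^ 'm \<Rightarrow> real ^ 'n::finite) \<Rightarrow> complex ^ 'm::finite \<Rightarrow> complex ^ 'm \<Rightarrow>
   complex ^ 'n" where
  "cext_vec \<beta> Z W = (\<chi> a. cext (\<lambda>u v. \<beta> u v $ a) Z W)"

definition cvec :: "real ^ 'n \<Rightarrow> complex ^ 'n::finite" where
  "cvec v = (\<chi> a. complex_of_real (v $ a))"

text \<open>The components of \<open>\<partial>\<^sub>z = 1/2 (\<partial>\<^sub>x - i \<partial>\<^sub>y)\<close>.\<close>

definition del_z :: "complex ^ 2" where
  "del_z = vector [1/2, - \<i>/2]"

definition hopf_Q ::
  "2 lmetric \<Rightarrow> 'n::finite lmetric \<Rightarrow> (real ^ 2 \<Rightarrow> real ^ 'n) \<Rightarrow> real ^ 2 \<Rightarrow> complex" where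
  "hopf_Q g h f x =
     cext (h (f x)) (cext_vec (sff g h f x) del_z del_z) (cvec (mean_curv g h f x))"

definition dbar :: "(real ^ 2 \<Rightarrow> complex) \<Rightarrow> real ^ 2 \<Rightarrow> complex" where
  "dbar F x = (dd F x (axis 1 1) + \<i> * dd F x (axis 2 1)) / 2"


section \<open>Global notions for a surface\<close>

definition S2 ::
  "('p \<Rightarrow> 'q) \<Rightarrow> ('p, 2) riem_mfd \<Rightarrow> ('q, 'n::finite) riem_mfd \<Rightarrow>
   ('p, 2) chart \<Rightarrow> ('q, 'n) chart \<Rightarrow> 2 lmetric" where
  "S2 \<phi> M N c d = stress_bienergy (metric M c) (metric N d) (local_rep \<phi> c d)"

definition biconservative ::
  "('p \<Rightarrow> 'q) \<Rightarrow> ('p, 2) riem_mfd \<Rightarrow> ('q, 'n::finite) riem_mfd \<Rightarrow> bool" where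
  "biconservative \<phi> M N \<longleftrightarrow>
     (\<forall>c\<in>atlas M. \<forall>d\<in>atlas N. \<forall>V E Y. open V \<and> V \<subseteq> local_dom \<phi> c d \<and>
        orthonormal_frame_on (metric M c) V E \<and> smooth_on V Y \<longrightarrow>
        (\<forall>x\<in>V. div_tensor (metric M c) E (S2 \<phi> M N c d) Y x = 0))"

definition S2_codazzi ::
  "('p \<Rightarrow> 'q) \<Rightarrow> ('p, 2) riem_mfd \<Rightarrow> ('q, 'n::finite) riem_mfd \<Rightarrow> bool" where
  "S2_codazzi \<phi> M N \<longleftrightarrow>
     (\<forall>c\<in>atlas M. \<forall>d\<in>atlas N. \<forall>V X Y Z. open V \<and> V \<subseteq> local_dom \<phi> c d \<and>
        smooth_on V X \<and> smooth_on V Y \<and> smooth_on V Z \<longrightarrow>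
        (\<forall>x\<in>V. cov_tensor (metric M c) (S2 \<phi> M N c d) X Y Z x =
               cov_tensor (metric M c) (S2 \<phi> M N c d) Y X Z x))"

definition isothermal :: "('p, 2) riem_mfd \<Rightarrow> ('p, 2) chart \<Rightarrow> bool" where
  "isothermal M c \<longleftrightarrow> c \<in> atlas M \<and>
     (\<exists>\<rho>. \<forall>x\<in>cimg c. \<rho> x > 0 \<and> (\<forall>u v. metric M c x u v = (\<rho> x)\<^sup>2 * (u \<bullet> v)))"

definition Q_holomorphic ::
  "('p \<Rightarrow> 'q) \<Rightarrow> ('p, 2) riem_mfd \<Rightarrow> ('q, 'n::finite) riem_mfd \<Rightarrow> bool" where
  "Q_holomorphic \<phi> M N \<longleftrightarrow>
     (\<forall>c. isothermal M c \<longrightarrow> (\<forall>d\<in>atlas N. \<forall>x\<in>local_dom \<phi> c d.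
        dbar (hopf_Q (metric M c) (metric N d) (local_rep \<phi> c d)) x = 0))"

definition H_norm_constant ::
  "('p \<Rightarrow> 'q) \<Rightarrow> ('p, 2) riem_mfd \<Rightarrow> ('q, 'n::finite) riem_mfd \<Rightarrow> bool" where
  "H_norm_constant \<phi> M N \<longleftrightarrow>
     (\<exists>k. \<forall>c\<in>atlas M. \<forall>d\<in>atlas N. \<forall>x\<in>local_dom \<phi> c d.
        mean_curv_norm (metric M c) (metric N d) (local_rep \<phi> c d) x = k)"

end

theory Submission
  imports Defs
begin

text \<open>
  Write \<open>T = S\<^sub>2\<close> and \<open>\<tau> = tr T = 4 |H|\<^sup>2\<close>. Both equivalences say that a certain part of \<open>\<nabla>T\<close>
  vanishes exactly when \<open>d\<tau> = 0\<close>, and in dimension two this is linear algebra at a point once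
  \<open>div T = 0\<close> is known.

  The Codazzi defect \<open>(\<nabla>\<^sub>X T)(Y, Z) - (\<nabla>\<^sub>Y T)(X, Z)\<close> is alternating in \<open>X\<close>, \<open>Y\<close>, so on a surface it
  carries the same information as its contraction, and this contraction is \<open>div T - d\<tau> = - d\<tau>\<close>
  (\<open>codazzi_iff_trace_derivative_zero\<close>). In isothermal coordinates with conformal factor \<open>\<rho>\<^sup>2\<close> the
  vector field \<open>\<partial>\<^sub>z\<close> is parallel in the direction conjugate to it, so \<open>\<partial>\<^sub>z\<^sub>b\<^sub>a\<^sub>r Q = \<partial>\<^sub>z\<^sub>b\<^sub>a\<^sub>r T(\<partial>\<^sub>z, \<partial>\<^sub>z) / 4\<close>
  is a component of \<open>\<nabla>T\<close>. By \<open>div T = 0\<close> it equals \<open>\<rho>\<^sup>2 (- \<partial>\<^sub>1 \<tau> + i \<partial>\<^sub>2 \<tau>) / 32\<close>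
  (\<open>isothermal_divfree\<close>, \<open>hopf_holomorphic_iff_mean_curv_stationary\<close>).

  Two points remain. First, \<open>d\<tau> = 0\<close> in charts has to give one constant value of \<open>|H|\<close> on the
  connected surface. For this \<open>|H|\<close> must not depend on the charts
  (\<open>mean_curv_norm_invariant\<close>): the second fundamental form is the covariant Hessian of the
  immersion, which obeys a chain rule and vanishes for isometries of equal dimension.

  Second, the holomorphicity of \<open>Q\<close> speaks of isothermal charts only and would be void without
  them, so every point needs one (\<open>isothermal_coordinates\<close>, \<open>isothermal_chart_exists\<close>). With
  \<open>g = \<lambda> |dz + \<mu> dz\<^sup>*|\<^sup>2\<close> and \<open>\<mu> = 0\<close> at the given point, isothermal coordinates are the local
  diffeomorphisms \<open>W\<close> with \<open>W\<^sub>z\<^sub>b\<^sub>a\<^sub>r = \<mu> W\<^sub>z\<close>. The problem is moved to the torus: a smooth periodic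
  function, the identity near \<open>0\<close>, makes \<open>\<mu>\<close> periodic, and at a small scale its Fourier
  coefficients are small in \<open>l\<^sup>1\<close> (\<open>small_torus_coeff\<close>). There the operator
  \<open>\<partial>\<^sub>z (\<partial>\<^sub>z\<^sub>b\<^sub>a\<^sub>r)\<^sup>-\<^sup>1\<close> is a Fourier multiplier bounded by \<open>1\<close>, and the Beltrami equation is solved by a
  Neumann series in the algebra of absolutely convergent Fourier series (\<open>torus_beltrami\<close>).
  The solution is smooth because the same series converges in the weighted algebras with
  weights \<open>(1 + \<epsilon> |k|)\<^sup>s\<close>, for each \<open>s\<close> with a suitable \<open>\<epsilon>\<close> (\<open>beltrami_sum_rapid\<close>).
\<close>


section \<open>Calculus of smooth maps\<close>

lemma dd_eq: "(f has_derivative f') (at x) \<Longrightarrow> dd f x v = f' v"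
  unfolding dd_def by (metis frechet_derivative_at)

lemma dd_has_derivative: "f differentiable (at x) \<Longrightarrow> (f has_derivative dd f x) (at x)"
  unfolding dd_def[abs_def] by (simp add: frechet_derivative_works)

lemma dd_cong_open:
  assumes "open S" "x \<in> S" "\<And>y. y \<in> S \<Longrightarrow> f y = g y"
  shows "dd f x = dd g x" "f differentiable (at x) \<longleftrightarrow> g differentiable (at x)"
proof -
  have *: "(f has_derivative D) (at x) \<longleftrightarrow> (g has_derivative D) (at x)" for D
    using has_derivative_transform_within_open[OF _ assms(1,2)] assms(3)
    by (metis (no_types, lifting))
  show "dd f x = dd g x" "f differentiable (at x) \<longleftrightarrow> g differentiable (at x)"
    unfolding dd_def[abs_def] frechet_derivative_def differentiable_def by (simp_all add: *)
qed

lemma cd_Suc: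
  "cont_diff_on (Suc k) S f \<longleftrightarrow>
     (\<forall>x\<in>S. f differentiable (at x)) \<and> (\<forall>v. cont_diff_on k S (\<lambda>x. dd f x v))"
  by (simp add: dd_def)

declare cont_diff_on.simps(2) [simp del]

lemma cd_cong:
  assumes "open S" "\<And>x. x \<in> S \<Longrightarrow> f x = g x"
  shows "cont_diff_on k S f \<longleftrightarrow> cont_diff_on k S g"
  using assms(2)
proof (induction k arbitrary: f g)
  case 0 then show ?case by (simp cong: continuous_on_cong)
next
  case (Suc k)
  have 1: "dd f x = dd g x" "f differentiable (at x) \<longleftrightarrow> g differentiable (at x)" if "x \<in> S" for x
    using dd_cong_open[OF \<open>open S\<close> that Suc.prems] by auto
  have "cont_diff_on k S (\<lambda>x. dd f x v) \<longleftrightarrow> cont_diff_on k S (\<lambda>x. dd g x v)" for v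
    by (rule Suc.IH) (simp add: 1)
  then show ?case unfolding cd_Suc by (simp add: 1)
qed

text \<open>The derivative may be given by any formula; this is how all orders of differentiability
  are obtained below.\<close>

lemma cd_SucI:
  assumes "open S" "\<And>x. x \<in> S \<Longrightarrow> (f has_derivative f' x) (at x)"
    "\<And>v. cont_diff_on k S (\<lambda>x. f' x v)"
  shows "cont_diff_on (Suc k) S f"
proof -
  have "cont_diff_on k S (\<lambda>x. dd f x v)" for v
    using assms(3)[of v] cd_cong[OF assms(1), of "\<lambda>x. dd f x v" "\<lambda>x. f' x v" k]
      dd_eq[OF assms(2)] by simp
  then show ?thesis unfolding cd_Suc using assms(2) differentiableI by blast
qed

lemma cd_SucD: "cont_diff_on (Suc k) S f \<Longrightarrow> cont_diff_on k S f"
proof (induction k arbitrary: f)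
  case 0 then show ?case
    by (auto simp: cd_Suc intro!: continuous_at_imp_continuous_on differentiable_imp_continuous_within)
next
  case (Suc k) 
  have a: "\<And>x. x\<in>S \<Longrightarrow> f differentiable (at x)" "\<And>v. cont_diff_on (Suc k) S (\<lambda>x. dd f x v)"
    using Suc.prems unfolding cd_Suc[of "Suc k"] by auto
  show ?case unfolding cd_Suc[of k] using a(1) Suc.IH[OF a(2)] by simp
qed

lemma cd_subset: "cont_diff_on k S f \<Longrightarrow> T \<subseteq> S \<Longrightarrow> cont_diff_on k T f"
  by (induction k arbitrary: f) (auto simp: cd_Suc intro: continuous_on_subset)

lemma cd_const: "cont_diff_on k S (\<lambda>x. c)"
proof (induction k arbitrary: c)
  case (Suc k)
  have "dd (\<lambda>x. c) x v = 0" for x :: 'a and v by (rule dd_eq) simp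
  then show ?case unfolding cd_Suc using Suc by simp
qed simp

lemma cd_linear: assumes "bounded_linear f" "open S" shows "cont_diff_on k S f"
proof (cases k)
  case 0 then show ?thesis using assms(1) by (simp add: linear_continuous_on)
next
  case (Suc j) then show ?thesis
    using cd_SucI[OF assms(2) bounded_linear_imp_has_derivative[OF assms(1)]] cd_const by blast
qed

lemma cd_add:
  assumes "open S" "cont_diff_on k S f" "cont_diff_on k S g"
  shows "cont_diff_on k S (\<lambda>x. f x + g x)"
  using assms(2,3)
proof (induction k arbitrary: f g)
  case 0 then show ?case by (simp add: continuous_on_add)
next
  case (Suc k)
  show ?case
    by (rule cd_SucI[OF \<open>open S\<close>, where f'="\<lambda>x v. dd f x v + dd g x v"])
       (use Suc in \<open>auto simp: cd_Suc intro!: has_derivative_add dd_has_derivative\<close>)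
qed

lemma cd_bilinear:
  assumes b: "bounded_bilinear b" and "open S" "cont_diff_on k S f" "cont_diff_on k S g"
  shows "cont_diff_on k S (\<lambda>x. b (f x) (g x))"
  using assms(3,4)
proof (induction k arbitrary: f g)
  case 0 then show ?case by (simp add: bounded_bilinear.continuous_on[OF b])
next
  case (Suc k)
  show ?case
  proof (rule cd_SucI[OF \<open>open S\<close>, where f'="\<lambda>x v. b (f x) (dd g x v) + b (dd f x v) (g x)"])
    fix x assume "x \<in> S"
    then show "((\<lambda>x. b (f x) (g x)) has_derivative (\<lambda>v. b (f x) (dd g x v) + b (dd f x v) (g x))) (at x)"
      using Suc.prems unfolding cd_Suc
      by (intro bounded_bilinear.FDERIV[OF b] dd_has_derivative) auto
  next
    fix v
    show "cont_diff_on k S (\<lambda>x. b (f x) (dd g x v) + b (dd f x v) (g x))"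
      using Suc.prems cd_SucD[OF Suc.prems(1)] cd_SucD[OF Suc.prems(2)] unfolding cd_Suc
      by (intro cd_add[OF \<open>open S\<close>] Suc.IH) auto
  qed
qed

lemma cd_sum:
  assumes "open S" "\<And>i. i \<in> I \<Longrightarrow> cont_diff_on k S (f i)"
  shows "cont_diff_on k S (\<lambda>x. \<Sum>i\<in>I. f i x)"
  using assms(2)
  by (induction I rule: infinite_finite_induct) (auto intro: cd_const cd_add[OF assms(1)])

text \<open>By the chain rule the derivative of a composition is \<open>Dg (f x) (Df x v)\<close>. Expanding the
  vector \<open>Df x v\<close> in a basis turns it into a sum of products of compositions, to which the
  induction hypothesis applies. For this the middle space has to be Euclidean.\<close>

lemma cd_compose:
  fixes f :: "'a::real_normed_vector \<Rightarrow> 'b::euclidean_space" and g :: "'b \<Rightarrow> 'c::real_normed_vector"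
  assumes "open S" "open T" "f ` S \<subseteq> T" "cont_diff_on k S f" "cont_diff_on k T g"
  shows "cont_diff_on k S (\<lambda>x. g (f x))"
  using assms(4,5)
proof (induction k arbitrary: g)
  case 0 then show ?case using assms(3) by (auto intro: continuous_on_compose2)
next
  case (Suc k)
  have fk: "cont_diff_on k S f" using Suc.prems(1) by (rule cd_SucD)
  have df: "f differentiable (at x)" if "x \<in> S" for x using Suc.prems(1) that by (simp add: cd_Suc)
  have dg: "g differentiable (at y)" if "y \<in> T" for y using Suc.prems(2) that by (simp add: cd_Suc)
  show ?case
  proof (rule cd_SucI[OF \<open>open S\<close>, where f'="\<lambda>x v. \<Sum>b\<in>Basis. (dd f x v \<bullet> b) *\<^sub>R dd g (f x) b"])
    fix x assume x: "x \<in> S"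
    then have fx: "f x \<in> T" using assms(3) by auto
    have l: "linear (dd g (f x))"
      using dd_has_derivative[OF dg[OF fx]] has_derivative_linear by blast
    have "((\<lambda>x. g (f x)) has_derivative (\<lambda>v. dd g (f x) (dd f x v))) (at x)"
      using has_derivative_compose[OF dd_has_derivative[OF df[OF x]]] dd_has_derivative[OF dg[OF fx]]
      by blast
    also have "(\<lambda>v. dd g (f x) (dd f x v)) = (\<lambda>v. \<Sum>b\<in>Basis. (dd f x v \<bullet> b) *\<^sub>R dd g (f x) b)"
    proof
      fix v
      have "dd g (f x) (dd f x v) = dd g (f x) (\<Sum>b\<in>Basis. (dd f x v \<bullet> b) *\<^sub>R b)"
        by (simp add: euclidean_representation)
      also have "\<dots> = (\<Sum>b\<in>Basis. (dd f x v \<bullet> b) *\<^sub>R dd g (f x) b)"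
        by (simp add: linear_sum[OF l] linear_scale[OF l])
      finally show "dd g (f x) (dd f x v) = (\<Sum>b\<in>Basis. (dd f x v \<bullet> b) *\<^sub>R dd g (f x) b)" .
    qed
    finally show "((\<lambda>x. g (f x)) has_derivative (\<lambda>v. \<Sum>b\<in>Basis. (dd f x v \<bullet> b) *\<^sub>R dd g (f x) b)) (at x)" .
  next
    fix v
    show "cont_diff_on k S (\<lambda>x. \<Sum>b\<in>Basis. (dd f x v \<bullet> b) *\<^sub>R dd g (f x) b)"
    proof (rule cd_sum[OF \<open>open S\<close>])
      fix b :: 'b
      have "cont_diff_on k S (\<lambda>x. dd f x v \<bullet> b)"
        using Suc.prems(1) unfolding cd_Suc
        by (intro cd_bilinear[OF bounded_bilinear_inner \<open>open S\<close>] cd_const) auto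
      moreover have "cont_diff_on k S (\<lambda>x. dd g (f x) b)"
        using Suc.prems(2) unfolding cd_Suc by (intro Suc.IH fk) auto
      ultimately show "cont_diff_on k S (\<lambda>x. (dd f x v \<bullet> b) *\<^sub>R dd g (f x) b)"
        by (rule cd_bilinear[OF bounded_bilinear_scaleR \<open>open S\<close>])
    qed
  qed
qed

text \<open>The closure properties pass to \<open>smooth_on\<close> order by order.\<close>

lemma smooth_dd: "smooth_on S f \<Longrightarrow> smooth_on S (\<lambda>x. dd f x v)"
  unfolding smooth_on_def using cd_Suc by blast

lemma smooth_diff_at: "smooth_on S f \<Longrightarrow> x \<in> S \<Longrightarrow> f differentiable (at x)"
  unfolding smooth_on_def using cd_Suc by blast

lemma smooth_derivative: "smooth_on S f \<Longrightarrow> x \<in> S \<Longrightarrow> (f has_derivative dd f x) (at x)"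
  by (simp add: smooth_diff_at dd_has_derivative)

lemma smooth_linear_dd: "smooth_on S f \<Longrightarrow> x \<in> S \<Longrightarrow> linear (dd f x)"
  using smooth_derivative has_derivative_linear by blast

lemma smooth_continuous: "smooth_on S f \<Longrightarrow> continuous_on S f"
  unfolding smooth_on_def using cont_diff_on.simps(1) by blast

lemma smooth_cong:
  "open S \<Longrightarrow> (\<And>x. x \<in> S \<Longrightarrow> f x = g x) \<Longrightarrow> smooth_on S f \<longleftrightarrow> smooth_on S g"
  unfolding smooth_on_def using cd_cong by metis

lemma smooth_subset: "smooth_on S f \<Longrightarrow> T \<subseteq> S \<Longrightarrow> smooth_on T f"
  unfolding smooth_on_def using cd_subset by metis

lemma smooth_const: "smooth_on S (\<lambda>x. c)"
  by (simp add: smooth_on_def cd_const)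

lemma smooth_bounded_linear: "bounded_linear f \<Longrightarrow> open S \<Longrightarrow> smooth_on S f"
  by (simp add: smooth_on_def cd_linear)

lemma smooth_id: "open S \<Longrightarrow> smooth_on S (\<lambda>x. x)"
  by (simp add: smooth_bounded_linear bounded_linear_ident)

lemma smooth_add: "open S \<Longrightarrow> smooth_on S f \<Longrightarrow> smooth_on S g \<Longrightarrow> smooth_on S (\<lambda>x. f x + g x)"
  by (simp add: smooth_on_def cd_add)

lemma smooth_bilinear:
  "bounded_bilinear b \<Longrightarrow> open S \<Longrightarrow> smooth_on S f \<Longrightarrow> smooth_on S g \<Longrightarrow> smooth_on S (\<lambda>x. b (f x) (g x))"
  by (simp add: smooth_on_def cd_bilinear)

lemma smooth_sum:
  "open S \<Longrightarrow> (\<And>i. i \<in> I \<Longrightarrow> smooth_on S (f i)) \<Longrightarrow> smooth_on S (\<lambda>x. \<Sum>i\<in>I. f i x)"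
  by (simp add: smooth_on_def cd_sum)

lemma smooth_compose:
  fixes f :: "'a::real_normed_vector \<Rightarrow> 'b::euclidean_space"
  shows "open S \<Longrightarrow> open T \<Longrightarrow> smooth_on S f \<Longrightarrow> smooth_on T g \<Longrightarrow> f ` S \<subseteq> T \<Longrightarrow> smooth_on S (\<lambda>x. g (f x))"
  unfolding smooth_on_def using cd_compose by metis

lemma smooth_scaleR:
  "open S \<Longrightarrow> smooth_on S f \<Longrightarrow> smooth_on S g \<Longrightarrow> smooth_on S (\<lambda>x. f x *\<^sub>R g x)"
  by (rule smooth_bilinear[OF bounded_bilinear_scaleR])

lemma smooth_mult:
  fixes f g :: "'a::real_normed_vector \<Rightarrow> 'b::real_normed_algebra"
  shows "open S \<Longrightarrow> smooth_on S f \<Longrightarrow> smooth_on S g \<Longrightarrow> smooth_on S (\<lambda>x. f x * g x)"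
  by (rule smooth_bilinear[OF bounded_bilinear_mult])

lemma smooth_minus: "open S \<Longrightarrow> smooth_on S f \<Longrightarrow> smooth_on S (\<lambda>x. - f x)"
  using smooth_scaleR[of S "\<lambda>_. -1" f] by (simp add: smooth_const)

lemma smooth_diff: "open S \<Longrightarrow> smooth_on S f \<Longrightarrow> smooth_on S g \<Longrightarrow> smooth_on S (\<lambda>x. f x - g x)"
  using smooth_add[of S f "\<lambda>x. - g x"] by (simp add: smooth_minus)

lemma smooth_linear_comp:
  assumes "bounded_linear L" "open S" "smooth_on S f" shows "smooth_on S (\<lambda>x. L (f x))"
proof -
  have *: "cont_diff_on k S (\<lambda>x. L (f x))" if "cont_diff_on k S f" for k f
    using that
  proof (induction k arbitrary: f)
    case 0 then show ?case by (simp add: bounded_linear.continuous_on[OF assms(1)])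
  next
    case (Suc k) show ?case
      by (rule cd_SucI[OF \<open>open S\<close>, where f'="\<lambda>x v. L (dd f x v)"])
        (use Suc in \<open>auto simp: cd_Suc intro!: bounded_linear.has_derivative[OF assms(1)] dd_has_derivative\<close>)
  qed
  then show ?thesis using assms(3) by (simp add: smooth_on_def)
qed

lemma smooth_prod:
  fixes f :: "'i \<Rightarrow> 'a::real_normed_vector \<Rightarrow> real"
  assumes "open S" "\<And>i. i \<in> I \<Longrightarrow> smooth_on S (f i)"
  shows "smooth_on S (\<lambda>x. \<Prod>i\<in>I. f i x)"
  using assms(2)
  by (induction I rule: infinite_finite_induct) (auto intro: smooth_const smooth_mult[OF assms(1)])

lemma smooth_vec_lambda:
  fixes f :: "'i::finite \<Rightarrow> 'a::real_normed_vector \<Rightarrow> real"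
  assumes "open S" "\<And>i. smooth_on S (f i)"
  shows "smooth_on S (\<lambda>x. \<chi> i. f i x)"
proof -
  have e: "(\<lambda>x. \<chi> i. f i x) = (\<lambda>x. \<Sum>i\<in>UNIV. f i x *\<^sub>R axis i 1)"
    by (auto simp: vec_eq_iff axis_def if_distrib[of "\<lambda>z. _ * z"] sum.delta' cong: if_cong)
  show ?thesis unfolding e
    using assms by (intro smooth_sum smooth_scaleR smooth_const) auto
qed

lemma smooth_vec_nth:
  fixes f :: "'a::real_normed_vector \<Rightarrow> ('b::real_normed_vector)^'i::finite"
  shows "open S \<Longrightarrow> smooth_on S f \<Longrightarrow> smooth_on S (\<lambda>x. f x $ i)"
  by (rule smooth_linear_comp[OF bounded_linear_vec_nth])

text \<open>Elementary functions are smooth because their derivatives are built from themselves; the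
  order of differentiability is raised by one at a time.\<close>

lemma cd_real_SucI:
  fixes f :: "real \<Rightarrow> 'b::real_normed_vector"
  assumes "open S" "\<And>x. x \<in> S \<Longrightarrow> (f has_vector_derivative f' x) (at x)" "cont_diff_on k S f'"
  shows "cont_diff_on (Suc k) S f"
  using assms
  by (intro cd_SucI[OF assms(1), where f'="\<lambda>x v. v *\<^sub>R f' x"])
     (auto simp: has_vector_derivative_def intro!: cd_bilinear[OF bounded_bilinear_scaleR] cd_const)

lemma smooth_inverse_real: "smooth_on (- {0::real}) inverse"
  unfolding smooth_on_def
proof
  fix k show "cont_diff_on k (- {0::real}) inverse"
  proof (induction k)
    case 0 show ?case by (auto intro!: continuous_intros)
  next
    case (Suc k) show ?case
    proof (rule cd_real_SucI[where f'="\<lambda>x. (-1) *\<^sub>R (inverse x * inverse x)"])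
      show "cont_diff_on k (- {0::real}) (\<lambda>x. (-1) *\<^sub>R (inverse x * inverse x))"
        by (intro cd_bilinear[OF bounded_bilinear_scaleR] cd_bilinear[OF bounded_bilinear_mult] cd_const Suc) auto
      fix x :: real assume "x \<in> - {0}"
      then show "(inverse has_vector_derivative (-1) *\<^sub>R (inverse x * inverse x)) (at x)"
        by (auto simp: has_real_derivative_iff_has_vector_derivative[symmetric] intro!: derivative_eq_intros)
    qed auto
  qed
qed

lemma smooth_inverse:
  fixes f :: "'a::real_normed_vector \<Rightarrow> real"
  assumes "open S" "smooth_on S f" "\<And>x. x \<in> S \<Longrightarrow> f x \<noteq> 0"
  shows "smooth_on S (\<lambda>x. inverse (f x))"
  by (rule smooth_compose[OF assms(1) _ assms(2) smooth_inverse_real]) (use assms(3) in auto)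

lemma smooth_divide:
  fixes f g :: "'a::real_normed_vector \<Rightarrow> real"
  assumes "open S" "smooth_on S f" "smooth_on S g" "\<And>x. x \<in> S \<Longrightarrow> g x \<noteq> 0"
  shows "smooth_on S (\<lambda>x. f x / g x)"
  unfolding divide_inverse using assms by (intro smooth_mult smooth_inverse) auto

lemma smooth_sqrt_real: "smooth_on {0::real<..} sqrt"
  unfolding smooth_on_def
proof
  fix k show "cont_diff_on k {0::real<..} sqrt"
  proof (induction k)
    case 0 show ?case by (auto intro!: continuous_intros)
  next
    case (Suc k) show ?case
    proof (rule cd_real_SucI[where f'="\<lambda>x. inverse (sqrt x) * (1/2)"])
      have "cont_diff_on k {0::real<..} (\<lambda>x. inverse (sqrt x))"
        using smooth_inverse_real
        by (intro cd_compose[where T="-{0}" and g=inverse and f=sqrt] Suc) (auto simp: smooth_on_def)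
      then show "cont_diff_on k {0::real<..} (\<lambda>x. inverse (sqrt x) * (1/2))"
        by (intro cd_bilinear[OF bounded_bilinear_mult] cd_const) auto
      fix x :: real assume "x \<in> {0<..}"
      then show "(sqrt has_vector_derivative inverse (sqrt x) * (1/2)) (at x)"
        by (auto simp: has_real_derivative_iff_has_vector_derivative[symmetric] intro!: derivative_eq_intros)
    qed auto
  qed
qed

lemma smooth_sqrt:
  fixes f :: "'a::real_normed_vector \<Rightarrow> real"
  assumes "open S" "smooth_on S f" "\<And>x. x \<in> S \<Longrightarrow> f x > 0"
  shows "smooth_on S (\<lambda>x. sqrt (f x))"
  by (rule smooth_compose[OF assms(1) _ assms(2) smooth_sqrt_real]) (use assms(3) in auto)

lemma smooth_sin_cos: "smooth_on (UNIV::real set) sin" "smooth_on (UNIV::real set) cos"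
proof -
  have "cont_diff_on k (UNIV::real set) sin \<and> cont_diff_on k (UNIV::real set) cos" for k
  proof (induction k)
    case 0 show ?case by (auto intro!: continuous_intros)
  next
    case (Suc k)
    have "cont_diff_on k UNIV (\<lambda>x::real. (-1) *\<^sub>R sin x)"
      using Suc by (intro cd_bilinear[OF bounded_bilinear_scaleR] cd_const) auto
    then have "cont_diff_on (Suc k) (UNIV::real set) cos"
      by (intro cd_real_SucI[where f'="\<lambda>x::real. (-1) *\<^sub>R sin x"])
         (auto simp: has_real_derivative_iff_has_vector_derivative[symmetric] intro!: derivative_eq_intros)
    moreover have "cont_diff_on (Suc k) (UNIV::real set) sin"
      using Suc by (intro cd_real_SucI[where f'=cos])
         (auto simp: has_real_derivative_iff_has_vector_derivative[symmetric] intro!: derivative_eq_intros)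
    ultimately show ?case by blast
  qed
  then show "smooth_on (UNIV::real set) sin" "smooth_on (UNIV::real set) cos"
    by (simp_all add: smooth_on_def)
qed

lemma smooth_arctan: "smooth_on (UNIV::real set) arctan"
  unfolding smooth_on_def
proof
  fix k
  have "smooth_on UNIV (\<lambda>x::real. inverse (1 + x * x))"
    by (intro smooth_inverse smooth_add smooth_const smooth_mult smooth_id)
       (auto simp: add_nonneg_eq_0_iff)
  then have "cont_diff_on (Suc k) UNIV arctan"
    by (intro cd_real_SucI[where f'="\<lambda>x::real. inverse (1 + x * x)"])
       (auto simp: smooth_on_def has_real_derivative_iff_has_vector_derivative[symmetric] power2_eq_square
          intro!: derivative_eq_intros)
  then show "cont_diff_on k (UNIV::real set) arctan" by (rule cd_SucD)
qed


lemma smooth_det: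
  fixes A :: "'a::real_normed_vector \<Rightarrow> real^'n^'n"
  assumes "open S" "\<And>i j. smooth_on S (\<lambda>x. A x $ i $ j)"
  shows "smooth_on S (\<lambda>x. det (A x))"
  unfolding det_def
  by (intro smooth_sum smooth_mult smooth_prod smooth_const assms)

lemma matrix_mult_matrix_inv: "invertible (A::real^'n^'n) \<Longrightarrow> A ** matrix_inv A = mat 1"
  unfolding invertible_def matrix_inv_def by (rule someI2_ex) auto

text \<open>Cramer's rule exhibits the entries of the inverse matrix as rational functions.\<close>

lemma matrix_inv_mult_eq_cramer:
  fixes A :: "real^'n^'n"
  assumes "det A \<noteq> 0"
  shows "matrix_inv A *v b = (\<chi> k. det (\<chi> i j. if j = k then b $ i else A $ i $ j) / det A)"
proof -
  have "invertible A" using assms by (simp add: invertible_det_nz)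
  then have "A *v (matrix_inv A *v b) = b"
    by (simp add: matrix_vector_mul_assoc matrix_mult_matrix_inv)
  then show ?thesis using cramer[OF assms] by blast
qed

lemma smooth_matrix_inv_mult:
  fixes A :: "'a::real_normed_vector \<Rightarrow> real^'n^'n"
  assumes "open S" "\<And>i j. smooth_on S (\<lambda>x. A x $ i $ j)" "\<And>x. x \<in> S \<Longrightarrow> det (A x) \<noteq> 0"
    "\<And>i. smooth_on S (\<lambda>x. b x $ i)"
  shows "smooth_on S (\<lambda>x. matrix_inv (A x) *v b x)"
proof -
  have "smooth_on S (\<lambda>x. if j = k then b x $ i else A x $ i $ j)" for i j k
    using assms by (cases "j = k") auto
  then have "smooth_on S (\<lambda>x. \<chi> k. det (\<chi> i j. if j = k then b x $ i else A x $ i $ j) / det (A x))"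
    by (intro smooth_vec_lambda smooth_divide smooth_det) (use assms in auto)
  then show ?thesis
    using smooth_cong[OF \<open>open S\<close>, of "\<lambda>x. matrix_inv (A x) *v b x"
      "\<lambda>x. \<chi> k. det (\<chi> i j. if j = k then b x $ i else A x $ i $ j) / det (A x)"]
      matrix_inv_mult_eq_cramer assms(3) by blast
qed

text \<open>The derivative of the inverse map \<open>g\<close> is \<open>(Df(g y))\<^sup>-\<^sup>1\<close>, so each order of
  differentiability of \<open>g\<close> yields the next one.\<close>

lemma smooth_inverse_map:
  fixes f :: "real^'n \<Rightarrow> real^'n"
  assumes "open U" "smooth_on U f" "\<And>x. x \<in> U \<Longrightarrow> g (f x) = x" "\<And>x. x \<in> U \<Longrightarrow> inj (dd f x)"
  shows "open (f ` U)" "smooth_on (f ` U) g"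
proof -
  define K where "K x v = matrix_inv (matrix (dd f x)) *v v" for x v
  have inj: "inj_on f U" using assms(3) by (metis inj_onI)
  show op: "open (f ` U)"
    using invariance_of_domain[OF smooth_continuous[OF assms(2)] \<open>open U\<close> inj] .
  have lin: "linear (dd f x)" if "x \<in> U" for x using smooth_linear_dd[OF assms(2) that] .
  have det: "det (matrix (dd f x)) \<noteq> 0" if "x \<in> U" for x
    using assms(4)[OF that] lin[OF that] det_nz_iff_inj by blast
  have smK: "smooth_on U (\<lambda>x. K x v)" for v
    unfolding K_def
    by (rule smooth_matrix_inv_mult[OF \<open>open U\<close> _ det])
       (auto simp: matrix_def intro!: smooth_const smooth_vec_nth smooth_dd assms)
  have dg: "(g has_derivative K (g y)) (at y)" if y: "y \<in> f ` U" for y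
  proof -
    obtain x where x: "x \<in> U" "y = f x" using y by auto
    have "dd f x \<circ> K x = id"
    proof
      fix v
      have "invertible (matrix (dd f x))" using det[OF x(1)] by (simp add: invertible_det_nz)
      then have "matrix (dd f x) *v K x v = v"
        unfolding K_def by (simp add: matrix_vector_mul_assoc matrix_mult_matrix_inv)
      then show "(dd f x \<circ> K x) v = id v" by (simp add: matrix_works linear_matrix_vector_mul_eq lin[OF x(1)])
    qed
    then have "(g has_derivative K x) (at (f x))"
      using has_derivative_inverse_on[OF \<open>open U\<close> smooth_derivative[OF assms(2)] assms(3), where g'=K and x=x] x
      by blast
    then show ?thesis using x assms(3) by simp
  qed
  have "cont_diff_on k (f ` U) g" for k
  proof (induction k)
    case 0
    show ?case
      using has_derivative_continuous[OF dg] by (auto intro!: continuous_at_imp_continuous_on)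
  next
    case (Suc k)
    show ?case
    proof (rule cd_SucI[OF op dg])
      fix v
      show "cont_diff_on k (f ` U) (\<lambda>y. K (g y) v)"
        by (rule cd_compose[OF op \<open>open U\<close> _ Suc, where g="\<lambda>x. K x v"])
           (use assms(3) smK in \<open>auto simp: smooth_on_def\<close>)
    qed
  qed
  then show "smooth_on (f ` U) g" by (simp add: smooth_on_def)
qed

lemma dd_line_vec:
  assumes "F differentiable (at (p + t *\<^sub>R v))"
  shows "((\<lambda>t. F (p + t *\<^sub>R v)) has_vector_derivative dd F (p + t *\<^sub>R v) v) (at t)"
proof -
  have "((\<lambda>t. p + t *\<^sub>R v) has_derivative (\<lambda>s. s *\<^sub>R v)) (at t)"
    by (auto intro!: derivative_eq_intros)
  from has_derivative_compose[OF this dd_has_derivative[OF assms]]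
  have "((\<lambda>t. F (p + t *\<^sub>R v)) has_derivative (\<lambda>s. dd F (p + t *\<^sub>R v) (s *\<^sub>R v))) (at t)" .
  moreover have "dd F (p + t *\<^sub>R v) (s *\<^sub>R v) = s *\<^sub>R dd F (p + t *\<^sub>R v) v" for s
    by (rule linear_scale[OF has_derivative_linear[OF dd_has_derivative[OF assms]]])
  ultimately show ?thesis by (simp add: has_vector_derivative_def)
qed

lemma dd_line:
  fixes F :: "'a::real_normed_vector \<Rightarrow> real"
  assumes "F differentiable (at (p + t *\<^sub>R v))"
  shows "((\<lambda>t. F (p + t *\<^sub>R v)) has_real_derivative dd F (p + t *\<^sub>R v) v) (at t)"
  using dd_line_vec[OF assms] by (simp add: has_real_derivative_iff_has_vector_derivative)

text \<open>A second difference quotient is a value of \<open>D\<^sub>v D\<^sub>u F\<close> nearby. Since the second difference is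
  symmetric in \<open>u\<close> and \<open>v\<close>, continuity yields the symmetry of second derivatives.\<close>

lemma second_difference_mvt:
  fixes F :: "'a::real_normed_vector \<Rightarrow> real"
  assumes "smooth_on S F" "h > 0"
    and S: "\<And>s t. 0 \<le> s \<Longrightarrow> s \<le> h \<Longrightarrow> 0 \<le> t \<Longrightarrow> t \<le> h \<Longrightarrow> x + s *\<^sub>R u + t *\<^sub>R v \<in> S"
  shows "\<exists>s t. 0 \<le> s \<and> s \<le> h \<and> 0 \<le> t \<and> t \<le> h \<and>
    F (x + h *\<^sub>R u + h *\<^sub>R v) - F (x + h *\<^sub>R u) - F (x + h *\<^sub>R v) + F x =
    h * h * dd (\<lambda>y. dd F y u) (x + s *\<^sub>R u + t *\<^sub>R v) v"
proof -
  let ?\<phi> = "\<lambda>s. F ((x + h *\<^sub>R v) + s *\<^sub>R u) - F (x + s *\<^sub>R u)"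
  have "\<exists>s. 0 < s \<and> s < h \<and> ?\<phi> h - ?\<phi> 0 =
      (h - 0) * (dd F ((x + h *\<^sub>R v) + s *\<^sub>R u) u - dd F (x + s *\<^sub>R u) u)"
  proof (rule MVT2[OF \<open>h > 0\<close>])
    fix s assume s: "0 \<le> s" "s \<le> h"
    have "x + h *\<^sub>R v + s *\<^sub>R u \<in> S" "x + s *\<^sub>R u \<in> S"
      using S[OF s, of h] S[OF s, of 0] \<open>h > 0\<close> by (simp_all add: add_ac)
    then show "DERIV ?\<phi> s :> dd F ((x + h *\<^sub>R v) + s *\<^sub>R u) u - dd F (x + s *\<^sub>R u) u"
      by (intro DERIV_diff dd_line smooth_diff_at[OF assms(1)])
  qed
  then obtain s where s: "0 < s" "s < h"
    "?\<phi> h - ?\<phi> 0 = h * (dd F ((x + h *\<^sub>R v) + s *\<^sub>R u) u - dd F (x + s *\<^sub>R u) u)" by auto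
  let ?\<psi> = "\<lambda>t. dd F (x + s *\<^sub>R u + t *\<^sub>R v) u"
  have "\<exists>t. 0 < t \<and> t < h \<and> ?\<psi> h - ?\<psi> 0 =
      (h - 0) * dd (\<lambda>y. dd F y u) (x + s *\<^sub>R u + t *\<^sub>R v) v"
  proof (rule MVT2[OF \<open>h > 0\<close>])
    fix t assume t: "0 \<le> t" "t \<le> h"
    show "DERIV ?\<psi> t :> dd (\<lambda>y. dd F y u) (x + s *\<^sub>R u + t *\<^sub>R v) v"
      using S[of s t] s t by (intro dd_line smooth_diff_at[OF smooth_dd[OF assms(1)]]) auto
  qed
  then obtain t where t: "0 < t" "t < h" "?\<psi> h - ?\<psi> 0 = h * dd (\<lambda>y. dd F y u) (x + s *\<^sub>R u + t *\<^sub>R v) v"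
    by auto
  have "F (x + h *\<^sub>R u + h *\<^sub>R v) - F (x + h *\<^sub>R u) - F (x + h *\<^sub>R v) + F x = ?\<phi> h - ?\<phi> 0"
    by (simp add: add_ac)
  also have "\<dots> = h * (?\<psi> h - ?\<psi> 0)" using s(3) by (simp add: add_ac)
  also have "\<dots> = h * h * dd (\<lambda>y. dd F y u) (x + s *\<^sub>R u + t *\<^sub>R v) v" using t(3) by simp
  finally show ?thesis using s t by (intro exI[of _ s] exI[of _ t]) auto
qed

lemma hess_sym_real:
  fixes F :: "'a::real_normed_vector \<Rightarrow> real"
  assumes "open S" "smooth_on S F" "x \<in> S"
  shows "dd (\<lambda>y. dd F y u) x v = dd (\<lambda>y. dd F y v) x u"
proof (rule ccontr)
  let ?a = "\<lambda>y. dd (\<lambda>y. dd F y u) y v" and ?b = "\<lambda>y. dd (\<lambda>y. dd F y v) y u"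
  assume ne: "?a x \<noteq> ?b x"
  define e where "e = \<bar>?a x - ?b x\<bar> / 2"
  have e: "e > 0" using ne by (simp add: e_def)
  have "continuous_on S ?a" "continuous_on S ?b"
    using assms(2) by (auto intro!: smooth_continuous smooth_dd)
  then have ca: "isCont ?a x" and cb: "isCont ?b x"
    using assms by (auto simp: continuous_on_eq_continuous_at)
  obtain da where da: "da > 0" "\<And>y. dist y x < da \<Longrightarrow> \<bar>?a y - ?a x\<bar> < e"
    using ca e unfolding continuous_at_eps_delta dist_real_def by blast
  obtain db where db: "db > 0" "\<And>y. dist y x < db \<Longrightarrow> \<bar>?b y - ?b x\<bar> < e"
    using cb e unfolding continuous_at_eps_delta dist_real_def by blast
  obtain dS where dS: "dS > 0" "ball x dS \<subseteq> S" using assms open_contains_ball by blast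
  define d where "d = min dS (min da db)"
  have d: "d > 0" "d \<le> dS" "d \<le> da" "d \<le> db" using da db dS by (auto simp: d_def)
  define h where "h = d / (2 * (norm u + norm v + 1))"
  have pos: "norm u + norm v + 1 > 0" by (smt (verit) norm_ge_zero)
  have h: "h > 0" using d(1) pos by (simp add: h_def)
  have near: "dist (x + s *\<^sub>R p + t *\<^sub>R q) x < d"
    if "0 \<le> s" "s \<le> h" "0 \<le> t" "t \<le> h" "{p, q} = {u, v}" for s t p q
  proof -
    have "dist (x + s *\<^sub>R p + t *\<^sub>R q) x = norm (s *\<^sub>R p + t *\<^sub>R q)"
      by (simp add: dist_norm add.assoc)
    also have "\<dots> \<le> norm (s *\<^sub>R p) + norm (t *\<^sub>R q)" by (rule norm_triangle_ineq)
    also have "\<dots> \<le> h * norm p + h * norm q" 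
      using that by (auto intro!: add_mono mult_right_mono)
    also have "\<dots> \<le> h * (norm u + norm v)"
    proof -
      have "p = u \<and> q = v \<or> p = v \<and> q = u" using that(5) by (metis doubleton_eq_iff)
      then show ?thesis using h by (auto simp: algebra_simps)
    qed
    also have "\<dots> < h * (2 * (norm u + norm v + 1))" 
      by (rule mult_strict_left_mono[OF _ h]) (smt (verit) norm_ge_zero)
    also have "\<dots> = d" using pos by (simp add: h_def)
    finally show ?thesis .
  qed
  have inS: "x + s *\<^sub>R p + t *\<^sub>R q \<in> S" if "0 \<le> s" "s \<le> h" "0 \<le> t" "t \<le> h" "{p, q} = {u, v}" for s t p q
    using near[OF that] dS d by (auto simp: dist_commute subset_iff)
  obtain s t where st: "0 \<le> s" "s \<le> h" "0 \<le> t" "t \<le> h"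
     "F (x + h *\<^sub>R u + h *\<^sub>R v) - F (x + h *\<^sub>R u) - F (x + h *\<^sub>R v) + F x = h * h * ?a (x + s *\<^sub>R u + t *\<^sub>R v)"
    using second_difference_mvt[OF assms(2) h inS[of _ _ u v]] by auto
  obtain s' t' where st': "0 \<le> s'" "s' \<le> h" "0 \<le> t'" "t' \<le> h"
     "F (x + h *\<^sub>R v + h *\<^sub>R u) - F (x + h *\<^sub>R v) - F (x + h *\<^sub>R u) + F x = h * h * ?b (x + s' *\<^sub>R v + t' *\<^sub>R u)"
    using second_difference_mvt[OF assms(2) h inS[of _ _ v u]] by (auto simp: insert_commute)
  have "h * h * ?a (x + s *\<^sub>R u + t *\<^sub>R v) = h * h * ?b (x + s' *\<^sub>R v + t' *\<^sub>R u)"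
    using st(5) st'(5)
    by (simp only: add.assoc add.commute[of "h *\<^sub>R v" "h *\<^sub>R u"])
  then have eq: "?a (x + s *\<^sub>R u + t *\<^sub>R v) = ?b (x + s' *\<^sub>R v + t' *\<^sub>R u)" using h by simp
  have "dist (x + s *\<^sub>R u + t *\<^sub>R v) x < da" using near[OF st(1-4), of u v] d by simp
  from da(2)[OF this] have 1: "\<bar>?a (x + s *\<^sub>R u + t *\<^sub>R v) - ?a x\<bar> < e" .
  have "dist (x + s' *\<^sub>R v + t' *\<^sub>R u) x < db" using near[OF st'(1-4), of v u] d by (simp add: insert_commute)
  from db(2)[OF this] have 2: "\<bar>?b (x + s' *\<^sub>R v + t' *\<^sub>R u) - ?b x\<bar> < e" .
  have "False" if "\<bar>p - a\<bar> < \<bar>a - b\<bar> / 2" "\<bar>p - b\<bar> < \<bar>a - b\<bar> / 2" for p a b :: real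
    using that abs_triangle_ineq[of "a - p" "p - b"] abs_minus_commute[of a p] by simp
  then show False using 1 2 eq unfolding e_def by metis
qed

lemma hess_sym:
  fixes F :: "'a::real_normed_vector \<Rightarrow> 'b::euclidean_space"
  assumes "open S" "smooth_on S F" "x \<in> S"
  shows "dd (\<lambda>y. dd F y u) x v = dd (\<lambda>y. dd F y v) x u"
proof (rule euclidean_eqI)
  fix b :: 'b assume "b \<in> Basis"
  have sm: "smooth_on S (\<lambda>y. F y \<bullet> b)"
    by (rule smooth_linear_comp[OF bounded_linear_inner_left assms(1,2)])
  have c: "dd (\<lambda>y. G y \<bullet> b) y w = dd G y w \<bullet> b" if "smooth_on S G" "y \<in> S" for G y w
    using smooth_derivative[OF that]
    by (intro dd_eq bounded_linear.has_derivative[OF bounded_linear_inner_left])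
  have c2: "dd (\<lambda>y. dd F y u \<bullet> b) x v = dd (\<lambda>y. dd (\<lambda>y. F y \<bullet> b) y u) x v" for u v
    using dd_cong_open(1)[OF assms(1,3), of "\<lambda>y. dd F y u \<bullet> b" "\<lambda>y. dd (\<lambda>y. F y \<bullet> b) y u"]
      c[OF assms(2)] by simp
  show "dd (\<lambda>y. dd F y u) x v \<bullet> b = dd (\<lambda>y. dd F y v) x u \<bullet> b"
    using hess_sym_real[OF assms(1) sm assms(3), of u v]
    by (simp add: c[OF smooth_dd[OF assms(2)] assms(3), symmetric] c2)
qed

section \<open>A smooth periodic function which is the identity near zero\<close>

text \<open>The functions \<open>x\<^sup>-\<^sup>n e\<^sup>-\<^sup>1\<^sup>/\<^sup>x\<close>, extended by zero. The exponent \<open>n\<close> is there because the span of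
  the family is closed under differentiation, which gives smoothness at \<open>0\<close>.\<close>

definition flat_exp :: "nat \<Rightarrow> real \<Rightarrow> real" where
  "flat_exp n x = (if x > 0 then (1 / x) ^ n * exp (- (1 / x)) else 0)"

lemma flat_exp_tendsto_0: "(flat_exp n \<longlongrightarrow> 0) (at 0)"
proof -
  have r: "(flat_exp n \<longlongrightarrow> 0) (at_right 0)"
  proof (rule Lim_transform_eventually)
    show "((\<lambda>x::real. inverse x ^ n / exp (inverse x)) \<longlongrightarrow> 0) (at_right 0)"
      using filterlim_compose[OF tendsto_power_div_exp_0 filterlim_inverse_at_top_right] .
    show "\<forall>\<^sub>F x in at_right 0. inverse x ^ n / exp (inverse x) = flat_exp n x"
      by (auto simp: flat_exp_def eventually_at_filter exp_minus field_simps)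
  qed
  have l: "(flat_exp n \<longlongrightarrow> 0) (at_left 0)"
  proof (rule Lim_transform_eventually)
    show "((\<lambda>x::real. 0) \<longlongrightarrow> (0::real)) (at_left 0)" by simp
    show "\<forall>\<^sub>F x in at_left 0. 0 = flat_exp n x"
      by (auto simp: flat_exp_def eventually_at_filter)
  qed
  show ?thesis using l r filterlim_split_at by blast
qed

lemma flat_exp_deriv:
  "(flat_exp n has_real_derivative flat_exp (n + 2) x - real n * flat_exp (n + 1) x) (at x)"
proof -
  consider "x > 0" | "x < 0" | "x = 0" by linarith
  then show ?thesis
  proof cases
    case 1
    have "((\<lambda>x. (1 / x) ^ n * exp (- (1 / x))) has_real_derivative
        flat_exp (n + 2) x - real n * flat_exp (n + 1) x) (at x)"
    proof (cases n)
      case 0 then show ?thesis using 1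
        by (auto simp: flat_exp_def power2_eq_square intro!: derivative_eq_intros)
    next
      case (Suc m)
      have i: "((\<lambda>x. 1 / x) has_real_derivative - (1 / x^2)) (at x)"
        using 1 by (auto simp: power2_eq_square intro!: derivative_eq_intros)
      have p: "((\<lambda>x. (1 / x) ^ Suc m) has_real_derivative real (Suc m) * (- (1 / x^2) * (1 / x) ^ m)) (at x)"
        using DERIV_power[OF i, of "Suc m"] by simp
      have e: "((\<lambda>x. exp (- (1 / x))) has_real_derivative exp (- (1 / x)) * (1 / x^2)) (at x)"
        using DERIV_chain2[OF DERIV_exp DERIV_minus[OF i]] by simp
      have "((\<lambda>x. (1 / x) ^ Suc m * exp (- (1 / x))) has_real_derivative
          real (Suc m) * (- (1 / x^2) * (1 / x) ^ m) * exp (- (1 / x))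
          + exp (- (1 / x)) * (1 / x^2) * (1 / x) ^ Suc m) (at x)"
        by (rule DERIV_mult[OF p e])
      then show ?thesis using 1 unfolding Suc
        by (simp add: flat_exp_def field_simps power2_eq_square)
    qed
    then show ?thesis
      by (rule has_field_derivative_transform_within_open[where S="{0<..}"]) (use 1 in \<open>auto simp: flat_exp_def\<close>)
  next
    case 2
    have "((\<lambda>x. 0) has_real_derivative flat_exp (n + 2) x - real n * flat_exp (n + 1) x) (at x)"
      using 2 by (simp add: flat_exp_def)
    then show ?thesis
      by (rule has_field_derivative_transform_within_open[where S="{..<0}"]) (use 2 in \<open>auto simp: flat_exp_def\<close>)
  next
    case 3
    have e: "(flat_exp n h - flat_exp n 0) / (h - 0) = flat_exp (n + 1) h" for h
      by (auto simp: flat_exp_def)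
    have "((\<lambda>h. (flat_exp n h - flat_exp n 0) / (h - 0)) \<longlongrightarrow> 0) (at 0)"
      unfolding e by (rule flat_exp_tendsto_0)
    then show ?thesis using 3 by (simp add: has_field_derivative_iff flat_exp_def)
  qed
qed

lemma smooth_flat_exp: "smooth_on UNIV (flat_exp n)"
proof -
  have "cont_diff_on k UNIV (flat_exp n)" for k
  proof (induction k arbitrary: n)
    case 0 show ?case
      using flat_exp_deriv by (auto intro!: continuous_at_imp_continuous_on DERIV_isCont)
  next
    case (Suc k)
    show ?case
    proof (rule cd_real_SucI[where f'="\<lambda>x. flat_exp (n + 2) x + (- real n) *\<^sub>R flat_exp (n + 1) x"])
      show "cont_diff_on k UNIV (\<lambda>x. flat_exp (n + 2) x + (- real n) *\<^sub>R flat_exp (n + 1) x)"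
        by (intro cd_add cd_bilinear[OF bounded_bilinear_scaleR] cd_const Suc) auto
    qed (use flat_exp_deriv in \<open>auto simp: has_real_derivative_iff_has_vector_derivative[symmetric]\<close>)
  qed
  then show ?thesis by (simp add: smooth_on_def)
qed

text \<open>With \<open>t/2\<close> as angle, \<open>sin t / (1 + cos t)\<close> is \<open>tan (t/2)\<close>. The flat correction in the
  denominator removes the pole at \<open>t = \<pi>\<close> and vanishes where \<open>cos t \<ge> 1/2\<close>, so that
  \<open>sawtooth\<close> is a smooth periodic function which is the identity near \<open>0\<close>.\<close>

definition sawtooth :: "real \<Rightarrow> real" where
  "sawtooth t = 2 * arctan (sin t / (1 + cos t + flat_exp 0 (1/2 - cos t)))"

lemma sawtooth_denominator_pos: "1 + cos t + flat_exp 0 (1/2 - cos t) > 0"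
proof (cases "cos t > -1")
  case True
  then have "1 + cos t > 0" by simp
  moreover have "flat_exp 0 (1/2 - cos t) \<ge> 0" by (simp add: flat_exp_def)
  ultimately show ?thesis by (rule add_pos_nonneg)
next
  case False
  then have "cos t = -1" using cos_ge_minus_one[of t] by linarith
  then show ?thesis by (simp add: flat_exp_def)
qed

lemma smooth_sawtooth: "smooth_on UNIV sawtooth"
proof -
  have "smooth_on UNIV (\<lambda>t. flat_exp 0 (1/2 - cos t))"
    by (intro smooth_compose[OF _ _ _ smooth_flat_exp, where f="\<lambda>t. 1/2 - cos t"]
        smooth_diff smooth_const smooth_sin_cos) auto
  then have "smooth_on UNIV (\<lambda>t. sin t / (1 + cos t + flat_exp 0 (1/2 - cos t)))"
    using sawtooth_denominator_pos
    by (intro smooth_divide smooth_add smooth_const smooth_sin_cos) (auto simp: less_le)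
  then have "smooth_on UNIV (\<lambda>t. arctan (sin t / (1 + cos t + flat_exp 0 (1/2 - cos t))))"
    by (intro smooth_compose[OF _ _ _ smooth_arctan]) auto
  then show ?thesis unfolding sawtooth_def[abs_def] by (intro smooth_mult smooth_const) auto
qed

lemma sawtooth_periodic: "sawtooth (t + 2 * pi) = sawtooth t"
  by (simp add: sawtooth_def)

lemma sawtooth_near_0: assumes "\<bar>t\<bar> < 1" shows "sawtooth t = t"
proof -
  have "\<bar>t\<bar> \<le> pi / 3" using assms pi_gt3 by linarith
  then have "cos (pi/3) \<le> cos \<bar>t\<bar>" by (intro cos_monotone_0_pi_le) (use pi_gt3 in auto)
  then have c: "cos t \<ge> 1/2" by (simp add: cos_60)
  then have "sawtooth t = 2 * arctan (sin t / (1 + cos t))" by (simp add: sawtooth_def flat_exp_def)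
  also have "sin t / (1 + cos t) = tan (t/2)" using tan_half[of "t/2"] by (simp add: add.commute)
  also have "arctan (tan (t/2)) = t/2" by (rule arctan_tan) (use assms pi_gt3 in auto)
  finally show ?thesis by simp
qed

lemma sawtooth_bound: "\<bar>sawtooth t\<bar> \<le> 4"
  using arctan_bounded[of "sin t / (1 + cos t + flat_exp 0 (1/2 - cos t))"] pi_less_4
  unfolding sawtooth_def by linarith


section \<open>Fourier series of periodic functions of one variable\<close>

definition fourier :: "(real \<Rightarrow> complex) \<Rightarrow> int \<Rightarrow> complex" where
  "fourier f k = integral {-pi..pi} (\<lambda>t. f t * cis (- (of_int k * t))) / of_real (2 * pi)"

lemma cis_has_vector_derivative:
  "((\<lambda>t. cis (a * t)) has_vector_derivative \<i> * of_real a * cis (a * t)) (at t within A)"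
proof -
  have "((\<lambda>z. exp (\<i> * of_real a * z)) has_field_derivative exp (\<i> * of_real a * of_real t) * (\<i> * of_real a)) (at (of_real t))"
    by (auto intro!: derivative_eq_intros)
  from has_vector_derivative_real_field[OF this]
  show ?thesis by (simp add: cis_conv_exp mult_ac)
qed

lemma continuous_on_cis_mult: "continuous_on A (\<lambda>t. cis (a * t))"
  by (intro continuous_intros)

lemma fourier_integrable:
  "continuous_on UNIV f \<Longrightarrow> (\<lambda>t. f t * cis (- (of_int k * t))) integrable_on {-pi..pi}"
  using continuous_on_cis_mult[of "{-pi..pi}" "- of_int k"]
  by (intro integrable_continuous_real continuous_on_mult) (auto intro: continuous_on_subset)

lemma fourier_bound:
  assumes "continuous_on UNIV f" "\<And>t. t \<in> {-pi..pi} \<Longrightarrow> norm (f t) \<le> B"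
  shows "norm (fourier f k) \<le> B"
proof -
  have "norm (integral {-pi..pi} (\<lambda>t. f t * cis (- (of_int k * t)))) \<le> B * (pi - (- pi))"
    using assms continuous_on_cis_mult[of "{-pi..pi}" "- of_int k"]
    by (intro integral_bound continuous_on_mult) (auto simp: norm_mult intro: continuous_on_subset)
  then show ?thesis by (simp add: fourier_def norm_divide divide_le_eq)
qed

lemma fourier_mult: "fourier (\<lambda>t. c * f t) k = c * fourier f k"
  by (simp add: fourier_def mult.assoc)

lemma fourier_diff:
  assumes "continuous_on UNIV f" "continuous_on UNIV g"
  shows "fourier (\<lambda>t. f t - g t) k = fourier f k - fourier g k"
  unfolding fourier_def left_diff_distrib
  by (subst integral_diff) (auto intro: fourier_integrable assms simp: diff_divide_distrib)

lemma cis_int_periodic: "cis (of_int k * (t + 2 * pi)) = cis (of_int k * t)"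
proof -
  have "cis (of_int k * (2 * pi)) = 1"
    by (simp add: complex_eq_iff mult.commute[of _ "2 * pi"] sin_int_2pin cos_int_2pin)
  then show ?thesis by (simp add: distrib_left cis_mult[symmetric])
qed

lemma fourier_deriv:
  assumes f: "\<And>t. (f has_vector_derivative f' t) (at t)" and f': "continuous_on UNIV f'"
    and per: "\<And>t. f (t + 2 * pi) = f t"
  shows "fourier f' k = \<i> * of_int k * fourier f k"
proof -
  let ?e = "\<lambda>t. cis (- of_int k * t)"
  have cf: "continuous_on UNIV f" using has_vector_derivative_continuous[OF f] by (intro continuous_at_imp_continuous_on) auto
  have "((\<lambda>t. f t * ?e t) has_vector_derivative
      f t * (\<i> * of_real (- of_int k) * ?e t) + f' t * ?e t) (at t within {-pi..pi})" for t
    using f[of t] cis_has_vector_derivative[of "- of_int k" t]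
    by (intro has_vector_derivative_mult) (auto intro: has_vector_derivative_at_within)
  then have "((\<lambda>t. f t * (\<i> * of_real (- of_int k) * ?e t) + f' t * ?e t) has_integral
      f pi * ?e pi - f (-pi) * ?e (-pi)) {-pi..pi}"
    by (intro fundamental_theorem_of_calculus) auto
  moreover have "f pi * ?e pi - f (-pi) * ?e (-pi) = 0"
    using per[of "-pi"] cis_int_periodic[of "-k" "-pi"] by simp
  ultimately have 0: "((\<lambda>t. f t * (\<i> * of_real (- of_int k) * ?e t) + f' t * ?e t) has_integral 0) {-pi..pi}"
    by simp
  have 1: "((\<lambda>t. f' t * cis (- (of_int k * t))) has_integral fourier f' k * of_real (2 * pi)) {-pi..pi}"
    using integrable_integral[OF fourier_integrable[OF f', of k]] by (simp add: fourier_def)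
  have 2: "((\<lambda>t. (- \<i> * of_int k) * (f t * cis (- (of_int k * t)))) has_integral
      (- \<i> * of_int k) * (fourier f k * of_real (2 * pi))) {-pi..pi}"
    using integrable_integral[OF fourier_integrable[OF cf, of k]]
    by (intro has_integral_mult_right) (simp add: fourier_def)
  have 3: "(\<lambda>t. f t * (\<i> * of_real (- of_int k) * ?e t) + f' t * ?e t) =
      (\<lambda>t. (- \<i> * of_int k) * (f t * cis (- (of_int k * t))) + f' t * cis (- (of_int k * t)))"
    by auto
  have "(- \<i> * of_int k) * (fourier f k * of_real (2 * pi)) + fourier f' k * of_real (2 * pi) = 0"
    using has_integral_unique[OF has_integral_add[OF 2 1] 0[unfolded 3]] .
  then have "of_real (2 * pi) * (fourier f' k - \<i> * of_int k * fourier f k) = 0"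
    by (simp add: algebra_simps)
  then show ?thesis by simp
qed

lemma fourier_const: "fourier (\<lambda>_. c) k = (if k = 0 then c else 0)"
proof (cases "k = 0")
  case True then show ?thesis by (simp add: fourier_def scaleR_conv_of_real)
next
  case False
  have "fourier (\<lambda>_. 0) k = \<i> * of_int k * fourier (\<lambda>_. c) k"
    by (rule fourier_deriv) auto
  then show ?thesis using False by (simp add: fourier_def)
qed

lemma periodic_int:
  fixes f :: "real \<Rightarrow> 'a"
  assumes "\<And>t. f (t + 2 * pi) = f t"
  shows "f (t + 2 * pi * of_int m) = f t"
proof (induction m rule: int_induct[where k=0])
  case (step1 i) then show ?case using assms[of "t + 2 * pi * of_int i"] by (simp add: algebra_simps)
next
  case (step2 i) then show ?case using assms[of "t + 2 * pi * of_int (i - 1)"] by (simp add: algebra_simps)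
qed simp

lemma integral_periodic_shift:
  fixes h :: "real \<Rightarrow> complex"
  assumes c: "continuous_on UNIV h" and per: "\<And>t. h (t + 2 * pi) = h t" and a: "0 \<le> a" "a \<le> 2 * pi"
  shows "integral {-pi..pi} (\<lambda>t. h (t + a)) = integral {-pi..pi} h"
proof -
  have i: "h integrable_on {x..y}" for x y
    using c by (intro integrable_continuous_real) (auto intro: continuous_on_subset)
  have shift: "integral {x..y} (\<lambda>t. h (t + b)) = integral {x+b..y+b} h" for x y b
    using has_integral_affinity'[OF integrable_integral[OF i, of "x+b" "y+b", folded cbox_interval], of 1 b]
    by (auto intro!: integral_unique)
  have "integral {-pi..pi} (\<lambda>t. h (t + a)) = integral {-pi+a..pi+a} h" by (rule shift)
  also have "\<dots> = integral {-pi+a..pi} h + integral {pi..pi+a} h"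
    using Henstock_Kurzweil_Integration.integral_combine[where a="-pi+a" and c=pi and b="pi+a" and f=h] i a by simp
  also have "integral {pi..pi+a} h = integral {-pi..-pi+a} (\<lambda>t. h (t + 2 * pi))"
    using shift[of "-pi" "-pi+a" "2*pi"] by (simp add: add_ac)
  also have "\<dots> = integral {-pi..-pi+a} h" by (simp add: per)
  also have "integral {-pi+a..pi} h + integral {-pi..-pi+a} h = integral {-pi..pi} h"
    unfolding add.commute[of "integral {-pi+a..pi} h"] using Henstock_Kurzweil_Integration.integral_combine[where a="-pi" and c="-pi+a" and b=pi and f=h] i a by simp
  finally show ?thesis .
qed

text \<open>The Riemann-Lebesgue lemma: a shift by half a period of \<open>e\<^sup>i\<^sup>k\<^sup>t\<close> changes the sign of the
  coefficient, and a continuous function changes little under a small shift.\<close>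

lemma fourier_tendsto_0:
  assumes c: "continuous_on UNIV G" and per: "\<And>t. G (t + 2 * pi) = G t" and e: "e > 0"
  obtains N where "\<And>k. \<bar>k\<bar> \<ge> int N \<Longrightarrow> norm (fourier G k) \<le> e"
proof -
  have "uniformly_continuous_on {-10..10} G"
    by (intro compact_uniformly_continuous) (auto intro: continuous_on_subset[OF c])
  then obtain d where d: "d > 0" "\<And>x y. x \<in> {-10..10} \<Longrightarrow> y \<in> {-10..10} \<Longrightarrow> dist y x < d \<Longrightarrow> dist (G y) (G x) < e"
    using e unfolding uniformly_continuous_on_def by metis
  obtain N0 where N0: "pi / d < real N0" using reals_Archimedean2 by blast
  define N where "N = Suc N0"
  show ?thesis
  proof (rule that[of N])
    fix k :: int assume k: "\<bar>k\<bar> \<ge> int N"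
    then have k0: "k \<noteq> 0" by (auto simp: N_def)
    define a where "a = pi / \<bar>of_int k\<bar>"
    have k1: "\<bar>of_int k\<bar> \<ge> (1::real)" "\<bar>of_int k\<bar> \<ge> real N" using k k0 by linarith+
    have a: "0 < a" "a \<le> pi" "a < d"
    proof -
      show "0 < a" using k1 by (simp add: a_def)
      show "a \<le> pi" using k1 by (simp add: a_def divide_le_eq)
      have "pi < d * real N0" using N0 d(1) by (simp add: divide_less_eq mult.commute)
      also have "\<dots> \<le> d * \<bar>of_int k\<bar>" using k1 d(1) by (intro mult_left_mono) (auto simp: N_def)
      finally show "a < d" using k1 k0 by (simp add: a_def divide_less_eq)
    qed
    let ?h = "\<lambda>t. G t * cis (- (of_int k * t))"
    have "cis (- (of_int k * a)) = -1"
    proof (cases "k > 0")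
      case True then show ?thesis by (simp add: a_def complex_eq_iff)
    next
      case False then show ?thesis using k0 by (simp add: a_def complex_eq_iff)
    qed
    then have sh: "?h (t + a) = - (G (t + a) * cis (- (of_int k * t)))" for t
    proof -
      have "cis (- (of_int k * (t + a))) = cis (- (of_int k * t)) * cis (- (of_int k * a))"
        by (simp add: cis_mult algebra_simps)
      then show ?thesis using \<open>cis (- (of_int k * a)) = -1\<close> by simp
    qed
    have ch: "continuous_on UNIV ?h"
      using continuous_on_mult[OF c continuous_on_cis_mult[of UNIV "- of_int k"]] by simp
    have ph: "?h (t + 2 * pi) = ?h t" for t using per[of t] cis_int_periodic[of "-k" t] by simp
    have "integral {-pi..pi} ?h = integral {-pi..pi} (\<lambda>t. ?h (t + a))"
      using integral_periodic_shift[OF ch ph, of a] a pi_gt_zero by simp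
    also have "\<dots> = - integral {-pi..pi} (\<lambda>t. G (t + a) * cis (- (of_int k * t)))"
      unfolding sh by simp
    finally have m: "fourier G k = - fourier (\<lambda>t. G (t + a)) k" by (simp add: fourier_def)
    have cs: "continuous_on UNIV (\<lambda>t. G (t + a))"
      by (rule continuous_on_compose2[OF c]) (auto intro!: continuous_intros)
    have "norm (fourier (\<lambda>t. G t - G (t + a)) k) \<le> e"
    proof (rule fourier_bound)
      show "continuous_on UNIV (\<lambda>t. G t - G (t + a))" using c cs by (rule continuous_on_diff)
      fix t assume "t \<in> {-pi..pi}"
      then have "dist (G t) (G (t + a)) < e"
        using a pi_less_4 by (intro d(2)) (auto simp: dist_real_def)
      then show "norm (G t - G (t + a)) \<le> e" by (simp add: dist_norm)
    qed
    then have "norm (2 * fourier G k) \<le> e" using fourier_diff[OF c cs, of k] m by simp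
    then show "norm (fourier G k) \<le> e" by (simp add: norm_mult) (use norm_ge_zero[of "fourier G k"] in linarith)
  qed
qed

text \<open>For a differentiable periodic \<open>f\<close> and a point \<open>t\<close>, the quotient \<open>G\<close> of \<open>f s - f t\<close> by
  \<open>e\<^sup>i\<^sup>(\<^sup>s\<^sup>-\<^sup>t\<^sup>) - 1\<close> extends continuously. Hence the Fourier series of \<open>f - f t\<close> at \<open>t\<close> telescopes,
  with remainder given by coefficients of \<open>G\<close> (Chernoff's argument).\<close>

lemma fourier_partial_sums_tendsto:
  assumes f: "\<And>s. (f has_vector_derivative f' s) (at s)" and per: "\<And>s. f (s + 2 * pi) = f s"
  shows "(\<lambda>n. \<Sum>k\<in>{-int n..int n}. fourier f k * cis (of_int k * t)) \<longlonglongrightarrow> f t"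
proof -
  have cf: "isCont f s" for s using f by (rule has_vector_derivative_continuous)
  have cfU: "continuous_on UNIV f" using cf by (simp add: continuous_at_imp_continuous_on)
  define G where "G s = (if cis (s - t) = 1 then f' t / \<i> else (f s - f t) / (cis (s - t) - 1))" for s
  have one: "f s = f t" if "cis (s - t) = 1" for s
  proof -
    have "cos (s - t) = 1" using that by (simp add: complex_eq_iff)
    then obtain m :: int where "s - t = of_int m * 2 * pi" by (auto simp: cos_one_2pi_int)
    then have "s = t + 2 * pi * of_int m" by (simp add: algebra_simps)
    then show ?thesis using periodic_int[of f t m] per by simp
  qed
  have fG: "f s - f t = (cis (s - t) - 1) * G s" for s using one[of s] by (auto simp: G_def)
  have cisper: "cis (s + 2 * pi - t) = cis (s - t)" for s
    using cis_int_periodic[of 1 "s - t"] by (simp add: algebra_simps)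
  have perG: "G (s + 2 * pi) = G s" for s by (simp add: G_def cisper per)
  have Gt: "isCont G t"
  proof -
    have dq: "((\<lambda>s. (h s - h t) / of_real (s - t)) \<longlongrightarrow> h') (at t)"
      if "(h has_vector_derivative h') (at t)" for h :: "real \<Rightarrow> complex" and h'
    proof -
      have "((\<lambda>s. norm (h s - h t - (s - t) *\<^sub>R h') / norm (s - t)) \<longlongrightarrow> 0) (at t)"
        using that unfolding has_vector_derivative_def has_derivative_iff_norm by auto
      then have "((\<lambda>s. norm ((h s - h t) / of_real (s - t) - h')) \<longlongrightarrow> 0) (at t)"
      proof (rule Lim_transform_eventually)
        show "\<forall>\<^sub>F s in at t. norm (h s - h t - (s - t) *\<^sub>R h') / norm (s - t) = norm ((h s - h t) / of_real (s - t) - h')"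
        proof (rule eventually_at_filter[THEN iffD2], rule always_eventually, intro allI impI)
          fix s assume "s \<noteq> t"
          then have "(h s - h t) / of_real (s - t) - h' = (h s - h t - (s - t) *\<^sub>R h') / of_real (s - t)"
            by (simp add: diff_divide_distrib scaleR_conv_of_real del: of_real_diff)
          then show "norm (h s - h t - (s - t) *\<^sub>R h') / norm (s - t) = norm ((h s - h t) / of_real (s - t) - h')"
            by (simp add: norm_divide del: of_real_diff)
        qed
      qed
      then show ?thesis using Lim_null tendsto_norm_zero_iff by blast
    qed
    have dc: "((\<lambda>s. cis (s - t)) has_vector_derivative \<i>) (at t)"
    proof -
      have "((\<lambda>s. cis (- t) * cis (1 * s)) has_vector_derivative cis (- t) * (\<i> * of_real 1 * cis (1 * t))) (at t)"
        by (intro has_vector_derivative_mult_right cis_has_vector_derivative)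
      moreover have eq: "cis (- t) * (\<i> * of_real 1 * cis (1 * t)) = \<i>"
        by (simp add: mult.left_commute cis_mult)
      ultimately show ?thesis unfolding eq by (simp add: cis_mult)
    qed
    have l: "((\<lambda>s. ((f s - f t) / of_real (s - t)) / ((cis (s - t) - cis (t - t)) / of_real (s - t))) \<longlongrightarrow> f' t / \<i>) (at t)"
      by (intro tendsto_divide dq f dc) auto
    have "(G \<longlongrightarrow> f' t / \<i>) (at t)"
    proof (rule Lim_transform_eventually[OF l])
      have "\<forall>\<^sub>F s in at t. s \<in> ball t 1 - {t}"
        by (rule eventually_at_in_open) auto
      then show "\<forall>\<^sub>F s in at t. ((f s - f t) / of_real (s - t)) / ((cis (s - t) - cis (t - t)) / of_real (s - t)) = G s"
      proof eventually_elim
        case (elim s)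
        have "cis (s - t) \<noteq> 1"
        proof
          assume "cis (s - t) = 1"
          then have "cos (s - t) = 1" by (simp add: complex_eq_iff)
          then obtain m :: int where m: "s - t = of_int m * 2 * pi" by (auto simp: cos_one_2pi_int)
          then have "\<bar>of_int m\<bar> * (2 * pi) < 1" using elim by (simp add: dist_real_def abs_mult abs_minus_commute)
          moreover have "m \<noteq> 0" using m elim by auto
          then have "\<bar>of_int m\<bar> \<ge> (1::real)" by linarith
          then have "\<bar>of_int m\<bar> * (2 * pi) \<ge> 1 * (2 * pi)" by (intro mult_right_mono) auto
          ultimately show False using pi_gt3 by linarith
        qed
        then show ?case using elim by (simp add: G_def del: of_real_diff)
      qed
    qed
    then show ?thesis by (simp add: isCont_def G_def)
  qed
  \<comment> \<open>The removable singularities lie at \<open>t + 2\<pi>m\<close>; periodicity moves them to \<open>t\<close>.\<close>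
  have cG: "isCont G s" for s
  proof (cases "cis (s - t) = 1")
    case True
    then have "cos (s - t) = 1" by (simp add: complex_eq_iff)
    then obtain m :: int where m: "s - t = of_int m * 2 * pi" by (auto simp: cos_one_2pi_int)
    have "G x = G (x + 2 * pi * of_int (- m))" for x using periodic_int[of G x "-m"] perG by simp
    then have Geq: "G = (\<lambda>x. G (x + 2 * pi * of_int (- m)))" by blast
    have "isCont G (s + 2 * pi * of_int (- m))" using Gt m by (simp add: algebra_simps)
    then have "isCont (\<lambda>x. G (x + 2 * pi * of_int (- m))) s"
      by (rule isCont_o2[where g=G, rotated]) (intro continuous_intros)
    then show ?thesis by (subst Geq)
  next
    case False
    have op: "open {x. cis (x - t) \<noteq> 1}"
      using continuous_on_compose2[OF continuous_on_cis_mult[of UNIV 1], of UNIV "\<lambda>x. x - t"]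
      by (intro open_Collect_neq) (auto intro!: continuous_intros)
    have "continuous_on {x. cis (x - t) \<noteq> 1} (\<lambda>s. (f s - f t) / (cis (s - t) - 1))"
      using continuous_on_compose2[OF continuous_on_cis_mult[of UNIV 1], of "{x. cis (x - t) \<noteq> 1}" "\<lambda>x. x - t"]
      by (intro continuous_intros continuous_on_subset[OF cfU]) (auto intro!: continuous_intros)
    then have "continuous_on {x. cis (x - t) \<noteq> 1} G"
      by (rule continuous_on_eq) (simp add: G_def)
    then show ?thesis using op False by (simp add: continuous_on_eq_continuous_at)
  qed
  then have cGU: "continuous_on UNIV G" by (simp add: continuous_at_imp_continuous_on)
  have shift: "fourier (\<lambda>s. cis s * G s) k = fourier G (k - 1)" for k
  proof -
    have e: "cis s * G s * cis (- (of_int k * s)) = G s * cis (- (of_int (k - 1) * s))" for s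
      by (simp add: cis_mult algebra_simps) 
    show ?thesis unfolding fourier_def by (simp only: e)
  qed
  define u where "u k = cis (of_int k * t) * fourier G k" for k
  have c1: "continuous_on UNIV (\<lambda>s. cis s * G s)"
    using continuous_on_mult[OF continuous_on_cis_mult[of UNIV 1] cGU] by simp
  have key: "fourier f k * cis (of_int k * t) = (if k = 0 then f t else 0) + (u (k - 1) - u k)" for k
  proof -
    have "fourier (\<lambda>s. f s - f t) k = fourier (\<lambda>s. cis (- t) * (cis s * G s) - G s) k"
    proof -
      have "cis (s - t) = cis (- t) * cis s" for s by (simp add: cis_mult)
      then show ?thesis unfolding fG by (simp add: left_diff_distrib mult.assoc)
    qed
    also have "\<dots> = cis (- t) * fourier G (k - 1) - fourier G k"
      using c1 by (subst fourier_diff) (auto simp: fourier_mult shift cGU intro!: continuous_on_mult)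
    finally have "fourier f k - (if k = 0 then f t else 0) = cis (- t) * fourier G (k - 1) - fourier G k"
      using fourier_diff[OF cfU continuous_on_const, of "f t" k] by (simp add: fourier_const)
    then have e: "fourier f k = (if k = 0 then f t else 0) + (cis (- t) * fourier G (k - 1) - fourier G k)"
      by (simp add: algebra_simps)
    have c: "cis (of_int (k - 1) * t) = cis (- t) * cis (of_int k * t)"
      by (simp add: cis_mult algebra_simps)
    show ?thesis unfolding u_def c e
      by (cases "k = 0") (simp_all add: left_diff_distrib right_diff_distrib distrib_right mult_ac)
  qed
  have tele: "(\<Sum>k\<in>{-int n..int n}. u (k - 1) - u k) = u (- int n - 1) - u (int n)" for n
  proof (induction n)
    case (Suc n)
    have "{-int (Suc n)..int (Suc n)} = insert (- int n - 1) (insert (int n + 1) {-int n..int n})" by auto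
    then show ?case using Suc by (simp add: add.commute[of 1])
  qed simp
  have sum: "(\<Sum>k\<in>{-int n..int n}. fourier f k * cis (of_int k * t)) = f t + (u (- int n - 1) - u (int n))" for n
    unfolding key sum.distrib tele by (simp add: sum.delta)
  have nu: "norm (u k) = norm (fourier G k)" for k by (simp add: u_def norm_mult)
  have "(\<lambda>n. u (- int n - 1) - u (int n)) \<longlonglongrightarrow> 0"
  proof (rule LIMSEQ_I)
    fix e :: real assume e: "e > 0"
    obtain N where N: "\<And>k. \<bar>k\<bar> \<ge> int N \<Longrightarrow> norm (fourier G k) \<le> e / 3"
      using fourier_tendsto_0[OF cGU perG, of "e / 3"] e by auto
    show "\<exists>n0. \<forall>n\<ge>n0. norm (u (- int n - 1) - u (int n) - 0) < e"
    proof (intro exI[of _ N] allI impI)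
      fix n assume n: "n \<ge> N"
      have "norm (u (- int n - 1) - u (int n)) \<le> e / 3 + e / 3"
        using norm_triangle_ineq4[of "u (- int n - 1)" "u (int n)"] N[of "- int n - 1"] N[of "int n"] n
        by (simp add: nu)
      then show "norm (u (- int n - 1) - u (int n) - 0) < e" using e by simp
    qed
  qed
  from tendsto_add[OF tendsto_const[of "f t"] this] show ?thesis unfolding sum by simp
qed

lemma fourier_inversion:
  assumes f: "\<And>s. (f has_vector_derivative f' s) (at s)" and per: "\<And>s. f (s + 2 * pi) = f s"
    and sm: "(\<lambda>k. fourier f k * cis (of_int k * t)) summable_on UNIV"
  shows "infsum (\<lambda>k. fourier f k * cis (of_int k * t)) UNIV = f t"
proof -
  have lim: "filterlim (\<lambda>n. {-int n..int n}) (finite_subsets_at_top UNIV) sequentially"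
    unfolding filterlim_finite_subsets_at_top
  proof (intro allI impI)
    fix X :: "int set" assume X: "finite X \<and> X \<subseteq> UNIV"
    define N where "N = (\<Sum>x\<in>X. \<bar>x\<bar>)"
    have N: "\<bar>x\<bar> \<le> N" if "x \<in> X" for x
      unfolding N_def using X that by (intro member_le_sum) auto
    show "\<forall>\<^sub>F n in sequentially. finite {-int n..int n} \<and> X \<subseteq> {-int n..int n} \<and> {-int n..int n} \<subseteq> UNIV"
      unfolding eventually_sequentially
    proof (intro exI[of _ "nat N"] allI impI)
      fix n assume "nat N \<le> n"
      then have "N \<le> int n" by linarith
      then show "finite {-int n..int n} \<and> X \<subseteq> {-int n..int n} \<and> {-int n..int n} \<subseteq> UNIV"
        using N by force
    qed
  qed
  have "((\<lambda>n. sum (\<lambda>k. fourier f k * cis (of_int k * t)) {-int n..int n}) \<longlongrightarrow>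
      infsum (\<lambda>k. fourier f k * cis (of_int k * t)) UNIV) sequentially"
    using has_sum_infsum[OF sm] unfolding has_sum_def
    by (rule filterlim_compose[where g="sum (\<lambda>k. fourier f k * cis (of_int k * t))"
          and f="\<lambda>n. {-int n..int n}", OF _ lim])
  moreover have "(\<lambda>n. sum (\<lambda>k. fourier f k * cis (of_int k * t)) {-int n..int n}) \<longlonglongrightarrow> f t"
    by (rule fourier_partial_sums_tendsto[where f'=f', OF f per])
  ultimately show ?thesis by (rule LIMSEQ_unique)
qed


section \<open>Fourier series on the torus\<close>

abbreviation plane_pt :: "real \<Rightarrow> real \<Rightarrow> real^2" where
  "plane_pt x y \<equiv> x *\<^sub>R axis 1 1 + y *\<^sub>R axis 2 1"

definition torus_periodic :: "(real^2 \<Rightarrow> 'a) \<Rightarrow> bool" where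
  "torus_periodic F \<longleftrightarrow> (\<forall>x i. F (x + (2 * pi) *\<^sub>R axis i 1) = F x)"

definition torus_coeff :: "(real^2 \<Rightarrow> complex) \<Rightarrow> int \<times> int \<Rightarrow> complex" where
  "torus_coeff F k = fourier (\<lambda>y. fourier (\<lambda>x. F (plane_pt x y)) (fst k)) (snd k)"

definition wave :: "int \<times> int \<Rightarrow> real^2 \<Rightarrow> complex" where
  "wave k x = cis (of_int (fst k) * x $ 1 + of_int (snd k) * x $ 2)"

lemma plane_pt_nth [simp]: "plane_pt x y $ 1 = x" "plane_pt x y $ 2 = y"
  by (simp_all add: axis_def)

lemma plane_pt_eq: "plane_pt (p $ 1) (p $ 2) = p"
  by (simp add: vec_eq_iff forall_2 axis_def)

context
  fixes F :: "real^2 \<Rightarrow> complex"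
  assumes F: "smooth_on UNIV F"
begin

lemma torus_line_derivs:
  "((\<lambda>x. F (plane_pt x y)) has_vector_derivative dd F (plane_pt x y) (axis 1 1)) (at x)"
  "((\<lambda>y. F (plane_pt x y)) has_vector_derivative dd F (plane_pt x y) (axis 2 1)) (at y)"
  using dd_line_vec[of F "y *\<^sub>R axis 2 1" x "axis 1 1"] dd_line_vec[of F "x *\<^sub>R axis 1 1" y "axis 2 1"]
    smooth_diff_at[OF F] by (simp_all add: add.commute)

lemma torus_continuous:
  "continuous_on A (\<lambda>x. F (plane_pt x y))" "continuous_on B (\<lambda>(y, x). F (plane_pt x y))"
  using smooth_continuous[OF F]
  by (auto simp: case_prod_unfold intro!: continuous_on_compose2[of UNIV F] continuous_intros)

end

lemma torus_fourier_deriv: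
  assumes F: "smooth_on UNIV F"
  shows "((\<lambda>y. fourier (\<lambda>x. F (plane_pt x y)) k) has_vector_derivative
      fourier (\<lambda>x. dd F (plane_pt x y) (axis 2 1)) k) (at y)"
proof -
  let ?e = "\<lambda>x. cis (- (of_int k * x))"
  have ce: "continuous_on A ?e" for A using continuous_on_cis_mult[of A "- of_int k"] by simp
  have "((\<lambda>y. integral (cbox (-pi) pi) (\<lambda>x. F (plane_pt x y) * ?e x)) has_vector_derivative
      integral (cbox (-pi) pi) (\<lambda>x. dd F (plane_pt x y) (axis 2 1) * ?e x)) (at y within UNIV)"
  proof (rule leibniz_rule_vector_derivative)
    show "((\<lambda>y. F (plane_pt x y) * ?e x) has_vector_derivative dd F (plane_pt x y) (axis 2 1) * ?e x)
        (at y within UNIV)" for x y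
      by (rule has_vector_derivative_mult_left) (use torus_line_derivs(2)[OF F] in simp)
    show "(\<lambda>x. F (plane_pt x y) * ?e x) integrable_on cbox (-pi) pi" for y
      by (intro integrable_continuous continuous_on_mult torus_continuous[OF F] ce)
    show "continuous_on (UNIV \<times> cbox (-pi) pi) (\<lambda>(y, x). dd F (plane_pt x y) (axis 2 1) * ?e x)"
      using torus_continuous(2)[OF smooth_dd[OF F], of _ "axis 2 1"]
      by (auto simp: case_prod_unfold intro!: continuous_intros continuous_on_compose2[OF ce])
  qed auto
  then have "((\<lambda>y. integral {-pi..pi} (\<lambda>x. F (plane_pt x y) * ?e x) * (1 / of_real (2 * pi))) has_vector_derivative
      integral {-pi..pi} (\<lambda>x. dd F (plane_pt x y) (axis 2 1) * ?e x) * (1 / of_real (2 * pi))) (at y)"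
    by (intro has_vector_derivative_mult_left) simp
  then show ?thesis unfolding fourier_def by simp
qed

lemma torus_fourier_continuous:
  "smooth_on UNIV F \<Longrightarrow> continuous_on A (\<lambda>y. fourier (\<lambda>x. F (plane_pt x y)) k)"
  using has_vector_derivative_continuous[OF torus_fourier_deriv] by (intro continuous_at_imp_continuous_on) auto

lemma torus_periodic_line:
  assumes "torus_periodic F"
  shows "F (plane_pt (x + 2 * pi) y) = F (plane_pt x y)" "F (plane_pt x (y + 2 * pi)) = F (plane_pt x y)"
proof -
  have "plane_pt (x + 2 * pi) y = plane_pt x y + (2 * pi) *\<^sub>R axis 1 1"
       "plane_pt x (y + 2 * pi) = plane_pt x y + (2 * pi) *\<^sub>R axis 2 1"
    by (simp_all add: scaleR_add_left)
  then show "F (plane_pt (x + 2 * pi) y) = F (plane_pt x y)" "F (plane_pt x (y + 2 * pi)) = F (plane_pt x y)"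
    using assms unfolding torus_periodic_def by metis+
qed

lemma torus_periodic_dd:
  assumes F: "smooth_on UNIV F" and per: "torus_periodic F"
  shows "torus_periodic (\<lambda>x. dd F x v)"
  unfolding torus_periodic_def
proof (intro allI)
  fix x :: "real^2" and i :: 2
  let ?p = "(2 * pi) *\<^sub>R axis i (1::real)"
  have "((\<lambda>x. x + ?p) has_derivative (\<lambda>v. v)) (at x)" by (auto intro!: derivative_eq_intros)
  from has_derivative_compose[OF this smooth_derivative[OF F]]
  have "((\<lambda>x. F (x + ?p)) has_derivative dd F (x + ?p)) (at x)" by simp
  then have "(F has_derivative dd F (x + ?p)) (at x)" using per by (simp add: torus_periodic_def)
  then show "dd F (x + ?p) v = dd F x v" using dd_eq by metis
qed

lemma torus_coeff_deriv:
  assumes F: "smooth_on UNIV F" and per: "torus_periodic F"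
  shows "torus_coeff (\<lambda>x. dd F x (axis 1 1)) k = \<i> * of_int (fst k) * torus_coeff F k"
    and "torus_coeff (\<lambda>x. dd F x (axis 2 1)) k = \<i> * of_int (snd k) * torus_coeff F k"
proof -
  have "fourier (\<lambda>x. dd F (plane_pt x y) (axis 1 1)) (fst k) = \<i> * of_int (fst k) * fourier (\<lambda>x. F (plane_pt x y)) (fst k)" for y
    by (rule fourier_deriv[OF torus_line_derivs(1)[OF F] torus_continuous(1)[OF smooth_dd[OF F]]
         torus_periodic_line(1)[OF per]])
  then show "torus_coeff (\<lambda>x. dd F x (axis 1 1)) k = \<i> * of_int (fst k) * torus_coeff F k"
    unfolding torus_coeff_def by (simp add: fourier_mult)
  show "torus_coeff (\<lambda>x. dd F x (axis 2 1)) k = \<i> * of_int (snd k) * torus_coeff F k"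
    unfolding torus_coeff_def
    by (rule fourier_deriv[OF torus_fourier_deriv[OF F] torus_fourier_continuous[OF smooth_dd[OF F]]])
       (simp add: torus_periodic_line[OF per])
qed

lemma torus_coeff_diff:
  assumes "smooth_on UNIV F" "smooth_on UNIV G"
  shows "torus_coeff (\<lambda>x. F x - G x) k = torus_coeff F k - torus_coeff G k"
  unfolding torus_coeff_def using assms
  by (simp add: fourier_diff torus_continuous torus_fourier_continuous)

lemma torus_coeff_bound:
  assumes "smooth_on UNIV F" "\<And>x y. x \<in> {-pi..pi} \<Longrightarrow> y \<in> {-pi..pi} \<Longrightarrow> norm (F (plane_pt x y)) \<le> B"
  shows "norm (torus_coeff F k) \<le> B"
  unfolding torus_coeff_def
  by (intro fourier_bound torus_fourier_continuous torus_continuous assms)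

text \<open>The operator \<open>(1 - \<partial>\<^sub>1\<^sup>2)(1 - \<partial>\<^sub>2\<^sup>2)\<close> multiplies the coefficients by
  \<open>(1 + k\<^sub>1\<^sup>2)(1 + k\<^sub>2\<^sup>2)\<close>, whose inverse is summable.\<close>

definition one_minus_sq :: "2 \<Rightarrow> (real^2 \<Rightarrow> 'b::real_normed_vector) \<Rightarrow> real^2 \<Rightarrow> 'b" where
  "one_minus_sq i F x = F x - dd (\<lambda>z. dd F z (axis i 1)) x (axis i 1)"

abbreviation damping :: "(real^2 \<Rightarrow> 'b::real_normed_vector) \<Rightarrow> real^2 \<Rightarrow> 'b" where
  "damping F \<equiv> one_minus_sq 1 (one_minus_sq 2 F)"

definition damping_factor :: "int \<times> int \<Rightarrow> real" where
  "damping_factor k = (1 + (of_int (fst k))\<^sup>2) * (1 + (of_int (snd k))\<^sup>2)"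

lemma one_minus_sq_smooth: "smooth_on UNIV F \<Longrightarrow> smooth_on UNIV (one_minus_sq i F)"
  unfolding one_minus_sq_def[abs_def] by (intro smooth_diff smooth_dd) auto

lemma one_minus_sq_periodic:
  "smooth_on UNIV F \<Longrightarrow> torus_periodic F \<Longrightarrow> torus_periodic (one_minus_sq i F)"
  using torus_periodic_dd[OF smooth_dd torus_periodic_dd, of F "axis i 1" "axis i 1"]
  by (simp add: one_minus_sq_def torus_periodic_def)

lemma one_minus_sq_coeff:
  assumes "smooth_on UNIV F" "torus_periodic F"
  shows "torus_coeff (one_minus_sq 1 F) k = (1 + (of_int (fst k))\<^sup>2) * torus_coeff F k"
    and "torus_coeff (one_minus_sq 2 F) k = (1 + (of_int (snd k))\<^sup>2) * torus_coeff F k"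
  unfolding one_minus_sq_def[abs_def] using assms
  by (simp_all add: torus_coeff_diff smooth_dd torus_coeff_deriv torus_periodic_dd power2_eq_square algebra_simps)

lemma damping_coeff:
  assumes "smooth_on UNIV F" "torus_periodic F"
  shows "torus_coeff (damping F) k = of_real (damping_factor k) * torus_coeff F k"
  using assms by (simp add: one_minus_sq_coeff one_minus_sq_smooth one_minus_sq_periodic damping_factor_def mult.assoc)

lemma damping_factor_pos: "damping_factor k > 0"
  unfolding damping_factor_def by (intro mult_pos_pos) (auto intro: add_pos_nonneg)

lemma summable_inverse_square_int: "(\<lambda>k::int. 1 / (1 + (of_int k)\<^sup>2) :: real) summable_on UNIV"
proof -
  have "summable (\<lambda>n. 1 / (1 + (real n)\<^sup>2))"
  proof (rule summable_comparison_test'[where N=1])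
    show "summable (\<lambda>n. inverse (real n ^ 2))" by (rule inverse_power_summable) auto
    show "norm (1 / (1 + (real n)\<^sup>2)) \<le> inverse (real n ^ 2)" if "1 \<le> n" for n
      using that by (simp add: inverse_eq_divide frac_le)
  qed
  then have n: "(\<lambda>n. 1 / (1 + (real n)\<^sup>2)) summable_on UNIV"
    by (subst summable_on_UNIV_nonneg_real_iff) auto
  have "(\<lambda>k::int. 1 / (1 + (of_int k)\<^sup>2) :: real) summable_on range int"
    using n by (subst summable_on_reindex) (auto simp: o_def)
  moreover have "(\<lambda>k::int. 1 / (1 + (of_int k)\<^sup>2) :: real) summable_on range (\<lambda>n. - int n)"
    using n by (subst summable_on_reindex) (auto simp: o_def inj_on_def)
  ultimately have "(\<lambda>k::int. 1 / (1 + (of_int k)\<^sup>2) :: real) summable_on (range int \<union> range (\<lambda>n. - int n))"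
    by (rule summable_on_union)
  moreover have "range int \<union> range (\<lambda>n. - int n) = UNIV"
    by (auto simp: image_iff) (metis int_cases2)
  ultimately show ?thesis by simp
qed

lemma summable_times_nonneg:
  fixes f :: "'a \<Rightarrow> real" and g :: "'b \<Rightarrow> real"
  assumes "f summable_on A" "g summable_on B" "\<And>x. f x \<ge> 0" "\<And>y. g y \<ge> 0"
  shows "(\<lambda>p. f (fst p) * g (snd p)) summable_on A \<times> B"
proof (rule summable_on_SigmaI)
  show "((\<lambda>y. f (fst (x, y)) * g (snd (x, y))) has_sum f x * infsum g B) B" for x
    using has_sum_cmult_right[OF has_sum_infsum[OF assms(2)]] by simp
  show "(\<lambda>x. f x * infsum g B) summable_on A"
    by (rule summable_on_cmult_left[OF assms(1)])
qed (use assms in auto)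

lemma summable_inverse_damping: "(\<lambda>k. 1 / damping_factor k) summable_on UNIV"
proof -
  define q where "q k = (1 / (1 + (of_int k)\<^sup>2) :: real)" for k :: int
  have "(\<lambda>p. q (fst p) * q (snd p)) summable_on UNIV \<times> UNIV"
    by (rule summable_times_nonneg) (use summable_inverse_square_int in \<open>auto simp: q_def\<close>)
  moreover have "q (fst p) * q (snd p) = 1 / damping_factor p" for p
    by (simp add: damping_factor_def q_def)
  ultimately show ?thesis by simp
qed

lemma bounded_on_square:
  assumes "continuous_on UNIV (F :: real^2 \<Rightarrow> complex)"
  obtains B where "\<And>x y. x \<in> {-pi..pi} \<Longrightarrow> y \<in> {-pi..pi} \<Longrightarrow> norm (F (plane_pt x y)) \<le> B"
proof -
  have "compact ((\<lambda>p. F (plane_pt (fst p) (snd p))) ` ({-pi..pi} \<times> {-pi..pi}))"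
    by (intro compact_continuous_image continuous_on_compose2[OF assms] continuous_intros compact_Times) auto
  then obtain B where "\<forall>z\<in>(\<lambda>p. F (plane_pt (fst p) (snd p))) ` ({-pi..pi} \<times> {-pi..pi}). norm z \<le> B"
    using compact_imp_bounded bounded_iff by meson
  then show ?thesis using that[of B] by force
qed

lemma torus_coeff_damping_bound:
  assumes "smooth_on UNIV F" "torus_periodic F"
    "\<And>x y. x \<in> {-pi..pi} \<Longrightarrow> y \<in> {-pi..pi} \<Longrightarrow> norm (damping F (plane_pt x y)) \<le> B"
  shows "norm (torus_coeff F k) \<le> B * (1 / damping_factor k)"
proof -
  have "norm (torus_coeff (damping F) k) \<le> B"
    by (rule torus_coeff_bound) (auto intro: one_minus_sq_smooth assms)
  then show ?thesis using damping_factor_pos[of k]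
    by (simp add: damping_coeff[OF assms(1,2)] norm_mult field_simps)
qed

lemma torus_coeff_abs_sum_bound:
  assumes "smooth_on UNIV F" "torus_periodic F"
    "\<And>x y. x \<in> {-pi..pi} \<Longrightarrow> y \<in> {-pi..pi} \<Longrightarrow> norm (damping F (plane_pt x y)) \<le> B"
  shows "(\<lambda>k. norm (torus_coeff F k)) summable_on UNIV"
    "infsum (\<lambda>k. norm (torus_coeff F k)) UNIV \<le> B * infsum (\<lambda>k. 1 / damping_factor k) UNIV"
proof -
  have s: "(\<lambda>k. B * (1 / damping_factor k)) summable_on UNIV"
    by (rule summable_on_cmult_right[OF summable_inverse_damping])
  show n: "(\<lambda>k. norm (torus_coeff F k)) summable_on UNIV"
    by (rule summable_on_comparison_test[OF s]) (use torus_coeff_damping_bound[OF assms] in auto)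
  have "infsum (\<lambda>k. norm (torus_coeff F k)) UNIV \<le> infsum (\<lambda>k. B * (1 / damping_factor k)) UNIV"
    by (rule infsum_mono[OF n s]) (rule torus_coeff_damping_bound[OF assms])
  also have "\<dots> = B * infsum (\<lambda>k. 1 / damping_factor k) UNIV"
    by (rule infsum_cmult_right) (simp add: summable_inverse_damping)
  finally show "infsum (\<lambda>k. norm (torus_coeff F k)) UNIV \<le> B * infsum (\<lambda>k. 1 / damping_factor k) UNIV" .
qed

definition freq_size :: "int \<times> int \<Rightarrow> real" where
  "freq_size k = \<bar>of_int (fst k)\<bar> + \<bar>of_int (snd k)\<bar>"

definition rapid :: "(int \<times> int \<Rightarrow> complex) \<Rightarrow> bool" where
  "rapid a \<longleftrightarrow> (\<forall>s::nat. (\<lambda>k. norm (a k) * (1 + freq_size k) ^ s) summable_on UNIV)"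

lemma freq_size_nonneg: "freq_size k \<ge> 0"
  by (simp add: freq_size_def)

lemma freq_size_le_damping: "1 + freq_size k \<le> 4 * damping_factor k"
proof -
  have q: "1 + \<bar>a\<bar> \<le> 2 * (1 + a\<^sup>2)" for a :: real
  proof -
    have "2 * \<bar>a\<bar> \<le> 1 + a\<^sup>2"
      using zero_le_power2[of "\<bar>a\<bar> - 1"] by (simp add: power2_eq_square algebra_simps)
    then show ?thesis using zero_le_power2[of a] by (simp only: distrib_left)
  qed
  have "1 + freq_size k \<le> (1 + \<bar>of_int (fst k)\<bar>) * (1 + \<bar>of_int (snd k)\<bar>)"
    by (simp add: freq_size_def algebra_simps)
  also have "\<dots> \<le> (2 * (1 + (of_int (fst k))\<^sup>2)) * (2 * (1 + (of_int (snd k))\<^sup>2))"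
    by (intro mult_mono q) auto
  also have "\<dots> = 4 * damping_factor k" by (simp add: damping_factor_def algebra_simps)
  finally show ?thesis .
qed

text \<open>Applying \<open>damping\<close> \<open>s + 1\<close> times before taking coefficients gains \<open>s\<close> factors that absorb the
  weight and one more that makes the sum converge.\<close>

lemma torus_coeff_rapid:
  assumes "smooth_on UNIV F" "torus_periodic F"
  shows "rapid (torus_coeff F)"
  unfolding rapid_def
proof
  fix s
  define G where "G m = (damping ^^ m) F" for m
  have G: "smooth_on UNIV (G m) \<and> torus_periodic (G m) \<and>
      (\<forall>k. torus_coeff (G m) k = of_real (damping_factor k ^ m) * torus_coeff F k)" for m
    by (induction m) (auto simp: G_def assms damping_coeff one_minus_sq_smooth one_minus_sq_periodic)
  obtain B where B: "\<And>x y. x \<in> {-pi..pi} \<Longrightarrow> y \<in> {-pi..pi} \<Longrightarrow> norm (damping (G s) (plane_pt x y)) \<le> B"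
    using bounded_on_square[of "damping (G s)"] G one_minus_sq_smooth smooth_continuous by metis
  have Gs: "norm (torus_coeff (G s) k) \<le> B * (1 / damping_factor k)" for k
    using torus_coeff_damping_bound[of "G s", OF _ _ B] G by blast
  show "(\<lambda>k. norm (torus_coeff F k) * (1 + freq_size k) ^ s) summable_on UNIV"
  proof (rule summable_on_comparison_test)
    show "(\<lambda>k. (4 ^ s * B) * (1 / damping_factor k)) summable_on UNIV"
      by (rule summable_on_cmult_right[OF summable_inverse_damping])
    fix k
    have "norm (torus_coeff F k) * (1 + freq_size k) ^ s \<le> norm (torus_coeff F k) * (4 * damping_factor k) ^ s"
      using freq_size_le_damping[of k] freq_size_nonneg[of k] by (intro mult_left_mono power_mono) auto
    also have "\<dots> = 4 ^ s * norm (torus_coeff (G s) k)"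
    proof -
      have "torus_coeff (G s) k = of_real (damping_factor k ^ s) * torus_coeff F k" using G by blast
      then show ?thesis using damping_factor_pos[of k]
        by (simp add: norm_mult norm_power power_mult_distrib)
    qed
    also have "\<dots> \<le> 4 ^ s * (B * (1 / damping_factor k))"
      using Gs by (intro mult_left_mono) auto
    finally show "norm (torus_coeff F k) * (1 + freq_size k) ^ s \<le> (4 ^ s * B) * (1 / damping_factor k)" by simp
  qed (use freq_size_nonneg in auto)
qed

lemma wave_norm [simp]: "norm (wave k x) = 1"
  by (simp add: wave_def)

lemma rapid_summable: "rapid a \<Longrightarrow> (\<lambda>k. norm (a k)) summable_on UNIV"
  unfolding rapid_def by (drule spec[of _ 0]) simp

text \<open>The one-dimensional inversion formula is used in each variable in turn; absolute
  convergence turns the iterated sum into the double one.\<close>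

lemma torus_inversion:
  assumes F: "smooth_on UNIV F" and per: "torus_periodic F"
  shows "infsum (\<lambda>k. torus_coeff F k * wave k p) UNIV = F p"
proof -
  define x y where "x = p $ 1" and "y = p $ 2"
  have p: "p = plane_pt x y" by (simp add: x_def y_def plane_pt_eq)
  let ?A = "\<lambda>k. torus_coeff F k * wave k p"
  have ab: "(\<lambda>k. norm (?A k)) summable_on UNIV"
    using rapid_summable[OF torus_coeff_rapid[OF assms]] by (simp add: norm_mult)
  then have sm: "?A summable_on (SIGMA k:UNIV. UNIV)" by (simp add: abs_summable_summable)
  define g where "g k y = fourier (\<lambda>x. F (plane_pt x y)) k" for k y
  have A: "?A (k, l) = cis (of_int k * x) * (fourier (g k) l * cis (of_int l * y))" for k l
    unfolding torus_coeff_def wave_def g_def[abs_def] x_def y_def by (simp add: cis_mult[symmetric])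
  have sm': "(\<lambda>(k, l). ?A (k, l)) summable_on (SIGMA k:UNIV. UNIV)"
    using sm by (simp add: case_prod_unfold)
  have inner: "infsum (\<lambda>l. ?A (k, l)) UNIV = cis (of_int k * x) * g k y" for k
  proof -
    from summable_on_SigmaD1[OF sm'] have "(\<lambda>l. ?A (k, l)) summable_on UNIV" by simp
    then have "(\<lambda>l. inverse (cis (of_int k * x)) * ?A (k, l)) summable_on UNIV"
      by (rule summable_on_cmult_right)
    then have s: "(\<lambda>l. fourier (g k) l * cis (of_int l * y)) summable_on UNIV"
      unfolding A by (simp add: field_simps)
    have "infsum (\<lambda>l. fourier (g k) l * cis (of_int l * y)) UNIV = g k y"
    proof (rule fourier_inversion[OF _ _ s])
      show "(g k has_vector_derivative fourier (\<lambda>x. dd F (plane_pt x s) (axis 2 1)) k) (at s)" for s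
        unfolding g_def[abs_def] by (rule torus_fourier_deriv[OF F])
      show "g k (s + 2 * pi) = g k s" for s
        unfolding g_def by (simp add: torus_periodic_line[OF per])
    qed
    then show ?thesis unfolding A using infsum_cmult_right[OF s] by simp
  qed
  have outer: "(\<lambda>k. cis (of_int k * x) * g k y) summable_on UNIV"
    using summable_on_Sigma_banach[OF sm'] by (simp add: inner)
  have "infsum ?A (SIGMA k:UNIV. UNIV) = infsum (\<lambda>k. cis (of_int k * x) * g k y) UNIV"
    using infsum_Sigma_banach[OF sm] by (simp add: inner)
  also have "\<dots> = infsum (\<lambda>k. fourier (\<lambda>x. F (plane_pt x y)) k * cis (of_int k * x)) UNIV"
    by (simp add: g_def mult.commute)
  also have "\<dots> = F (plane_pt x y)"
    by (rule fourier_inversion[OF torus_line_derivs(1)[OF F] torus_periodic_line(1)[OF per]])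
       (use outer in \<open>simp add: g_def mult.commute\<close>)
  finally show ?thesis using p by simp
qed


section \<open>Absolutely convergent trigonometric series\<close>

definition torus_series :: "(int \<times> int \<Rightarrow> complex) \<Rightarrow> real^2 \<Rightarrow> complex" where
  "torus_series a x = infsum (\<lambda>k. a k * wave k x) UNIV"

definition phase :: "int \<times> int \<Rightarrow> real^2 \<Rightarrow> real" where
  "phase k x = of_int (fst k) * x $ 1 + of_int (snd k) * x $ 2"

lemma wave_eq: "wave k x = cis (phase k x)"
  by (simp add: wave_def phase_def)

lemma phase_bound: "\<bar>phase k h\<bar> \<le> freq_size k * norm h"
proof -
  have "\<bar>phase k h\<bar> \<le> \<bar>of_int (fst k)\<bar> * \<bar>h $ 1\<bar> + \<bar>of_int (snd k)\<bar> * \<bar>h $ 2\<bar>"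
    unfolding phase_def by (rule order_trans[OF abs_triangle_ineq]) (simp add: abs_mult)
  also have "\<dots> \<le> \<bar>of_int (fst k)\<bar> * norm h + \<bar>of_int (snd k)\<bar> * norm h"
    by (intro add_mono mult_left_mono component_le_norm_cart) auto
  finally show ?thesis by (simp add: freq_size_def algebra_simps)
qed

lemma cis_taylor: "norm (cis t - 1 - \<i> * of_real t) \<le> t\<^sup>2"
proof -
  have "norm (exp (\<i> * of_real t) - (\<Sum>k\<le>1. (\<i> * of_real t) ^ k / fact k)) \<le>
      exp \<bar>Re (\<i> * of_real t)\<bar> * norm (\<i> * of_real t) ^ Suc 1 / fact 1"
    by (rule Taylor_exp)
  then show ?thesis by (simp add: cis_conv_exp norm_mult power2_eq_square diff_diff_eq)
qed

lemma rapid_mult: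
  assumes "rapid a" "\<And>k. norm (m k) \<le> C * (1 + freq_size k)"
  shows "rapid (\<lambda>k. a k * m k)"
  unfolding rapid_def
proof
  fix s
  show "(\<lambda>k. norm (a k * m k) * (1 + freq_size k) ^ s) summable_on UNIV"
  proof (rule summable_on_comparison_test)
    show "(\<lambda>k. C * (norm (a k) * (1 + freq_size k) ^ Suc s)) summable_on UNIV"
      using assms(1) unfolding rapid_def by (intro summable_on_cmult_right) blast
    fix k
    have "norm (a k) * norm (m k) * (1 + freq_size k) ^ s \<le> norm (a k) * (C * (1 + freq_size k)) * (1 + freq_size k) ^ s"
      using assms(2)[of k] freq_size_nonneg[of k] by (intro mult_right_mono mult_left_mono) auto
    then show "norm (a k * m k) * (1 + freq_size k) ^ s \<le> C * (norm (a k) * (1 + freq_size k) ^ Suc s)"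
      by (simp add: norm_mult mult_ac)
  qed (use freq_size_nonneg in auto)
qed

lemma rapid_freq:
  assumes "rapid a"
  shows "rapid (\<lambda>k. a k * (\<i> * of_int (fst k)))" "rapid (\<lambda>k. a k * (\<i> * of_int (snd k)))"
  by (rule rapid_mult[OF assms, where C=1]; simp add: norm_mult freq_size_def)+

lemma torus_series_summable:
  assumes "rapid a" shows "(\<lambda>k. a k * wave k x) summable_on UNIV"
  by (rule abs_summable_summable) (simp add: norm_mult rapid_summable[OF assms])

lemma torus_series_add:
  "rapid a \<Longrightarrow> rapid b \<Longrightarrow> torus_series (\<lambda>k. a k + b k) x = torus_series a x + torus_series b x"
  unfolding torus_series_def distrib_right by (intro infsum_add torus_series_summable)

lemma torus_series_cmult: "rapid a \<Longrightarrow> torus_series (\<lambda>k. c * a k) x = c * torus_series a x"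
  unfolding torus_series_def mult.assoc by (intro infsum_cmult_right) (simp add: torus_series_summable)

lemma torus_series_single: "torus_series (\<lambda>k. if k = 0 then c else 0) x = c"
proof -
  have "torus_series (\<lambda>k. if k = 0 then c else 0) x = infsum (\<lambda>k. (if k = 0 then c else 0) * wave k x) {0}"
    unfolding torus_series_def by (rule infsum_cong_neutral) auto
  then show ?thesis by (simp add: wave_def)
qed

lemma rapid_single: "rapid (\<lambda>k. if k = 0 then c else 0)"
  unfolding rapid_def
proof
  fix s
  have "(\<lambda>k. norm (if k = 0 then c else 0) * (1 + freq_size k) ^ s) summable_on {0}" by simp
  then show "(\<lambda>k. norm (if k = 0 then c else 0) * (1 + freq_size k) ^ s) summable_on UNIV"
    by (rule summable_on_cong_neutral[THEN iffD1, rotated -1]) auto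
qed

lemma rapid_add: assumes "rapid a" "rapid b" shows "rapid (\<lambda>k. a k + b k)"
  unfolding rapid_def
proof
  fix s
  show "(\<lambda>k. norm (a k + b k) * (1 + freq_size k) ^ s) summable_on UNIV"
  proof (rule summable_on_comparison_test)
    show "(\<lambda>k. norm (a k) * (1 + freq_size k) ^ s + norm (b k) * (1 + freq_size k) ^ s) summable_on UNIV"
      using assms unfolding rapid_def by (intro summable_on_add) auto
    show "norm (a k + b k) * (1 + freq_size k) ^ s \<le> norm (a k) * (1 + freq_size k) ^ s + norm (b k) * (1 + freq_size k) ^ s" for k
      unfolding distrib_right[symmetric] using freq_size_nonneg[of k]
      by (intro mult_right_mono norm_triangle_ineq) auto
  qed (use freq_size_nonneg in auto)
qed

lemma has_sum_minus:
  fixes f g :: "'i \<Rightarrow> complex"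
  assumes "(f has_sum a) A" "(g has_sum b) A"
  shows "((\<lambda>x. f x - g x) has_sum (a - b)) A"
  using has_sum_add[OF assms(1) has_sum_cmult_right[OF assms(2), of "-1"]] by simp

text \<open>Termwise differentiation: the second order Taylor estimate for \<open>cis\<close>, summed against the
  rapidly decreasing coefficients, bounds the error of the linear approximation by \<open>C |h|\<^sup>2\<close>.\<close>

lemma torus_series_has_derivative:
  assumes a: "rapid a"
  shows "(torus_series a has_derivative (\<lambda>h. h $ 1 *\<^sub>R torus_series (\<lambda>k. a k * (\<i> * of_int (fst k))) x
      + h $ 2 *\<^sub>R torus_series (\<lambda>k. a k * (\<i> * of_int (snd k))) x)) (at x)" (is "(_ has_derivative ?D) _")
proof -
  define C where "C = infsum (\<lambda>k. norm (a k) * (1 + freq_size k) ^ 2) UNIV"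
  have s2: "(\<lambda>k. norm (a k) * (1 + freq_size k) ^ 2) summable_on UNIV" using a by (simp add: rapid_def)
  have bl: "bounded_linear ?D"
    by (intro bounded_linear_add bounded_linear_scaleR_const bounded_linear_vec_nth)
  have est: "norm (torus_series a (x + h) - torus_series a x - ?D h) \<le> C * (norm h)\<^sup>2" for h
  proof -
    let ?t = "\<lambda>k. a k * wave k (x + h) - a k * wave k x -
        (of_real (h $ 1) * (a k * (\<i> * of_int (fst k)) * wave k x) + of_real (h $ 2) * (a k * (\<i> * of_int (snd k)) * wave k x))"
    have hs: "(?t has_sum (torus_series a (x + h) - torus_series a x - ?D h)) UNIV"
      unfolding torus_series_def scaleR_conv_of_real
      by (intro has_sum_minus has_sum_add has_sum_cmult_right has_sum_infsum torus_series_summable a rapid_freq)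
    have tb: "norm (?t k) \<le> (norm h)\<^sup>2 * (norm (a k) * (1 + freq_size k) ^ 2)" for k
    proof -
      have ph: "phase k (x + h) = phase k x + phase k h" by (simp add: phase_def algebra_simps)
      have "?t k = a k * wave k x * (cis (phase k h) - 1 - \<i> * of_real (phase k h))"
        unfolding wave_eq ph cis_mult[symmetric] by (simp add: phase_def algebra_simps)
      then have "norm (?t k) = norm (a k) * norm (cis (phase k h) - 1 - \<i> * of_real (phase k h))"
        by (simp add: norm_mult)
      also have "\<dots> \<le> norm (a k) * (phase k h)\<^sup>2" by (intro mult_left_mono cis_taylor) auto
      also have "\<dots> \<le> norm (a k) * ((1 + freq_size k) * norm h)\<^sup>2"
      proof (rule mult_left_mono)
        have "(phase k h)\<^sup>2 \<le> (freq_size k * norm h)\<^sup>2"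
          using phase_bound[of k h] by (metis abs_ge_zero power2_abs power_mono)
        also have "\<dots> \<le> ((1 + freq_size k) * norm h)\<^sup>2"
          using freq_size_nonneg[of k] by (intro power_mono mult_right_mono) auto
        finally show "(phase k h)\<^sup>2 \<le> ((1 + freq_size k) * norm h)\<^sup>2" .
      qed simp
      also have "\<dots> = (norm h)\<^sup>2 * (norm (a k) * (1 + freq_size k) ^ 2)"
        by (simp only: power_mult_distrib mult_ac)
      finally show ?thesis .
    qed
    have "norm (torus_series a (x + h) - torus_series a x - ?D h) \<le> (norm h)\<^sup>2 * C"
      unfolding C_def by (rule norm_infsum_le[OF hs has_sum_cmult_right[OF has_sum_infsum[OF s2]] tb])
    then show ?thesis by (simp add: mult.commute)
  qed
  have "((\<lambda>h. norm (torus_series a (x + h) - torus_series a x - ?D h) / norm h) \<longlongrightarrow> 0) (at 0)"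
  proof (rule Lim_null_comparison)
    show "\<forall>\<^sub>F h in at 0. norm (norm (torus_series a (x + h) - torus_series a x - ?D h) / norm h) \<le> C * norm h"
      unfolding eventually_at_filter
    proof (rule always_eventually, intro allI impI)
      fix h :: "real^2" assume "h \<noteq> 0"
      then show "norm (norm (torus_series a (x + h) - torus_series a x - ?D h) / norm h) \<le> C * norm h"
        using est[of h] by (simp add: divide_le_eq power2_eq_square mult.assoc)
    qed
    have "((\<lambda>h::real^2. C * norm h) \<longlongrightarrow> C * norm (0::real^2)) (at 0)"
      by (intro tendsto_intros)
    then show "((\<lambda>h::real^2. C * norm h) \<longlongrightarrow> 0) (at 0)" by simp
  qed
  then show ?thesis unfolding has_derivative_at using bl by simp
qed

lemma torus_series_smooth: assumes "rapid a" shows "smooth_on UNIV (torus_series a)"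
proof -
  have "cont_diff_on k UNIV (torus_series a)" if "rapid a" for k a
    using that
  proof (induction k arbitrary: a)
    case 0
    show ?case using has_derivative_continuous[OF torus_series_has_derivative[OF 0]]
      by (auto intro!: continuous_at_imp_continuous_on)
  next
    case (Suc k)
    show ?case
      by (rule cd_SucI[OF open_UNIV torus_series_has_derivative[OF Suc.prems]])
         (intro cd_add cd_bilinear[OF bounded_bilinear_scaleR] cd_const Suc.IH rapid_freq Suc.prems open_UNIV)
  qed
  then show ?thesis using assms by (simp add: smooth_on_def)
qed

lemma torus_series_dd:
  assumes "rapid a"
  shows "dd (torus_series a) x (axis 1 1) = torus_series (\<lambda>k. a k * (\<i> * of_int (fst k))) x"
    "dd (torus_series a) x (axis 2 1) = torus_series (\<lambda>k. a k * (\<i> * of_int (snd k))) x"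
  by (simp_all add: dd_eq[OF torus_series_has_derivative[OF assms]] axis_def)

subsection \<open>Convolution\<close>

definition conv :: "(int \<times> int \<Rightarrow> 'a::{real_normed_field,banach}) \<Rightarrow> (int \<times> int \<Rightarrow> 'a) \<Rightarrow> int \<times> int \<Rightarrow> 'a" where
  "conv a b k = infsum (\<lambda>j. a j * b (k - j)) UNIV"

text \<open>The convolution is the product family \<open>a j * b l\<close>, summed along the lines \<open>j + l = k\<close>.\<close>

lemma conv_sums:
  fixes a b :: "int \<times> int \<Rightarrow> 'a::{real_normed_field,banach}"
  assumes a: "(\<lambda>k. norm (a k)) summable_on UNIV" and b: "(\<lambda>k. norm (b k)) summable_on UNIV"
  shows "(\<lambda>j. norm (a j * b (k - j))) summable_on UNIV"
    and "conv a b summable_on UNIV"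
    and "infsum (conv a b) UNIV = infsum a UNIV * infsum b UNIV"
proof -
  let ?P = "\<lambda>p. a (fst p) * b (snd p)"
  let ?r = "\<lambda>p::(int \<times> int) \<times> (int \<times> int). (snd p, fst p - snd p)"
  have bij: "bij_betw ?r (UNIV \<times> UNIV) (UNIV \<times> UNIV)"
    by (rule bij_betwI[where g="\<lambda>p. (fst p + snd p, fst p)"]) (auto simp: fun_eq_iff)
  have "(\<lambda>p. norm (?P p)) summable_on UNIV \<times> UNIV"
    unfolding norm_mult by (rule summable_times_nonneg[OF a b]) auto
  then have Pn: "(\<lambda>p. norm (?P (?r p))) summable_on UNIV \<times> UNIV"
    using summable_on_reindex_bij_betw[OF bij, of "\<lambda>p. norm (?P p)"] by blast
  then have Pn': "(\<lambda>(k, j). norm (a j * b (k - j))) summable_on UNIV \<times> UNIV"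
    by (simp add: case_prod_unfold)
  show "(\<lambda>j. norm (a j * b (k - j))) summable_on UNIV"
    using summable_on_SigmaD1[OF Pn'] by simp
  have Ps: "(\<lambda>(k, j). a j * b (k - j)) summable_on UNIV \<times> UNIV"
    using abs_summable_summable[OF Pn] by (simp add: case_prod_unfold)
  show "conv a b summable_on UNIV"
    using summable_on_Sigma_banach[OF Ps] by (simp add: conv_def[abs_def])
  have P0: "?P summable_on UNIV \<times> UNIV"
    using abs_summable_summable[OF \<open>(\<lambda>p. norm (?P p)) summable_on UNIV \<times> UNIV\<close>] .
  have "infsum (conv a b) UNIV = infsum (\<lambda>k. infsum (\<lambda>j. ?P (?r (k, j))) UNIV) UNIV"
    by (simp add: conv_def[abs_def])
  also have "\<dots> = infsum (\<lambda>p. ?P (?r p)) (UNIV \<times> UNIV)"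
    using infsum_Sigma_banach[of "\<lambda>p. ?P (?r p)" UNIV "\<lambda>_. UNIV"] abs_summable_summable[OF Pn] by simp
  also have "\<dots> = infsum ?P (UNIV \<times> UNIV)"
    by (rule infsum_reindex_bij_betw[OF bij])
  also have "\<dots> = infsum (\<lambda>x. infsum (\<lambda>y. ?P (x, y)) UNIV) UNIV"
    using infsum_Sigma_banach[OF P0] by simp
  also have "\<dots> = infsum (\<lambda>x. a x * infsum b UNIV) UNIV"
    by (simp add: infsum_cmult_right abs_summable_summable[OF b])
  also have "\<dots> = infsum a UNIV * infsum b UNIV"
    by (rule infsum_cmult_left) (simp add: abs_summable_summable[OF a])
  finally show "infsum (conv a b) UNIV = infsum a UNIV * infsum b UNIV" .
qed

text \<open>For a submultiplicative weight the weighted \<open>l\<^sup>1\<close> sequences form a Banach algebra under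
  convolution.\<close>

lemma conv_weighted:
  fixes a b :: "int \<times> int \<Rightarrow> complex" and w :: "int \<times> int \<Rightarrow> real"
  assumes w: "\<And>k. w k \<ge> 0" "\<And>j k. w (j + k) \<le> w j * w k"
    and one: "\<And>k. w k \<ge> 1"
    and a: "(\<lambda>k. norm (a k) * w k) summable_on UNIV" and b: "(\<lambda>k. norm (b k) * w k) summable_on UNIV"
  shows "(\<lambda>k. norm (conv a b k) * w k) summable_on UNIV"
    "infsum (\<lambda>k. norm (conv a b k) * w k) UNIV \<le> infsum (\<lambda>k. norm (a k) * w k) UNIV * infsum (\<lambda>k. norm (b k) * w k) UNIV"
proof -
  let ?a = "\<lambda>k. norm (a k) * w k" and ?b = "\<lambda>k. norm (b k) * w k"
  have na: "(\<lambda>k. norm (?a k)) summable_on UNIV" "(\<lambda>k. norm (?b k)) summable_on UNIV"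
    using a b w by (simp_all add: abs_mult)
  note c = conv_sums[OF na]
  have un: "(\<lambda>k. norm (u k)) summable_on UNIV" if "(\<lambda>k. norm (u k) * w k) summable_on UNIV" for u :: "int \<times> int \<Rightarrow> complex"
    by (rule summable_on_comparison_test[OF that]) (use one mult_left_mono[of 1 "w k" "norm (u k)" for k] in auto)
  have le: "norm (conv a b k) * w k \<le> conv ?a ?b k" for k
  proof -
    have s: "(\<lambda>j. norm (a j * b (k - j))) summable_on UNIV"
      by (rule conv_sums(1)) (use un a b in auto)
    have "norm (conv a b k) \<le> infsum (\<lambda>j. norm (a j * b (k - j))) UNIV"
      unfolding conv_def by (rule norm_infsum_bound[OF s])
    then have "norm (conv a b k) * w k \<le> infsum (\<lambda>j. norm (a j * b (k - j))) UNIV * w k"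
      using w(1) by (rule mult_right_mono)
    also have "\<dots> = infsum (\<lambda>j. norm (a j * b (k - j)) * w k) UNIV"
      by (rule infsum_cmult_left[symmetric]) (use s in auto)
    also have "\<dots> \<le> infsum (\<lambda>j. ?a j * ?b (k - j)) UNIV"
    proof (rule infsum_mono)
      show "(\<lambda>j. norm (a j * b (k - j)) * w k) summable_on UNIV" by (rule summable_on_cmult_left[OF s])
      show "(\<lambda>j. ?a j * ?b (k - j)) summable_on UNIV" by (rule abs_summable_summable[OF c(1)])
      fix j
      have "norm (a j * b (k - j)) * w k \<le> norm (a j * b (k - j)) * (w j * w (k - j))"
        using w(2)[of j "k - j"] by (intro mult_left_mono) auto
      then show "norm (a j * b (k - j)) * w k \<le> ?a j * ?b (k - j)" by (simp add: norm_mult mult_ac)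
    qed
    finally show ?thesis by (simp add: conv_def)
  qed
  show s: "(\<lambda>k. norm (conv a b k) * w k) summable_on UNIV"
    by (rule summable_on_comparison_test[OF c(2)]) (use le w in auto)
  have "infsum (\<lambda>k. norm (conv a b k) * w k) UNIV \<le> infsum (conv ?a ?b) UNIV"
    by (rule infsum_mono[OF s c(2) le])
  then show "infsum (\<lambda>k. norm (conv a b k) * w k) UNIV \<le> infsum ?a UNIV * infsum ?b UNIV"
    by (simp add: c(3))
qed

lemma torus_series_conv:
  assumes "(\<lambda>k. norm (a k)) summable_on UNIV" "(\<lambda>k. norm (b k)) summable_on UNIV"
  shows "torus_series (conv a b) x = torus_series a x * torus_series b x"
proof -
  let ?a = "\<lambda>k. a k * wave k x" and ?b = "\<lambda>k. b k * wave k x"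
  have c: "conv ?a ?b k = conv a b k * wave k x" for k
  proof -
    have ph: "phase k x = phase j x + phase (k - j) x" for j by (simp add: phase_def algebra_simps)
    have "?a j * ?b (k - j) = (a j * b (k - j)) * wave k x" for j
      unfolding wave_eq by (simp add: ph[of j] cis_mult[symmetric] mult_ac)
    then have "conv ?a ?b k = infsum (\<lambda>j. (a j * b (k - j)) * wave k x) UNIV"
      unfolding conv_def by presburger
    also have "\<dots> = conv a b k * wave k x"
      unfolding conv_def
      by (rule infsum_cmult_left) (use abs_summable_summable[OF conv_sums(1)[OF assms]] in auto)
    finally show ?thesis .
  qed
  have "(\<lambda>k. norm (?a k)) summable_on UNIV" "(\<lambda>k. norm (?b k)) summable_on UNIV"
    using assms by (simp_all add: norm_mult)
  from conv_sums(3)[OF this] show ?thesis unfolding torus_series_def c[abs_def] by (simp only: c)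
qed


section \<open>The Beltrami equation on the torus\<close>

text \<open>The Fourier multiplier of \<open>\<partial>\<^sub>z (\<partial>\<^sub>z\<^sub>b\<^sub>a\<^sub>r)\<^sup>-\<^sup>1\<close>, set to zero on the constants.\<close>

definition beurling :: "int \<times> int \<Rightarrow> complex" where
  "beurling k = (if k = 0 then 0 else
     (of_int (fst k) - \<i> * of_int (snd k)) / (of_int (fst k) + \<i> * of_int (snd k)))"

lemma freq_nonzero:
  assumes "k \<noteq> 0"
  shows "of_int (fst k) + \<i> * of_int (snd k) \<noteq> (0::complex)"
    "norm (of_int (fst k) + \<i> * of_int (snd k) :: complex) \<ge> 1"
proof -
  let ?z = "of_int (fst k) + \<i> * of_int (snd k) :: complex"
  have "fst k \<noteq> 0 \<or> snd k \<noteq> 0" using assms by (auto simp: zero_prod_def prod_eq_iff)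
  then have "\<bar>Re ?z\<bar> \<ge> 1 \<or> \<bar>Im ?z\<bar> \<ge> 1" by simp linarith
  then show n: "norm ?z \<ge> 1" using abs_Re_le_cmod[of ?z] abs_Im_le_cmod[of ?z] by linarith
  show "?z \<noteq> 0" using n by auto
qed

lemma beurling_norm: "norm (beurling k) \<le> 1"
proof (cases "k = 0")
  case False
  have "norm (of_int (fst k) - \<i> * of_int (snd k) :: complex) = norm (of_int (fst k) + \<i> * of_int (snd k) :: complex)"
    by (simp add: cmod_def)
  then show ?thesis using False freq_nonzero[OF False] by (simp add: beurling_def norm_divide)
qed (simp add: beurling_def)

text \<open>Looking for \<open>W\<close> with \<open>W\<^sub>z\<^sub>b\<^sub>a\<^sub>r = \<phi>\<close> and \<open>W\<^sub>z = 1 + T \<phi>\<close>, where \<open>T\<close> is the multiplier \<open>beurling\<close>,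
  turns the Beltrami equation \<open>W\<^sub>z\<^sub>b\<^sub>a\<^sub>r = \<mu> W\<^sub>z\<close> into \<open>\<phi> = \<mu> (1 + T \<phi>)\<close>. The iterates are the terms
  \<open>(\<mu> T)\<^sup>n \<mu>\<close> of the Neumann series of this equation, written for Fourier coefficients.\<close>

primrec beltrami_iter :: "(int \<times> int \<Rightarrow> complex) \<Rightarrow> nat \<Rightarrow> int \<times> int \<Rightarrow> complex" where
  "beltrami_iter m 0 = m"
| "beltrami_iter m (Suc n) = conv m (\<lambda>k. beurling k * beltrami_iter m n k)"

definition beltrami_sum :: "(int \<times> int \<Rightarrow> complex) \<Rightarrow> int \<times> int \<Rightarrow> complex" where
  "beltrami_sum m k = infsum (\<lambda>n. beltrami_iter m n k) UNIV"

lemma beltrami_iter_weighted: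
  fixes w :: "int \<times> int \<Rightarrow> real"
  assumes w: "\<And>j k. w (j + k) \<le> w j * w k" "\<And>k. w k \<ge> 1"
    and m: "(\<lambda>k. norm (m k) * w k) summable_on UNIV"
  shows "(\<lambda>k. norm (beltrami_iter m n k) * w k) summable_on UNIV \<and>
    infsum (\<lambda>k. norm (beltrami_iter m n k) * w k) UNIV \<le> infsum (\<lambda>k. norm (m k) * w k) UNIV ^ Suc n"
proof (induction n)
  case 0 then show ?case using m by simp
next
  case (Suc n)
  let ?q = "infsum (\<lambda>k. norm (m k) * w k) UNIV"
  let ?b = "\<lambda>k. beurling k * beltrami_iter m n k"
  have w0: "w k \<ge> 0" for k using w(2)[of k] by linarith
  have q0: "?q \<ge> 0" by (rule infsum_nonneg) (use w0 in auto)
  have le: "norm (?b k) * w k \<le> norm (beltrami_iter m n k) * w k" for k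
  proof (rule mult_right_mono[OF _ w0])
    show "norm (?b k) \<le> norm (beltrami_iter m n k)"
      using mult_right_mono[OF beurling_norm[of k] norm_ge_zero[of "beltrami_iter m n k"]] by (simp add: norm_mult)
  qed
  have bs: "(\<lambda>k. norm (?b k) * w k) summable_on UNIV"
    by (rule summable_on_comparison_test[OF conjunct1[OF Suc.IH]]) (use le w0 in auto)
  have "infsum (\<lambda>k. norm (?b k) * w k) UNIV \<le> infsum (\<lambda>k. norm (beltrami_iter m n k) * w k) UNIV"
    by (rule infsum_mono[OF bs conjunct1[OF Suc.IH] le])
  also have "\<dots> \<le> ?q ^ Suc n" using Suc.IH by simp
  finally have b: "infsum (\<lambda>k. norm (?b k) * w k) UNIV \<le> ?q ^ Suc n" .
  note c = conv_weighted[OF w0 w(1) w(2) m bs]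
  have "infsum (\<lambda>k. norm (conv m ?b k) * w k) UNIV \<le> ?q * infsum (\<lambda>k. norm (?b k) * w k) UNIV"
    by (rule c(2))
  also have "\<dots> \<le> ?q * ?q ^ Suc n" using b q0 by (rule mult_left_mono)
  finally show ?case using c(1) by simp
qed

lemma beltrami_sum_weighted:
  fixes w :: "int \<times> int \<Rightarrow> real"
  assumes w: "\<And>j k. w (j + k) \<le> w j * w k" "\<And>k. w k \<ge> 1"
    and m: "(\<lambda>k. norm (m k) * w k) summable_on UNIV"
    and q: "q = infsum (\<lambda>k. norm (m k) * w k) UNIV" "q < 1"
  shows "(\<lambda>(n, k). norm (beltrami_iter m n k)) summable_on UNIV \<times> UNIV"
    and "(\<lambda>k. norm (beltrami_sum m k) * w k) summable_on UNIV"
    and "infsum (\<lambda>k. norm (beltrami_sum m k) * w k) UNIV \<le> q / (1 - q)"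
proof -
  have w0: "w k \<ge> 0" for k using w(2)[of k] by linarith
  have q0: "q \<ge> 0" unfolding q(1) by (rule infsum_nonneg) (use w0 in auto)
  note it = beltrami_iter_weighted[OF w m, folded q(1)]
  let ?N = "\<lambda>n. infsum (\<lambda>k. norm (beltrami_iter m n k) * w k) UNIV"
  let ?f = "\<lambda>p. norm (beltrami_iter m (fst p) (snd p)) * w (snd p)"
  have geo: "(\<lambda>n. q ^ Suc n) summable_on UNIV"
    using q0 q(2) by (subst summable_on_UNIV_nonneg_real_iff) (auto intro!: summable_mult summable_geometric)
  have N0: "?N n \<ge> 0" for n by (rule infsum_nonneg) (use w0 in auto)
  have Ns: "?N summable_on UNIV"
    by (rule summable_on_comparison_test[OF geo]) (use it N0 in auto)
  have f: "?f summable_on UNIV \<times> UNIV"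
  proof (rule summable_on_SigmaI)
    show "((\<lambda>k. ?f (n, k)) has_sum ?N n) UNIV" for n
      using has_sum_infsum[OF conjunct1[OF it[of n]]] by simp
  qed (use Ns w0 in auto)
  have fle: "norm (beltrami_iter m n k) \<le> norm (beltrami_iter m n k) * w k" for n k
    using w(2) mult_left_mono[of 1 "w k" "norm (beltrami_iter m n k)"] by simp
  show s: "(\<lambda>(n, k). norm (beltrami_iter m n k)) summable_on UNIV \<times> UNIV"
    by (rule summable_on_comparison_test[OF f]) (use fle in auto)
  have f': "(\<lambda>(n, k). norm (beltrami_iter m n k) * w k) summable_on UNIV \<times> UNIV"
    using f by (simp add: case_prod_unfold)
  have fs: "(\<lambda>(k, n). norm (beltrami_iter m n k) * w k) summable_on UNIV \<times> UNIV"
    using summable_on_swap[THEN iffD1, OF f'] by (simp add: case_prod_unfold)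
  have inn: "(\<lambda>n. norm (beltrami_iter m n k) * w k) summable_on UNIV" for k
    using summable_on_SigmaD1[OF fs] by simp
  have outs: "(\<lambda>k. infsum (\<lambda>n. norm (beltrami_iter m n k) * w k) UNIV) summable_on UNIV"
    using summable_on_Sigma_banach[OF fs] by simp
  have le: "norm (beltrami_sum m k) * w k \<le> infsum (\<lambda>n. norm (beltrami_iter m n k) * w k) UNIV" for k
  proof -
    have s1: "(\<lambda>n. norm (beltrami_iter m n k)) summable_on UNIV"
      by (rule summable_on_comparison_test[OF inn[of k]]) (use fle in auto)
    have "norm (beltrami_sum m k) * w k \<le> infsum (\<lambda>n. norm (beltrami_iter m n k)) UNIV * w k"
      unfolding beltrami_sum_def using w0 by (intro mult_right_mono norm_infsum_bound[OF s1])
    also have "\<dots> = infsum (\<lambda>n. norm (beltrami_iter m n k) * w k) UNIV"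
      by (rule infsum_cmult_left[symmetric]) (use s1 in auto)
    finally show ?thesis .
  qed
  show bs: "(\<lambda>k. norm (beltrami_sum m k) * w k) summable_on UNIV"
    by (rule summable_on_comparison_test[OF outs]) (use le w0 in auto)
  have "infsum (\<lambda>k. norm (beltrami_sum m k) * w k) UNIV \<le>
      infsum (\<lambda>k. infsum (\<lambda>n. norm (beltrami_iter m n k) * w k) UNIV) UNIV"
    by (rule infsum_mono[OF bs outs le])
  also have "\<dots> = infsum ?N UNIV" by (rule infsum_swap_banach[OF fs])
  also have "\<dots> \<le> infsum (\<lambda>n. q ^ Suc n) UNIV"
    by (rule infsum_mono[OF Ns geo]) (use it in auto)
  also have "\<dots> = q / (1 - q)"
  proof -
    have "(\<lambda>n. q * q ^ n) sums (q * (1 / (1 - q)))"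
      using q0 q(2) by (intro sums_mult geometric_sums) auto
    moreover have "(\<lambda>n. q * q ^ n) sums infsum (\<lambda>n. q ^ Suc n) UNIV"
      using has_sum_imp_sums[OF has_sum_infsum[OF geo]] by simp
    ultimately show ?thesis using sums_unique2 by fastforce
  qed
  finally show "infsum (\<lambda>k. norm (beltrami_sum m k) * w k) UNIV \<le> q / (1 - q)" .
qed

lemma weight_convex:
  assumes "0 \<le> e" "e \<le> 1" "0 \<le> (t::real)"
  shows "(1 + e * t) ^ s \<le> 1 - e + e * (1 + t) ^ s"
proof (induction s)
  case (Suc s)
  let ?X = "(1 + t) ^ s"
  have X: "?X \<ge> 1" using assms by simp
  have "(1 + e * t) ^ Suc s \<le> (1 + e * t) * (1 - e + e * ?X)"
    using Suc assms by (simp add: mult_left_mono)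
  also have "\<dots> = 1 - e + e * (1 + t) ^ Suc s - e * t * (1 - e) * (?X - 1)"
    by (simp add: algebra_simps)
  also have "\<dots> \<le> 1 - e + e * (1 + t) ^ Suc s" using assms X by simp
  finally show ?case .
qed simp

text \<open>The weights \<open>(1 + \<epsilon> |k|)\<^sup>s\<close> define the same space for every \<open>\<epsilon> > 0\<close>, but by
  \<open>weight_convex\<close> the norm of a rapidly decreasing sequence tends to its \<open>l\<^sup>1\<close> norm as \<open>\<epsilon> \<rightarrow> 0\<close>.
  So smallness in \<open>l\<^sup>1\<close> alone makes the Neumann series converge in every weighted space.\<close>

lemma beltrami_sum_rapid:
  assumes m: "rapid m" and q: "infsum (\<lambda>k. norm (m k)) UNIV < 1"
  shows "rapid (beltrami_sum m)"
  unfolding rapid_def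
proof
  fix s
  define q where "q = infsum (\<lambda>k. norm (m k)) UNIV"
  define C where "C = infsum (\<lambda>k. norm (m k) * (1 + freq_size k) ^ s) UNIV"
  have ms: "(\<lambda>k. norm (m k)) summable_on UNIV" "(\<lambda>k. norm (m k) * (1 + freq_size k) ^ s) summable_on UNIV"
    using rapid_summable[OF m] m by (simp_all add: rapid_def)
  have C0: "C \<ge> 0" unfolding C_def by (rule infsum_nonneg) (use freq_size_nonneg in auto)
  have q1: "q < 1" using q by (simp add: q_def)
  \<comment> \<open>small enough that the weighted norm, at most \<open>q + e * C\<close>, stays below \<open>1\<close>\<close>
  define e where "e = min 1 ((1 - q) / (2 * (C + 1)))"
  have e: "0 < e" "e \<le> 1" using q1 C0 by (auto simp: e_def)
  have "e * C \<le> (1 - q) / (2 * (C + 1)) * C" using C0 by (intro mult_right_mono) (auto simp: e_def)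
  also have "\<dots> < 1 - q"
  proof -
    have "(1 - q) * C < (1 - q) * (2 * (C + 1))" using q1 C0 by (intro mult_strict_left_mono) auto
    then show ?thesis using C0 by (simp add: divide_less_eq)
  qed
  finally have eC: "q + e * C < 1" by simp
  define w where "w k = (1 + e * freq_size k) ^ s" for k
  have fs: "freq_size (j + k) \<le> freq_size j + freq_size k" for j k
    by (simp add: freq_size_def)
  have w1: "w k \<ge> 1" for k using e freq_size_nonneg[of k] by (simp add: w_def)
  have w2: "w (j + k) \<le> w j * w k" for j k
  proof -
    have "1 + e * freq_size (j + k) \<le> 1 + e * (freq_size j + freq_size k)"
      using e fs[of j k] by simp
    also have "\<dots> \<le> (1 + e * freq_size j) * (1 + e * freq_size k)"
      using e freq_size_nonneg[of j] freq_size_nonneg[of k] by (simp add: algebra_simps)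
    finally show ?thesis unfolding w_def power_mult_distrib[symmetric]
      using e freq_size_nonneg[of "j + k"] by (intro power_mono) auto
  qed
  have le: "norm (m k) * w k \<le> norm (m k) + e * (norm (m k) * (1 + freq_size k) ^ s)" for k
  proof -
    have "w k \<le> 1 + e * (1 + freq_size k) ^ s"
      using weight_convex[of e "freq_size k" s] e freq_size_nonneg[of k] by (simp add: w_def)
    from mult_left_mono[OF this norm_ge_zero[of "m k"]] show ?thesis by (simp add: algebra_simps)
  qed
  have rs: "(\<lambda>k. norm (m k) + e * (norm (m k) * (1 + freq_size k) ^ s)) summable_on UNIV"
    by (intro summable_on_add summable_on_cmult_right ms)
  have mw: "(\<lambda>k. norm (m k) * w k) summable_on UNIV"
    by (rule summable_on_comparison_test[OF rs]) (use le w1 in \<open>auto simp: w_def e freq_size_nonneg less_imp_le\<close>)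
  have "infsum (\<lambda>k. norm (m k) * w k) UNIV \<le> infsum (\<lambda>k. norm (m k) + e * (norm (m k) * (1 + freq_size k) ^ s)) UNIV"
    by (rule infsum_mono[OF mw rs le])
  also have "\<dots> = q + e * C"
    unfolding q_def C_def using ms
    by (subst infsum_add) (auto intro!: summable_on_cmult_right infsum_cmult_right)
  finally have "infsum (\<lambda>k. norm (m k) * w k) UNIV < 1" using eC by simp
  from beltrami_sum_weighted(2)[OF w2 w1 mw refl this]
  have bw: "(\<lambda>k. norm (beltrami_sum m k) * w k) summable_on UNIV" .
  show "(\<lambda>k. norm (beltrami_sum m k) * (1 + freq_size k) ^ s) summable_on UNIV"
  proof (rule summable_on_comparison_test)
    show "(\<lambda>k. (1 / e) ^ s * (norm (beltrami_sum m k) * w k)) summable_on UNIV"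
      by (rule summable_on_cmult_right[OF bw])
    fix k
    have "1 + freq_size k \<le> (1 / e) * (1 + e * freq_size k)" using e by (simp add: field_simps)
    then have "(1 + freq_size k) ^ s \<le> (1 / e) ^ s * w k"
      unfolding w_def power_mult_distrib[symmetric] using freq_size_nonneg[of k] by (intro power_mono) auto
    from mult_left_mono[OF this norm_ge_zero[of "beltrami_sum m k"]]
    show "norm (beltrami_sum m k) * (1 + freq_size k) ^ s \<le> (1 / e) ^ s * (norm (beltrami_sum m k) * w k)"
      by (simp add: mult_ac)
  qed (use freq_size_nonneg in auto)
qed

text \<open>Summing the recursion of the Neumann series gives \<open>\<phi> = \<mu> (1 + T \<phi>)\<close> at the level of
  functions.\<close>

lemma beltrami_sum_equation:
  assumes m: "rapid m" and q: "infsum (\<lambda>k. norm (m k)) UNIV < 1"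
  shows "torus_series (beltrami_sum m) x =
    torus_series m x * (1 + torus_series (\<lambda>k. beurling k * beltrami_sum m k) x)"
proof -
  have s1: "(\<lambda>k. norm (m k) * 1) summable_on UNIV" using rapid_summable[OF m] by simp
  note B = beltrami_sum_weighted(1)[of "\<lambda>_. 1", OF _ _ s1 refl]
  have B: "(\<lambda>(n, k). norm (beltrami_iter m n k)) summable_on UNIV \<times> UNIV"
    by (rule B) (use q in auto)
  have it: "(\<lambda>k. norm (beltrami_iter m n k)) summable_on UNIV" for n
    using summable_on_SigmaD1[OF B] by simp
  have bit: "(\<lambda>k. norm (beurling k * beltrami_iter m n k)) summable_on UNIV" for n
    by (rule summable_on_comparison_test[OF it[of n]])
       (use mult_right_mono[OF beurling_norm norm_ge_zero] in \<open>auto simp: norm_mult\<close>)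
  have sums: "(\<lambda>n. torus_series (\<lambda>k. c k * beltrami_iter m n k) x) sums torus_series (\<lambda>k. c k * beltrami_sum m k) x"
    if c: "\<And>k. norm (c k) \<le> 1" for c
  proof -
    have P: "(\<lambda>p. norm (c (snd p) * beltrami_iter m (fst p) (snd p) * wave (snd p) x)) summable_on UNIV \<times> UNIV"
      by (rule summable_on_comparison_test[OF B])
         (use mult_right_mono[OF c norm_ge_zero] in \<open>auto simp: norm_mult\<close>)
    have P1: "(\<lambda>(n, k). c k * beltrami_iter m n k * wave k x) summable_on UNIV \<times> UNIV"
      using abs_summable_summable[OF P] by (simp add: case_prod_unfold)
    have "(\<lambda>n. torus_series (\<lambda>k. c k * beltrami_iter m n k) x) summable_on UNIV"
      using summable_on_Sigma_banach[OF P1] by (simp add: torus_series_def)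
    then have "(\<lambda>n. torus_series (\<lambda>k. c k * beltrami_iter m n k) x) sums
        infsum (\<lambda>n. torus_series (\<lambda>k. c k * beltrami_iter m n k) x) UNIV"
      by (intro has_sum_imp_sums has_sum_infsum)
    also have "infsum (\<lambda>n. torus_series (\<lambda>k. c k * beltrami_iter m n k) x) UNIV =
        infsum (\<lambda>k. infsum (\<lambda>n. c k * beltrami_iter m n k * wave k x) UNIV) UNIV"
      unfolding torus_series_def by (rule infsum_swap_banach[OF P1])
    also have "\<dots> = torus_series (\<lambda>k. c k * beltrami_sum m k) x"
    proof -
      have B2: "(\<lambda>(k, n). norm (beltrami_iter m n k)) summable_on UNIV \<times> UNIV"
        using summable_on_swap[THEN iffD1, OF B] by (simp add: case_prod_unfold)
      have "(\<lambda>n. beltrami_iter m n k) summable_on UNIV" for k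
        by (rule abs_summable_summable) (use summable_on_SigmaD1[OF B2] in simp)
      then have "infsum (\<lambda>n. c k * beltrami_iter m n k * wave k x) UNIV = c k * beltrami_sum m k * wave k x" for k
        unfolding beltrami_sum_def
        using infsum_cmult_right[of "c k * wave k x" "\<lambda>n. beltrami_iter m n k" UNIV] by (simp add: mult_ac)
      then show ?thesis by (simp add: torus_series_def)
    qed
    finally show ?thesis .
  qed
  have A: "(\<lambda>n. torus_series (beltrami_iter m n) x) sums torus_series (beltrami_sum m) x"
    using sums[of "\<lambda>_. 1"] by simp
  have T: "(\<lambda>n. torus_series (\<lambda>k. beurling k * beltrami_iter m n k) x) sums
      torus_series (\<lambda>k. beurling k * beltrami_sum m k) x"
    by (rule sums[OF beurling_norm])
  have "torus_series (beltrami_iter m (Suc n)) x =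
      torus_series m x * torus_series (\<lambda>k. beurling k * beltrami_iter m n k) x" for n
    using torus_series_conv[OF rapid_summable[OF m] bit[of n]] by simp
  then have "(\<lambda>n. torus_series (beltrami_iter m (Suc n)) x) sums
      (torus_series m x * torus_series (\<lambda>k. beurling k * beltrami_sum m k) x)"
    using sums_mult[OF T, of "torus_series m x"] by simp
  from sums_Suc[OF this]
  have "(\<lambda>n. torus_series (beltrami_iter m n) x) sums
      (torus_series m x * torus_series (\<lambda>k. beurling k * beltrami_sum m k) x + torus_series m x)" by simp
  from sums_unique2[OF A this] show ?thesis by (simp add: algebra_simps)
qed

text \<open>The solution is \<open>W = z + \<phi>\<^sub>0 z\<^sup>* + \<Sum> b\<^sub>k e\<^sub>k\<close>, where the \<open>b\<^sub>k\<close> integrate the nonconstant part of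
  \<open>\<phi>\<close>. The bound \<open>1/2\<close> on the norm of \<open>\<mu>\<close> gives \<open>|T \<phi>| \<le> q / (1 - q) < 1\<close>, so \<open>W\<^sub>z\<close> has no
  zero. In the statement, \<open>\<partial>\<^sub>1 W + i \<partial>\<^sub>2 W\<close> is \<open>2 W\<^sub>z\<^sub>b\<^sub>a\<^sub>r\<close> and \<open>\<partial>\<^sub>1 W - i \<partial>\<^sub>2 W\<close> is \<open>2 W\<^sub>z\<close>.\<close>

theorem torus_beltrami:
  assumes m: "rapid m" and q: "infsum (\<lambda>k. norm (m k)) UNIV < 1 / 2"
  obtains W :: "real^2 \<Rightarrow> complex" where "smooth_on UNIV W"
    "\<And>x. dd W x (axis 1 1) + \<i> * dd W x (axis 2 1) = torus_series m x * (dd W x (axis 1 1) - \<i> * dd W x (axis 2 1))"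
    "\<And>x. dd W x (axis 1 1) - \<i> * dd W x (axis 2 1) \<noteq> 0"
proof -
  define q where "q = infsum (\<lambda>k. norm (m k)) UNIV"
  have q12: "q < 1/2" using q by (simp add: q_def)
  have q0: "q \<ge> 0" unfolding q_def by (rule infsum_nonneg) auto
  let ?\<phi> = "beltrami_sum m"
  have r: "rapid ?\<phi>" by (rule beltrami_sum_rapid[OF m]) (use q in simp)
  define b where "b k = (if k = 0 then 0 else 2 * ?\<phi> k / (\<i> * (of_int (fst k) + \<i> * of_int (snd k))))" for k
  have rb: "rapid b"
  proof -
    have "rapid (\<lambda>k. ?\<phi> k * (if k = 0 then 0 else 2 / (\<i> * (of_int (fst k) + \<i> * of_int (snd k)))))"
    proof (rule rapid_mult[OF r, where C=2])
      fix k :: "int \<times> int"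
      show "norm (if k = 0 then 0 else 2 / (\<i> * (of_int (fst k) + \<i> * of_int (snd k))) :: complex) \<le> 2 * (1 + freq_size k)"
      proof (cases "k = 0")
        case False
        have "norm (2 / (\<i> * (of_int (fst k) + \<i> * of_int (snd k))) :: complex) =
            2 / norm (of_int (fst k) + \<i> * of_int (snd k) :: complex)"
          by (simp add: norm_divide norm_mult)
        also have "\<dots> \<le> 2 / 1" using freq_nonzero(2)[OF False] by (intro divide_left_mono) auto
        finally show ?thesis using False freq_size_nonneg[of k] by simp
      qed (use freq_size_nonneg in simp)
    qed
    moreover have "(\<lambda>k. ?\<phi> k * (if k = 0 then 0 else 2 / (\<i> * (of_int (fst k) + \<i> * of_int (snd k))))) = b"
      by (auto simp: b_def)
    ultimately show ?thesis by simp
  qed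
  note r1 = rapid_freq(1)[OF rb] and r2 = rapid_freq(2)[OF rb]
  define L where "L x = of_real (x $ 1) * (1 + ?\<phi> 0) + of_real (x $ 2) * (\<i> * (1 - ?\<phi> 0))" for x :: "real^2"
  have bL: "bounded_linear L"
    unfolding L_def[abs_def]
    by (intro bounded_linear_add bounded_linear_compose[OF bounded_linear_mult_left]
          bounded_linear_compose[OF bounded_linear_of_real] bounded_linear_vec_nth)
  define W where "W x = L x + torus_series b x" for x
  have smW: "smooth_on UNIV W"
    unfolding W_def[abs_def] by (intro smooth_add smooth_bounded_linear[OF bL] torus_series_smooth[OF rb]) auto
  have dW: "dd W x v = L v + dd (torus_series b) x v" for x v
    unfolding W_def[abs_def]
    by (intro dd_eq has_derivative_add bounded_linear_imp_has_derivative[OF bL]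
        smooth_derivative[OF torus_series_smooth[OF rb]]) auto
  have d1: "dd W x (axis 1 1) = 1 + ?\<phi> 0 + torus_series (\<lambda>k. b k * (\<i> * of_int (fst k))) x" for x
    unfolding dW torus_series_dd[OF rb] by (simp add: L_def axis_def)
  have d2: "dd W x (axis 2 1) = \<i> * (1 - ?\<phi> 0) + torus_series (\<lambda>k. b k * (\<i> * of_int (snd k))) x" for x
    unfolding dW torus_series_dd[OF rb] by (simp add: L_def axis_def)
  have P: "dd W x (axis 1 1) + \<i> * dd W x (axis 2 1) = 2 * torus_series ?\<phi> x" for x
  proof -
    have "b k * (\<i> * of_int (fst k)) + \<i> * (b k * (\<i> * of_int (snd k))) + (if k = 0 then 2 * ?\<phi> 0 else 0) = 2 * ?\<phi> k" for k
    proof (cases "k = 0")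
      case False
      have "b k * (\<i> * of_int (fst k)) + \<i> * (b k * (\<i> * of_int (snd k))) =
          b k * (\<i> * (of_int (fst k) + \<i> * of_int (snd k)))" by (simp add: algebra_simps)
      also have "\<dots> = 2 * ?\<phi> k" using False freq_nonzero(1)[OF False] by (simp add: b_def)
      finally show ?thesis using False by simp
    qed (simp add: b_def)
    then have "2 * torus_series ?\<phi> x = torus_series (\<lambda>k. (b k * (\<i> * of_int (fst k)) + \<i> * (b k * (\<i> * of_int (snd k))))
        + (if k = 0 then 2 * ?\<phi> 0 else 0)) x"
      using torus_series_cmult[OF r, of 2 x] by simp
    also have "\<dots> = torus_series (\<lambda>k. b k * (\<i> * of_int (fst k))) x + \<i> * torus_series (\<lambda>k. b k * (\<i> * of_int (snd k))) x + 2 * ?\<phi> 0"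
    proof -
      have "rapid (\<lambda>k. \<i> * (b k * (\<i> * of_int (snd k))))"
        using rapid_mult[OF r2, of "\<lambda>_. \<i>" 1] freq_size_nonneg by (simp add: mult_ac)
      then show ?thesis
        by (simp only: torus_series_add rapid_add r1 r2 rapid_single torus_series_single torus_series_cmult)
    qed
    finally show ?thesis unfolding d1 d2 by (simp add: algebra_simps)
  qed
  have R: "dd W x (axis 1 1) - \<i> * dd W x (axis 2 1) = 2 * (1 + torus_series (\<lambda>k. beurling k * ?\<phi> k) x)" for x
  proof -
    have e: "b k * (\<i> * of_int (fst k)) + (- \<i>) * (b k * (\<i> * of_int (snd k))) = 2 * (beurling k * ?\<phi> k)" for k
    proof (cases "k = 0")
      case False
      have "b k * (\<i> * of_int (fst k)) + (- \<i>) * (b k * (\<i> * of_int (snd k))) =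
          b k * (\<i> * (of_int (fst k) - \<i> * of_int (snd k)))" by (simp add: algebra_simps)
      also have "\<dots> = 2 * (beurling k * ?\<phi> k)" using False freq_nonzero(1)[OF False] by (simp add: b_def beurling_def)
      finally show ?thesis .
    qed (simp add: b_def beurling_def)
    have rT: "rapid (\<lambda>k. beurling k * ?\<phi> k)"
    proof -
      have "rapid (\<lambda>k. ?\<phi> k * beurling k)"
        by (rule rapid_mult[OF r, where C=1])
           (use beurling_norm freq_size_nonneg in \<open>auto intro: order_trans[OF beurling_norm]\<close>)
      then show ?thesis by (simp add: mult.commute)
    qed
    have "2 * torus_series (\<lambda>k. beurling k * ?\<phi> k) x =
        torus_series (\<lambda>k. b k * (\<i> * of_int (fst k)) + (- \<i>) * (b k * (\<i> * of_int (snd k)))) x"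
      unfolding e by (rule torus_series_cmult[OF rT, symmetric])
    also have "\<dots> = torus_series (\<lambda>k. b k * (\<i> * of_int (fst k))) x + (- \<i>) * torus_series (\<lambda>k. b k * (\<i> * of_int (snd k))) x"
    proof -
      have "rapid (\<lambda>k. (- \<i>) * (b k * (\<i> * of_int (snd k))))"
        using rapid_mult[OF r2, of "\<lambda>_. - \<i>" 1] freq_size_nonneg by (simp add: mult_ac)
      then show ?thesis by (simp only: torus_series_add r1 r2 torus_series_cmult)
    qed
    finally show ?thesis unfolding d1 d2 by (simp add: algebra_simps)
  qed
  have bound: "norm (torus_series (\<lambda>k. beurling k * ?\<phi> k) x) < 1" for x
  proof -
    have s1: "(\<lambda>k. norm (m k) * 1) summable_on UNIV" using rapid_summable[OF m] by simp
    have q': "q = infsum (\<lambda>k. norm (m k) * 1) UNIV" by (simp add: q_def)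
    have "infsum (\<lambda>k. norm (?\<phi> k) * 1) UNIV \<le> q / (1 - q)"
      by (rule beltrami_sum_weighted(3)[of "\<lambda>_. 1", OF _ _ s1 q']) (use q12 in auto)
    also have "\<dots> < 1" using q12 by (simp add: divide_less_eq)
    finally have l: "infsum (\<lambda>k. norm (?\<phi> k)) UNIV < 1" by simp
    have nle: "norm (beurling k * ?\<phi> k) \<le> norm (?\<phi> k)" for k
      using mult_right_mono[OF beurling_norm[of k] norm_ge_zero[of "?\<phi> k"]] by (simp add: norm_mult)
    have s2: "(\<lambda>k. norm (beurling k * ?\<phi> k)) summable_on UNIV"
      by (rule summable_on_comparison_test[OF rapid_summable[OF r]]) (use nle in auto)
    have "norm (torus_series (\<lambda>k. beurling k * ?\<phi> k) x) \<le> infsum (\<lambda>k. norm (beurling k * ?\<phi> k)) UNIV"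
      unfolding torus_series_def
      using norm_infsum_bound[of "\<lambda>k. beurling k * ?\<phi> k * wave k x" UNIV] s2 by (simp add: norm_mult)
    also have "\<dots> \<le> infsum (\<lambda>k. norm (?\<phi> k)) UNIV"
      by (rule infsum_mono[OF s2 rapid_summable[OF r] nle])
    finally show ?thesis using l by simp
  qed
  show ?thesis
  proof (rule that[OF smW])
    fix x
    show "dd W x (axis 1 1) + \<i> * dd W x (axis 2 1) = torus_series m x * (dd W x (axis 1 1) - \<i> * dd W x (axis 2 1))"
      unfolding P R using beltrami_sum_equation[OF m, of x] q by simp
    show "dd W x (axis 1 1) - \<i> * dd W x (axis 2 1) \<noteq> 0"
    proof
      assume "dd W x (axis 1 1) - \<i> * dd W x (axis 2 1) = 0"
      then have "torus_series (\<lambda>k. beurling k * ?\<phi> k) x = -1" unfolding R by (simp add: add_eq_0_iff)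
      then show False using bound[of x] by simp
    qed
  qed
qed


section \<open>Periodization at a small scale\<close>

definition periodic_chart :: "real^2 \<Rightarrow> real^2 \<Rightarrow> real^2 \<Rightarrow> real \<Rightarrow> real^2 \<Rightarrow> real^2" where
  "periodic_chart x0 P1 P2 e s = x0 + e *\<^sub>R (sawtooth (s $ 1) *\<^sub>R P1 + sawtooth (s $ 2) *\<^sub>R P2)"

lemma dd_slice:
  fixes H :: "real \<times> (real^2) \<Rightarrow> 'b::real_normed_vector"
  assumes "H differentiable (at (e, s))"
  shows "dd (\<lambda>s. H (e, s)) s v = dd H (e, s) (0, v)"
proof -
  have "((\<lambda>s. (e, s)) has_derivative (\<lambda>v. (0, v))) (at s)"
    by (intro has_derivative_Pair has_derivative_const has_derivative_ident)
  from has_derivative_compose[OF this dd_has_derivative[OF assms]] show ?thesis by (rule dd_eq)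
qed

text \<open>A function vanishing at \<open>x\<^sub>0\<close>, read through \<open>periodic_chart\<close> with scale \<open>e\<close>, becomes a smooth
  function on the torus. It tends to zero with all derivatives as \<open>e \<rightarrow> 0\<close>, so its Fourier
  coefficients become small in \<open>l\<^sup>1\<close>.\<close>

lemma small_torus_coeff:
  fixes f :: "real^2 \<Rightarrow> complex"
  assumes U: "open U" "x0 \<in> U" and f: "smooth_on U f" "f x0 = 0"
  obtains e where "e > 0"
    "\<And>s. periodic_chart x0 P1 P2 e s \<in> U"
    "smooth_on UNIV (\<lambda>s. f (periodic_chart x0 P1 P2 e s))"
    "torus_periodic (\<lambda>s. f (periodic_chart x0 P1 P2 e s))"
    "infsum (\<lambda>k. norm (torus_coeff (\<lambda>s. f (periodic_chart x0 P1 P2 e s)) k)) UNIV < 1 / 2"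
proof -
  define \<Phi> where "\<Phi> s = sawtooth (s $ 1) *\<^sub>R P1 + sawtooth (s $ 2) *\<^sub>R P2" for s :: "real^2"
  have saw: "smooth_on UNIV (\<lambda>s::real^2. sawtooth (s $ i))" for i
    by (rule smooth_compose[OF _ _ smooth_vec_nth[OF open_UNIV smooth_id] smooth_sawtooth]) auto
  have sm\<Phi>: "smooth_on UNIV \<Phi>"
    unfolding \<Phi>_def[abs_def] by (intro smooth_add smooth_scaleR smooth_const saw) auto
  define R where "R = 4 * norm P1 + 4 * norm P2"
  have \<Phi>R: "norm (\<Phi> s) \<le> R" for s
    unfolding \<Phi>_def R_def
    by (rule order_trans[OF norm_triangle_ineq]) (auto intro!: add_mono mult_right_mono sawtooth_bound)
  have R0: "R \<ge> 0" by (simp add: R_def)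
  define \<Psi> where "\<Psi> p = x0 + fst p *\<^sub>R \<Phi> (snd p)" for p :: "real \<times> (real^2)"
  have sm\<Psi>: "smooth_on UNIV \<Psi>"
  proof -
    have "smooth_on UNIV (\<lambda>p::real \<times> (real^2). \<Phi> (snd p))"
      by (rule smooth_compose[OF _ _ _ sm\<Phi>]) (auto intro: smooth_bounded_linear[OF bounded_linear_snd])
    then show ?thesis unfolding \<Psi>_def[abs_def]
      by (intro smooth_add smooth_scaleR smooth_const smooth_bounded_linear[OF bounded_linear_fst]) auto
  qed
  define O1 where "O1 = \<Psi> -` U"
  have O1: "open O1" unfolding O1_def
    using smooth_continuous[OF sm\<Psi>] U(1) by (simp add: continuous_on_open_vimage)
  define K where "K p = f (\<Psi> p)" for p
  have K: "smooth_on O1 K" unfolding K_def[abs_def]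
    by (rule smooth_compose[OF O1 U(1) _ f(1)]) (auto simp: O1_def intro: smooth_subset[OF sm\<Psi>])
  \<comment> \<open>Scale and position form one variable, so that the dependence on both is jointly smooth;
    \<open>T\<close> is \<open>one_minus_sq\<close> in the position.\<close>
  define T where "T i H p = H p - dd (\<lambda>z. dd H z (0, axis i 1)) p (0, axis i 1)"
    for i :: 2 and H :: "real \<times> (real^2) \<Rightarrow> complex" and p
  have smT: "smooth_on O1 (T i H)" if "smooth_on O1 H" for i H
    unfolding T_def[abs_def] by (intro smooth_diff smooth_dd that O1)
  have sliceT: "one_minus_sq i (\<lambda>s. H (e, s)) = (\<lambda>s. T i H (e, s))"
    if H: "smooth_on O1 H" and e: "\<And>s. (e, s) \<in> O1" for i H e
  proof
    fix s
    have d: "dd (\<lambda>s. G (e, s)) s v = dd G (e, s) (0, v)" if "smooth_on O1 G" for G :: "real \<times> (real^2) \<Rightarrow> complex" and s v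
      by (rule dd_slice[OF smooth_diff_at[OF that e]])
    show "one_minus_sq i (\<lambda>s. H (e, s)) s = T i H (e, s)"
      unfolding one_minus_sq_def T_def d[OF H] d[OF smooth_dd[OF H]] ..
  qed
  have slice: "damping (\<lambda>s. K (e, s)) s = T 1 (T 2 K) (e, s)" if "\<And>s. (e, s) \<in> O1" for e s
    using sliceT[OF K that, of 2] sliceT[OF smT[OF K] that, of 1 2] by simp
  have zeroO: "(0, s) \<in> O1" for s using U(2) by (simp add: O1_def \<Psi>_def)
  have z: "T 1 (T 2 K) (0, s) = 0" for s
  proof -
    have "one_minus_sq i (\<lambda>s::real^2. 0::complex) = (\<lambda>s. 0)" for i
    proof -
      have "dd (\<lambda>s::real^2. 0::complex) x v = 0" for x v by (rule dd_eq) simp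
      then show ?thesis by (simp add: one_minus_sq_def fun_eq_iff)
    qed
    moreover have "(\<lambda>s. K (0, s)) = (\<lambda>s. 0)" by (simp add: K_def \<Psi>_def f(2))
    ultimately show ?thesis using slice[of 0 s, OF zeroO] by simp
  qed
  define C0 where "C0 = infsum (\<lambda>k. 1 / damping_factor k) UNIV"
  have C0: "C0 \<ge> 0" unfolding C0_def by (rule infsum_nonneg) (use damping_factor_pos in \<open>auto simp: less_imp_le\<close>)
  define \<eta> where "\<eta> = 1 / (4 * (C0 + 1))"
  have \<eta>: "\<eta> > 0" "\<eta> * C0 < 1 / 2" using C0 by (auto simp: \<eta>_def divide_less_eq)
  \<comment> \<open>The set where the damped function is small contains the slice of scale \<open>0\<close>, hence a tube
    around its compact part.\<close>
  define O2 where "O2 = O1 \<inter> (\<lambda>p. norm (T 1 (T 2 K) p)) -` {..<\<eta>}"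
  have O2: "open O2" unfolding O2_def
    by (rule continuous_open_preimage[OF continuous_on_norm[OF smooth_continuous[OF smT[OF smT[OF K]]]] O1]) auto
  define Sq where "Sq = {plane_pt x y | x y. x \<in> {-pi..pi} \<and> y \<in> {-pi..pi}}"
  have Sq: "compact Sq"
  proof -
    have "Sq = (\<lambda>p. plane_pt (fst p) (snd p)) ` ({-pi..pi} \<times> {-pi..pi})" by (force simp: Sq_def)
    then show ?thesis by (auto intro!: compact_continuous_image continuous_intros compact_Times)
  qed
  have "{0} \<times> Sq \<subseteq> O2" using zeroO z \<eta>(1) by (auto simp: O2_def)
  then obtain r where r: "r > 0" "(\<Union>p\<in>{0} \<times> Sq. ball p r) \<subseteq> O2"
    using compact_subset_open_imp_ball_epsilon_subset[OF compact_Times[OF compact_sing Sq] O2] by metis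
  obtain \<delta> where \<delta>: "\<delta> > 0" "ball x0 \<delta> \<subseteq> U" using U open_contains_ball by blast
  define e where "e = min (r / 2) (\<delta> / (R + 1))"
  have e: "e > 0" "e < r" "e * R < \<delta>"
  proof -
    show "e > 0" "e < r" using r \<delta> R0 by (auto simp: e_def min_less_iff_disj)
    have "e * R \<le> \<delta> / (R + 1) * R" using R0 by (intro mult_right_mono) (auto simp: e_def)
    also have "\<dots> < \<delta>" using \<delta> R0 by (simp add: divide_less_eq)
    finally show "e * R < \<delta>" .
  qed
  have inU: "x0 + e *\<^sub>R \<Phi> s \<in> U" for s
  proof -
    have "norm (e *\<^sub>R \<Phi> s) \<le> e * R" using \<Phi>R[of s] e by simp
    then have "norm (e *\<^sub>R \<Phi> s) < \<delta>" using e(3) by (rule le_less_trans)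
    then have "dist x0 (x0 + e *\<^sub>R \<Phi> s) < \<delta>" by (simp add: dist_norm)
    then show ?thesis using \<delta> by auto
  qed
  have eO1: "(e, s) \<in> O1" for s using inU by (simp add: O1_def \<Psi>_def)
  let ?F = "\<lambda>s. f (x0 + e *\<^sub>R \<Phi> s)"
  have FK: "?F = (\<lambda>s. K (e, s))" by (simp add: K_def \<Psi>_def)
  have smF: "smooth_on UNIV ?F"
    by (rule smooth_compose[OF _ U(1) _ f(1)]) (auto intro!: smooth_add smooth_scaleR smooth_const sm\<Phi> inU)
  have perF: "torus_periodic ?F"
  proof -
    have "\<Phi> (s + (2 * pi) *\<^sub>R axis i 1) = \<Phi> s" for s i
      using exhaust_2[of i] by (auto simp: \<Phi>_def axis_def sawtooth_periodic)
    then show ?thesis by (simp add: torus_periodic_def)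
  qed
  have bd: "norm (damping ?F (plane_pt x y)) \<le> \<eta>" if "x \<in> {-pi..pi}" "y \<in> {-pi..pi}" for x y
  proof -
    have "plane_pt x y \<in> Sq" using that by (auto simp: Sq_def)
    moreover have "dist (0, plane_pt x y) (e, plane_pt x y) < r" using e by (simp add: dist_Pair_Pair)
    ultimately have "(e, plane_pt x y) \<in> O2" using r(2) by (auto simp: subset_iff)
    then show ?thesis unfolding FK slice[of e, OF eO1] by (simp add: O2_def)
  qed
  have "infsum (\<lambda>k. norm (torus_coeff ?F k)) UNIV \<le> \<eta> * C0"
    unfolding C0_def by (rule torus_coeff_abs_sum_bound(2)[OF smF perF bd])
  then have small: "infsum (\<lambda>k. norm (torus_coeff ?F k)) UNIV < 1 / 2" using \<eta>(2) by linarith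
  show ?thesis
    using that[of e] e(1) inU smF perF small unfolding \<Phi>_def periodic_chart_def by blast
qed


section \<open>Metrics on open subsets of Euclidean space\<close>

definition inner_form :: "('a::real_vector \<Rightarrow> 'a \<Rightarrow> real) \<Rightarrow> bool" where
  "inner_form b \<longleftrightarrow> bilinear b \<and> (\<forall>u v. b u v = b v u) \<and> (\<forall>u. u \<noteq> 0 \<longrightarrow> b u u > 0)"

definition metric_on :: "(real^'n) set \<Rightarrow> 'n::finite lmetric \<Rightarrow> bool" where
  "metric_on U g \<longleftrightarrow> open U \<and> (\<forall>u v. smooth_on U (\<lambda>x. g x u v)) \<and> (\<forall>x\<in>U. inner_form (g x))"

definition orthonormal :: "('a \<Rightarrow> 'a \<Rightarrow> real) \<Rightarrow> ('i \<Rightarrow> 'a) \<Rightarrow> bool" where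
  "orthonormal b E \<longleftrightarrow> (\<forall>i j. b (E i) (E j) = (if i = j then 1 else 0))"

lemma bilinear_expand:
  fixes \<beta> :: "real^'m \<Rightarrow> real^'n \<Rightarrow> 'c::real_vector"
  assumes "bilinear \<beta>"
  shows "\<beta> u v = (\<Sum>i\<in>UNIV. \<Sum>j\<in>UNIV. (u $ i * v $ j) *\<^sub>R \<beta> (axis i 1) (axis j 1))"
proof -
  have u: "u = (\<Sum>i\<in>UNIV. u $ i *\<^sub>R axis i 1)" and v: "v = (\<Sum>j\<in>UNIV. v $ j *\<^sub>R axis j 1)"
    using basis_expansion[of u] basis_expansion[of v] by (simp_all add: scalar_mult_eq_scaleR)
  have "\<beta> u v = \<beta> (\<Sum>i\<in>UNIV. u $ i *\<^sub>R axis i 1) (\<Sum>j\<in>UNIV. v $ j *\<^sub>R axis j 1)"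
    using u v by metis
  also have "\<dots> = (\<Sum>i\<in>UNIV. \<Sum>j\<in>UNIV. \<beta> (u $ i *\<^sub>R axis i 1) (v $ j *\<^sub>R axis j 1))"
  proof -
    have 1: "linear (\<lambda>u. \<beta> u y)" and 2: "linear (\<beta> x)" for x y
      using assms by (auto simp: bilinear_def)
    show ?thesis by (subst linear_sum[OF 1], subst linear_sum[OF 2], rule refl)
  qed
  also have "\<dots> = (\<Sum>i\<in>UNIV. \<Sum>j\<in>UNIV. (u $ i * v $ j) *\<^sub>R \<beta> (axis i 1) (axis j 1))"
    by (simp add: bilinear_lmul[OF assms] bilinear_rmul[OF assms] mult.commute)
  finally show ?thesis .
qed

lemma inner_formD:
  assumes "inner_form b"
  shows "bilinear b" "b u v = b v u" "u \<noteq> 0 \<Longrightarrow> b u u > 0" "b u u = 0 \<Longrightarrow> u = 0"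
  using assms unfolding inner_form_def by fastforce+

lemma inner_form_nonneg: "inner_form b \<Longrightarrow> b u u \<ge> 0"
  using inner_formD(3)[of b u] bilinear_lzero[OF inner_formD(1)[of b]]
  by (cases "u = 0") (auto simp: less_imp_le)

lemma inner_form_eqI:
  assumes b: "inner_form b" and "\<And>t. b u t = b v t"
  shows "u = v"
proof -
  have "b (u - v) (u - v) = 0"
    using assms(2) by (simp add: bilinear_lsub[OF inner_formD(1)[OF b]])
  then show ?thesis using inner_formD(4)[OF b] by fastforce
qed

lemma metric_onD:
  assumes "metric_on U g"
  shows "open U" "smooth_on U (\<lambda>x. g x u v)" "x \<in> U \<Longrightarrow> inner_form (g x)" "x \<in> U \<Longrightarrow> bilinear (g x)"
    "x \<in> U \<Longrightarrow> g x u v = g x v u"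
  using assms unfolding metric_on_def inner_form_def by blast+

lemma metric_on_subset: "metric_on U g \<Longrightarrow> open V \<Longrightarrow> V \<subseteq> U \<Longrightarrow> metric_on V g"
  unfolding metric_on_def using smooth_subset by blast

text \<open>Orthonormality gives \<open>c\<^sub>j = b(\<Sum> c\<^sub>i E\<^sub>i, E\<^sub>j)\<close>, so the \<open>E\<^sub>i\<close> are independent, and there are as
  many of them as the dimension.\<close>

lemma orthonormal_expand:
  fixes b :: "real^'n \<Rightarrow> real^'n \<Rightarrow> real" and E :: "'n \<Rightarrow> real^'n"
  assumes b: "inner_form b" and E: "orthonormal b E"
  shows "v = (\<Sum>i\<in>UNIV. b v (E i) *\<^sub>R E i)"
proof -
  define L where "L c = (\<Sum>i\<in>UNIV. c $ i *\<^sub>R E i)" for c :: "real^'n"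
  have lin: "linear L" unfolding L_def[abs_def]
    by (intro linear_compose_sum ballI) (auto intro!: linearI simp: scaleR_add_left)
  have bL: "b (L c) (E j) = c $ j" for c j
  proof -
    have l: "linear (\<lambda>u. b u (E j))" using inner_formD(1)[OF b] by (simp add: bilinear_def)
    have "b (L c) (E j) = (\<Sum>i\<in>UNIV. c $ i * b (E i) (E j))"
      unfolding L_def by (simp add: linear_sum[OF l] linear_cmul[OF l])
    also have "\<dots> = (\<Sum>i\<in>UNIV. if i = j then c $ i else 0)"
      using E by (intro sum.cong) (auto simp: orthonormal_def)
    finally show ?thesis by simp
  qed
  have "inj L" by (rule injI) (metis bL vec_eq_iff)
  then have "surj L" using lin linear_injective_imp_surjective by blast
  then obtain c where c: "v = L c" by blast
  have "b v (E i) = c $ i" for i unfolding c by (rule bL)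
  then show ?thesis using c[unfolded L_def] by (simp only:)
qed

abbreviation gram :: "(real^'n \<Rightarrow> real^'n \<Rightarrow> real) \<Rightarrow> real^'n^'n" where
  "gram b \<equiv> (\<chi> i j. b (axis i 1) (axis j 1))"

lemma gram_mult:
  fixes b :: "real^'n \<Rightarrow> real^'n \<Rightarrow> real"
  assumes "inner_form b"
  shows "b w t = (\<Sum>j\<in>UNIV. t $ j * (gram b *v w) $ j)"
proof -
  have "b w t = b t w" by (rule inner_formD(2)[OF assms])
  also have "\<dots> = (\<Sum>i\<in>UNIV. \<Sum>j\<in>UNIV. (t $ i * w $ j) *\<^sub>R b (axis i 1) (axis j 1))"
    by (rule bilinear_expand[OF inner_formD(1)[OF assms]])
  finally show ?thesis
    by (simp add: matrix_vector_mult_def sum_distrib_left mult_ac)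
qed

lemma gram_invertible:
  fixes b :: "real^'n \<Rightarrow> real^'n \<Rightarrow> real"
  assumes "inner_form b" shows "invertible (gram b)" "det (gram b) \<noteq> 0"
proof -
  have "v = 0" if "gram b *v v = 0" for v
    using gram_mult[OF assms, of v v] that inner_formD(4)[OF assms, of v] by simp
  then have "inj ((*v) (gram b))"
    using linear_injective_0[OF matrix_vector_mul_linear[of "gram b"]] by blast
  then show "invertible (gram b)"
    using matrix_left_invertible_injective invertible_left_inverse by blast
  then show "det (gram b) \<noteq> 0" by (simp add: invertible_det_nz)
qed

lemma sharp_works:
  assumes g: "inner_form (g x)" and \<alpha>: "linear \<alpha>"
  shows "g x (sharp g x \<alpha>) t = \<alpha> t"
proof -
  have "gram (g x) *v sharp g x \<alpha> = (\<chi> l. \<alpha> (axis l 1))"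
    unfolding sharp_def ginv_def
    by (simp add: matrix_vector_mul_assoc matrix_mult_matrix_inv gram_invertible(1)[OF g])
  then have "g x (sharp g x \<alpha>) t = (\<Sum>j\<in>UNIV. t $ j * \<alpha> (axis j 1))"
    using gram_mult[OF g, of "sharp g x \<alpha>" t] by simp
  also have "\<dots> = \<alpha> (\<Sum>j\<in>UNIV. t $ j *\<^sub>R axis j 1)"
    by (simp add: linear_sum[OF \<alpha>] linear_cmul[OF \<alpha>])
  also have "(\<Sum>j\<in>UNIV. t $ j *\<^sub>R axis j 1) = t"
    using basis_expansion[of t] by (simp add: scalar_mult_eq_scaleR)
  finally show ?thesis .
qed

lemma sharp_smooth:
  assumes g: "metric_on U g" and \<alpha>: "\<And>l. smooth_on U (\<lambda>x. \<alpha> x (axis l 1))"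
  shows "smooth_on U (\<lambda>x. sharp g x (\<alpha> x))"
  unfolding sharp_def ginv_def
  by (rule smooth_matrix_inv_mult[OF metric_onD(1)[OF g]])
     (simp_all add: metric_onD(2)[OF g] gram_invertible(2) metric_onD(3)[OF g] \<alpha>)

text \<open>If the columns of \<open>P\<close> form an orthonormal basis, then \<open>P\<^sup>T G P = 1\<close> and so \<open>G\<^sup>-\<^sup>1 = P P\<^sup>T\<close>.\<close>

lemma ginv_trace:
  fixes \<beta> :: "real^'n \<Rightarrow> real^'n \<Rightarrow> 'c::real_vector" and E :: "'n \<Rightarrow> real^'n"
  assumes g: "inner_form (g x)" and E: "orthonormal (g x) E" and \<beta>: "bilinear \<beta>"
  shows "(\<Sum>i\<in>UNIV. \<Sum>j\<in>UNIV. (ginv g x $ i $ j) *\<^sub>R \<beta> (axis i 1) (axis j 1)) = (\<Sum>k\<in>UNIV. \<beta> (E k) (E k))"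
proof -
  let ?G = "gram (g x)"
  define P :: "real^'n^'n" where "P = (\<chi> i j. E j $ i)"
  have "transpose P ** (?G ** P) = mat 1"
  proof -
    have "(transpose P ** (?G ** P)) $ j $ k = g x (E j) (E k)" for j k
      unfolding bilinear_expand[OF inner_formD(1)[OF g], of "E j" "E k"]
      by (simp add: matrix_matrix_mult_def transpose_def P_def sum_distrib_left mult_ac)
    then show ?thesis using E by (simp add: vec_eq_iff mat_def orthonormal_def)
  qed
  then have "(transpose P ** ?G) ** P = mat 1" by (simp add: matrix_mul_assoc)
  then have "P ** (transpose P ** ?G) = mat 1" using matrix_left_right_inverse by blast
  then have inv: "(P ** transpose P) ** ?G = mat 1" by (simp add: matrix_mul_assoc)
  have "ginv g x = P ** transpose P"
  proof -
    have "ginv g x = ((P ** transpose P) ** ?G) ** ginv g x" by (simp add: inv)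
    also have "\<dots> = (P ** transpose P) ** (?G ** ginv g x)" by (simp add: matrix_mul_assoc)
    also have "?G ** ginv g x = mat 1"
      unfolding ginv_def by (rule matrix_mult_matrix_inv[OF gram_invertible(1)[OF g]])
    finally show ?thesis by simp
  qed
  then have gi: "ginv g x $ i $ j = (\<Sum>k\<in>UNIV. E k $ i * E k $ j)" for i j
    by (simp add: matrix_matrix_mult_def transpose_def P_def)
  have "(\<Sum>i\<in>UNIV. \<Sum>j\<in>UNIV. (ginv g x $ i $ j) *\<^sub>R \<beta> (axis i 1) (axis j 1)) =
      (\<Sum>i\<in>UNIV. \<Sum>j\<in>UNIV. \<Sum>k\<in>UNIV. (E k $ i * E k $ j) *\<^sub>R \<beta> (axis i 1) (axis j 1))"
    by (simp add: gi scaleR_sum_left)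
  also have "\<dots> = (\<Sum>i\<in>UNIV. \<Sum>k\<in>UNIV. \<Sum>j\<in>UNIV. (E k $ i * E k $ j) *\<^sub>R \<beta> (axis i 1) (axis j 1))"
    by (rule sum.cong[OF refl sum.swap])
  also have "\<dots> = (\<Sum>k\<in>UNIV. \<Sum>i\<in>UNIV. \<Sum>j\<in>UNIV. (E k $ i * E k $ j) *\<^sub>R \<beta> (axis i 1) (axis j 1))"
    by (rule sum.swap)
  also have "\<dots> = (\<Sum>k\<in>UNIV. \<beta> (E k) (E k))" by (rule sum.cong[OF refl bilinear_expand[OF \<beta>, symmetric]])
  finally show ?thesis .
qed

lemma dd_add:
  "f differentiable (at x) \<Longrightarrow> g differentiable (at x) \<Longrightarrow> dd (\<lambda>y. f y + g y) x v = dd f x v + dd g x v"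
  by (rule dd_eq[OF has_derivative_add[OF dd_has_derivative dd_has_derivative]])

lemma dd_diff:
  "f differentiable (at x) \<Longrightarrow> g differentiable (at x) \<Longrightarrow> dd (\<lambda>y. f y - g y) x v = dd f x v - dd g x v"
  by (rule dd_eq[OF has_derivative_diff[OF dd_has_derivative dd_has_derivative]])

lemma dd_linear_comp:
  "bounded_linear L \<Longrightarrow> f differentiable (at x) \<Longrightarrow> dd (\<lambda>y. L (f y)) x v = L (dd f x v)"
  by (rule dd_eq[OF bounded_linear.has_derivative[OF _ dd_has_derivative]])

lemma dd_compose:
  "f differentiable (at x) \<Longrightarrow> g differentiable (at (f x)) \<Longrightarrow> dd (\<lambda>y. g (f y)) x v = dd g (f x) (dd f x v)"
  by (rule dd_eq[OF has_derivative_compose[OF dd_has_derivative dd_has_derivative]])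

text \<open>Fields of bilinear maps: smoothness and the product rule follow from the components.\<close>

lemma smooth_bilinear_field:
  fixes \<beta> :: "'a::real_normed_vector \<Rightarrow> real^'m \<Rightarrow> real^'n \<Rightarrow> 'c::real_normed_vector"
  assumes U: "open U" and \<beta>: "\<And>x. x \<in> U \<Longrightarrow> bilinear (\<beta> x)" "\<And>u v. smooth_on U (\<lambda>x. \<beta> x u v)"
    and X: "smooth_on U X" and Y: "smooth_on U Y"
  shows "smooth_on U (\<lambda>x. \<beta> x (X x) (Y x))"
proof -
  have "smooth_on U (\<lambda>x. \<Sum>i\<in>UNIV. \<Sum>j\<in>UNIV. (X x $ i * Y x $ j) *\<^sub>R \<beta> x (axis i 1) (axis j 1))"
    by (intro smooth_sum smooth_scaleR smooth_mult smooth_vec_nth U X Y \<beta>(2))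
  then show ?thesis
    by (rule smooth_cong[OF U, THEN iffD2, rotated]) (rule bilinear_expand[OF \<beta>(1)])
qed

lemma has_derivative_bilinear_field:
  fixes \<beta> :: "real^'k \<Rightarrow> real^'m \<Rightarrow> real^'n \<Rightarrow> 'c::real_normed_vector"
  assumes U: "open U" "x \<in> U" and \<beta>: "\<And>x. x \<in> U \<Longrightarrow> bilinear (\<beta> x)"
    "\<And>u v. (\<lambda>x. \<beta> x u v) differentiable (at x)"
    and X: "X differentiable (at x)" and Y: "Y differentiable (at x)"
  shows "((\<lambda>y. \<beta> y (X y) (Y y)) has_derivative
      (\<lambda>w. dd (\<lambda>y. \<beta> y (X x) (Y x)) x w + \<beta> x (dd X x w) (Y x) + \<beta> x (X x) (dd Y x w))) (at x)"
proof -
  let ?b = "\<lambda>y i j. \<beta> y (axis i 1) (axis j 1)"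
  have dX: "((\<lambda>y. X y $ i) has_derivative (\<lambda>w. dd X x w $ i)) (at x)" for i
    by (rule bounded_linear.has_derivative[OF bounded_linear_vec_nth dd_has_derivative[OF X]])
  have dY: "((\<lambda>y. Y y $ i) has_derivative (\<lambda>w. dd Y x w $ i)) (at x)" for i
    by (rule bounded_linear.has_derivative[OF bounded_linear_vec_nth dd_has_derivative[OF Y]])
  have db: "((\<lambda>y. ?b y i j) has_derivative dd (\<lambda>y. ?b y i j) x) (at x)" for i j
    by (rule dd_has_derivative[OF \<beta>(2)])
  have const: "dd (\<lambda>y. \<beta> y u v) x w = (\<Sum>i\<in>UNIV. \<Sum>j\<in>UNIV. (u $ i * v $ j) *\<^sub>R dd (\<lambda>y. ?b y i j) x w)" for u v w
  proof -
    have e: "dd (\<lambda>y. \<beta> y u v) x = dd (\<lambda>y. \<Sum>i\<in>UNIV. \<Sum>j\<in>UNIV. (u $ i * v $ j) *\<^sub>R ?b y i j) x"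
      by (rule dd_cong_open(1)[OF U]) (rule bilinear_expand[OF \<beta>(1)])
    have D: "((\<lambda>y. \<Sum>i\<in>UNIV. \<Sum>j\<in>UNIV. (u $ i * v $ j) *\<^sub>R ?b y i j) has_derivative
        (\<lambda>w. \<Sum>i\<in>UNIV. \<Sum>j\<in>UNIV. (u $ i * v $ j) *\<^sub>R dd (\<lambda>y. ?b y i j) x w)) (at x)"
      by (intro has_derivative_sum has_derivative_scaleR_right db)
    show ?thesis unfolding e by (rule dd_eq[OF D])
  qed
  have "((\<lambda>y. \<Sum>i\<in>UNIV. \<Sum>j\<in>UNIV. (X y $ i * Y y $ j) *\<^sub>R ?b y i j) has_derivative
      (\<lambda>w. \<Sum>i\<in>UNIV. \<Sum>j\<in>UNIV. (X x $ i * Y x $ j) *\<^sub>R dd (\<lambda>y. ?b y i j) x w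
        + (X x $ i * dd Y x w $ j + dd X x w $ i * Y x $ j) *\<^sub>R ?b x i j)) (at x)"
    by (intro has_derivative_sum has_derivative_scaleR has_derivative_mult dX dY db)
  also have "(\<lambda>w. \<Sum>i\<in>UNIV. \<Sum>j\<in>UNIV. (X x $ i * Y x $ j) *\<^sub>R dd (\<lambda>y. ?b y i j) x w
        + (X x $ i * dd Y x w $ j + dd X x w $ i * Y x $ j) *\<^sub>R ?b x i j) =
      (\<lambda>w. dd (\<lambda>y. \<beta> y (X x) (Y x)) x w + \<beta> x (dd X x w) (Y x) + \<beta> x (X x) (dd Y x w))"
    unfolding const[of "X x" "Y x"] bilinear_expand[OF \<beta>(1)[OF U(2)], of "dd X x _" "Y x"]
      bilinear_expand[OF \<beta>(1)[OF U(2)], of "X x" "dd Y x _"]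
    by (simp add: scaleR_add_left sum.distrib add_ac)
  finally show ?thesis
    by (rule has_derivative_transform_within_open[OF _ U]) (rule bilinear_expand[OF \<beta>(1), symmetric])
qed

text \<open>Gram-Schmidt applied to the coordinate frame.\<close>

lemma exists_orthonormal_frame:
  fixes g :: "2 lmetric"
  assumes g: "metric_on U g"
  obtains E where "orthonormal_frame_on g U E"
proof -
  note gD = metric_onD[OF g]
  note U = gD(1)
  let ?e1 = "axis 1 (1::real) :: real^2" and ?e2 = "axis 2 (1::real) :: real^2"
  have ne: "?e1 \<noteq> 0" by (simp add: axis_eq_0_iff)
  define c where "c x = g x ?e2 ?e1 / g x ?e1 ?e1" for x
  define w where "w x = ?e2 - c x *\<^sub>R ?e1" for x
  have wne: "w x \<noteq> 0" for x
  proof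
    assume "w x = 0"
    then have "w x $ 2 = 0" by simp
    then show False by (simp add: w_def axis_def)
  qed
  have p1: "g x ?e1 ?e1 > 0" and pw: "g x (w x) (w x) > 0" if "x \<in> U" for x
    using inner_formD(3)[OF gD(3)[OF that]] ne wne by auto
  have smc: "smooth_on U c" unfolding c_def[abs_def]
    by (intro smooth_divide U gD(2)) (use p1 in fastforce)
  have smw: "smooth_on U w" unfolding w_def[abs_def]
    by (intro smooth_diff smooth_scaleR smooth_const smc U)
  define E where "E i x = (if i = 1 then (1 / sqrt (g x ?e1 ?e1)) *\<^sub>R ?e1 else (1 / sqrt (g x (w x) (w x))) *\<^sub>R w x)"
    for i :: 2 and x
  have smE1: "smooth_on U (\<lambda>x. (1 / sqrt (g x ?e1 ?e1)) *\<^sub>R ?e1)"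
    by (intro smooth_scaleR smooth_divide smooth_const smooth_sqrt U gD(2)) (use p1 in fastforce)+
  have smgw: "smooth_on U (\<lambda>x. g x (w x) (w x))"
    by (rule smooth_bilinear_field[where \<beta>=g, OF U gD(4) gD(2) smw smw])
  have smE2: "smooth_on U (\<lambda>x. (1 / sqrt (g x (w x) (w x))) *\<^sub>R w x)"
    by (intro smooth_scaleR smooth_divide smooth_const smooth_sqrt U smw smgw) (use pw in fastforce)+
  have "smooth_on U (E i)" for i
    unfolding E_def[abs_def] using smE1 smE2 by (cases "i = 1") auto
  moreover have "g x (E i x) (E j x) = (if i = j then 1 else 0)" if x: "x \<in> U" for x i j
  proof -
    note b = gD(4)[OF x]
    have orth: "g x (w x) ?e1 = 0"
      using p1[OF x] by (simp add: w_def c_def bilinear_lsub[OF b] bilinear_lmul[OF b])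
    then have orth': "g x ?e1 (w x) = 0" using gD(5)[OF x] by simp
    have i2: "k = 2" if "k \<noteq> 1" for k :: 2 using exhaust_2[of k] that by auto
    show ?thesis using p1[OF x] pw[OF x] i2[of i] i2[of j]
      by (auto simp: E_def bilinear_lmul[OF b] bilinear_rmul[OF b] orth orth')
  qed
  ultimately have "orthonormal_frame_on g U E" by (auto simp: orthonormal_frame_on_def)
  then show ?thesis by (rule that)
qed


section \<open>Existence of isothermal coordinates\<close>

lemma locally_injective_smooth:
  fixes f :: "real^'n \<Rightarrow> real^'n"
  assumes U: "open U" "a \<in> U" and f: "smooth_on U f" and inj: "inj (dd f a)"
  obtains r where "r > 0" "ball a r \<subseteq> U" "inj_on f (ball a r)"
proof -
  have l: "linear (dd f x)" if "x \<in> U" for x by (rule smooth_linear_dd[OF f that])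
  obtain g' where g': "linear g'" "g' \<circ> dd f a = id"
    using linear_injective_left_inverse[OF l[OF U(2)] inj] by blast
  have close: "\<exists>d>0. \<forall>x. dist a x < d \<longrightarrow> onorm (\<lambda>v. dd f x v - dd f a v) < e" if e: "e > 0" for e :: real
  proof -
    define c where "c x = (\<Sum>b\<in>Basis. norm (dd f x b - dd f a b))" for x
    have "continuous_on U c" unfolding c_def[abs_def]
      by (intro continuous_on_sum continuous_on_norm continuous_on_diff continuous_on_const
          smooth_continuous[OF smooth_dd[OF f]])
    then have "isCont c a" using U by (simp add: continuous_on_eq_continuous_at)
    moreover have "c a = 0" by (simp add: c_def)
    ultimately obtain d0 where d0: "d0 > 0" "\<And>x. dist x a < d0 \<Longrightarrow> \<bar>c x\<bar> < e / 2"
      using half_gt_zero[OF e] unfolding continuous_at_eps_delta dist_real_def by fastforce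
    obtain d1 where d1: "d1 > 0" "ball a d1 \<subseteq> U" using U open_contains_ball by blast
    show ?thesis
    proof (intro exI[of _ "min d0 d1"] conjI allI impI)
      show "min d0 d1 > 0" using d0 d1 by simp
      fix x assume x: "dist a x < min d0 d1"
      then have xU: "x \<in> U" using d1 by auto
      have dlin: "linear (\<lambda>v. dd f x v - dd f a v)"
        by (intro linear_compose_sub l xU U(2))
      have "onorm (\<lambda>v. dd f x v - dd f a v) \<le> c x"
      proof (rule onorm_le)
        fix v
        have "dd f x v - dd f a v = (\<Sum>b\<in>Basis. (v \<bullet> b) *\<^sub>R (dd f x b - dd f a b))"
          using linear_sum[OF dlin, of "\<lambda>b. (v \<bullet> b) *\<^sub>R b" Basis] linear_cmul[OF dlin]
          by (simp add: euclidean_representation)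
        then have "norm (dd f x v - dd f a v) \<le> (\<Sum>b\<in>Basis. \<bar>v \<bullet> b\<bar> * norm (dd f x b - dd f a b))"
          using norm_sum[of "\<lambda>b. (v \<bullet> b) *\<^sub>R (dd f x b - dd f a b)" Basis] by simp
        also have "\<dots> \<le> (\<Sum>b\<in>Basis. norm v * norm (dd f x b - dd f a b))"
          by (intro sum_mono mult_right_mono Basis_le_norm) auto
        finally show "norm (dd f x v - dd f a v) \<le> c x * norm v"
          by (simp add: c_def sum_distrib_left mult.commute)
      qed
      also have "c x < e" using d0(2)[of x] x e by (simp add: dist_commute)
      finally show "onorm (\<lambda>v. dd f x v - dd f a v) < e" .
    qed
  qed
  have bl: "bounded_linear g'" using g'(1) linear_conv_bounded_linear by blast
  obtain r where "r > 0" "ball a r \<subseteq> U" "inj_on f (ball a r)"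
    by (rule has_derivative_locally_injective[OF U(2) U(1) bl g'(2) smooth_derivative[OF f] close]) blast
  then show ?thesis by (rule that)
qed

definition plane_of :: "complex \<Rightarrow> real^2" where
  "plane_of z = plane_pt (Re z) (Im z)"

lemma plane_of_bounded_linear: "bounded_linear plane_of"
  unfolding plane_of_def[abs_def]
  by (intro bounded_linear_add bounded_linear_scaleR_const bounded_linear_Re bounded_linear_Im)

lemma plane_of_inner: "plane_of z \<bullet> plane_of w = Re z * Re w + Im z * Im w"
  by (simp add: plane_of_def inner_vec_def UNIV_2 axis_def)

text \<open>With \<open>\<mu> = (E - G + 2iF) / N\<close> and \<open>N = E + G + 2 sqrt (EG - F\<^sup>2)\<close> the quadratic form
  \<open>E a\<^sup>2 + 2 F a b + G b\<^sup>2\<close> equals \<open>(N/4) |\<zeta> + \<mu> \<zeta>\<^sup>*|\<^sup>2\<close>, where \<open>\<zeta> = a + ib\<close>. Here it is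
  polarized.\<close>

lemma beltrami_form:
  fixes E F G D N a b a' b' :: real
  assumes D: "D\<^sup>2 = E * G - F\<^sup>2" and N: "N = E + G + 2 * D" "N > 0"
  shows "a * a' * E + (a * b' + a' * b) * F + b * b' * G =
    N / 4 * (((1 + (E - G) / N) * a + 2 * F / N * b) * ((1 + (E - G) / N) * a' + 2 * F / N * b')
      + (2 * F / N * a + (1 - (E - G) / N) * b) * (2 * F / N * a' + (1 - (E - G) / N) * b'))"
proof -
  have p: "1 + (E - G) / N = (2 * E + 2 * D) / N" and m: "1 - (E - G) / N = (2 * G + 2 * D) / N"
    using N by (auto simp: field_simps)
  have "N / 4 * (((1 + (E - G) / N) * a + 2 * F / N * b) * ((1 + (E - G) / N) * a' + 2 * F / N * b')
      + (2 * F / N * a + (1 - (E - G) / N) * b) * (2 * F / N * a' + (1 - (E - G) / N) * b')) =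
      (((E + D) * a + F * b) * ((E + D) * a' + F * b') + (F * a + (G + D) * b) * (F * a' + (G + D) * b')) / N"
    unfolding p m using N(2) by (simp add: field_simps)
  also have "((E + D) * a + F * b) * ((E + D) * a' + F * b') + (F * a + (G + D) * b) * (F * a' + (G + D) * b') =
      N * (a * a' * E + (a * b' + a' * b) * F + b * b' * G)"
    unfolding N(1) using D by algebra
  finally show ?thesis using N(2) by simp
qed

text \<open>Let \<open>P\<^sub>1, P\<^sub>2\<close> be orthonormal at \<open>x\<^sub>0\<close>. Then \<open>\<mu>\<close> vanishes at \<open>x\<^sub>0\<close>, and at a small scale it becomes
  the coefficient of a solvable Beltrami equation on the torus. Its solution \<open>W\<close> satisfies
  \<open>dW(u) = W\<^sub>z (\<zeta> + \<mu> \<zeta>\<^sup>*)\<close>, so \<open>|dW|\<^sup>2\<close> is a multiple of \<open>g\<close> where the periodization is undone by an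
  affine map. Conformality makes \<open>dW\<close> injective, and \<open>W\<close> is then locally a coordinate map.\<close>

theorem isothermal_coordinates:
  fixes g :: "2 lmetric"
  assumes g: "metric_on U g" and x0: "x0 \<in> U"
  obtains V and G :: "real^2 \<Rightarrow> real^2" and \<rho> where "open V" "x0 \<in> V" "V \<subseteq> U" "smooth_on V G" "inj_on G V"
    "\<And>x. x \<in> V \<Longrightarrow> inj (dd G x)" "\<And>x. x \<in> V \<Longrightarrow> \<rho> x > 0"
    "\<And>x u v. x \<in> V \<Longrightarrow> g x u v = \<rho> x * (dd G x u \<bullet> dd G x v)"
proof -
  note gD = metric_onD[OF g]
  note U = gD(1)
  note b0 = gD(4)[OF x0]
  obtain Fr where Fr: "orthonormal_frame_on g U Fr" using exists_orthonormal_frame[OF g] by blast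
  define P1 P2 where "P1 = Fr 1 x0" and "P2 = Fr 2 x0"
  have on: "g x0 P1 P1 = 1" "g x0 P2 P2 = 1" "g x0 P1 P2 = 0" "g x0 P2 P1 = 0"
    using Fr x0 by (auto simp: orthonormal_frame_on_def P1_def P2_def)
  have exp2: "v = g x0 v P1 *\<^sub>R P1 + g x0 v P2 *\<^sub>R P2" for v
  proof -
    have "orthonormal (g x0) (\<lambda>i. Fr i x0)"
      using Fr x0 by (simp add: orthonormal_def orthonormal_frame_on_def)
    from orthonormal_expand[OF gD(3)[OF x0] this, of v]
    show ?thesis by (simp only: P1_def P2_def sum_2)
  qed
  define E F G where "E x = g x P1 P1" and "F x = g x P1 P2" and "G x = g x P2 P2" for x
  define D where "D x = sqrt (E x * G x - F x * F x)" for x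
  define N where "N x = E x + G x + 2 * D x" for x
  have P: "P1 \<noteq> 0" "P2 \<noteq> 0" using on b0 by (auto simp: bilinear_lzero)
  have EG: "E x > 0" "G x > 0" if "x \<in> U" for x
    using inner_formD(3)[OF gD(3)[OF that]] P by (auto simp: E_def G_def)
  have disc: "E x * G x - F x * F x > 0" if x: "x \<in> U" for x
  proof -
    note b = gD(4)[OF x]
    let ?w = "F x *\<^sub>R P1 - E x *\<^sub>R P2"
    have "?w \<noteq> 0"
    proof
      assume "?w = 0"
      then have "g x0 ?w P2 = 0" using b0 by (simp add: bilinear_lzero)
      then have "E x = 0" by (simp add: bilinear_lsub[OF b0] bilinear_lmul[OF b0] on)
      then show False using EG(1)[OF x] by simp
    qed
    then have "g x ?w ?w > 0" using inner_formD(3)[OF gD(3)[OF x]] by blast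
    moreover have "g x ?w ?w = E x * (E x * G x - F x * F x)"
      using gD(5)[OF x, of P2 P1]
      by (simp add: bilinear_lsub[OF b] bilinear_lmul[OF b] bilinear_rsub[OF b] bilinear_rmul[OF b]
          E_def F_def G_def algebra_simps)
    ultimately show ?thesis using EG(1)[OF x] by (simp add: zero_less_mult_iff)
  qed
  have smE: "smooth_on U E" "smooth_on U F" "smooth_on U G"
    unfolding E_def[abs_def] F_def[abs_def] G_def[abs_def] by (rule gD(2))+
  have smD: "smooth_on U D" unfolding D_def[abs_def]
    by (intro smooth_sqrt smooth_diff smooth_mult smE U disc)
  have smN: "smooth_on U N" unfolding N_def[abs_def]
    by (intro smooth_add smooth_mult smooth_const smE smD U)
  have D0: "D x > 0" if "x \<in> U" for x using disc[OF that] by (simp add: D_def)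
  have N0: "N x > 0" if "x \<in> U" for x using EG[OF that] D0[OF that] by (simp add: N_def)
  have N0': "N x \<noteq> 0" if "x \<in> U" for x using N0[OF that] by simp
  define \<mu> where "\<mu> x = complex_of_real ((E x - G x) / N x) + \<i> * complex_of_real (2 * F x / N x)" for x
  have sm\<mu>: "smooth_on U \<mu>" unfolding \<mu>_def[abs_def]
    by (intro smooth_add smooth_mult[OF U smooth_const] smooth_linear_comp[OF bounded_linear_of_real]
         smooth_divide smooth_diff smooth_mult[of U "\<lambda>_. 2"] smooth_const smE smN U N0')
  have \<mu>0: "\<mu> x0 = 0" by (simp add: \<mu>_def E_def F_def G_def on)
  obtain e where e: "e > 0" "\<And>s. periodic_chart x0 P1 P2 e s \<in> U"
    "smooth_on UNIV (\<lambda>s. \<mu> (periodic_chart x0 P1 P2 e s))"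
    "torus_periodic (\<lambda>s. \<mu> (periodic_chart x0 P1 P2 e s))"
    "infsum (\<lambda>k. norm (torus_coeff (\<lambda>s. \<mu> (periodic_chart x0 P1 P2 e s)) k)) UNIV < 1 / 2"
    by (rule small_torus_coeff[OF U x0 sm\<mu> \<mu>0, of P1 P2]) blast
  define m where "m = torus_coeff (\<lambda>s. \<mu> (periodic_chart x0 P1 P2 e s))"
  have mser: "torus_series m s = \<mu> (periodic_chart x0 P1 P2 e s)" for s
    unfolding torus_series_def m_def by (rule torus_inversion[OF e(3,4)])
  obtain W :: "real^2 \<Rightarrow> complex" where W: "smooth_on UNIV W"
    "\<And>x. dd W x (axis 1 1) + \<i> * dd W x (axis 2 1) = torus_series m x * (dd W x (axis 1 1) - \<i> * dd W x (axis 2 1))"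
    "\<And>x. dd W x (axis 1 1) - \<i> * dd W x (axis 2 1) \<noteq> 0"
    by (rule torus_beltrami[OF torus_coeff_rapid[OF e(3,4)] e(5)]) (use m_def in blast)
  \<comment> \<open>\<open>A\<close> inverts the periodized chart near the origin and \<open>lin\<close> is its linear part.\<close>
  define lin where "lin v = plane_pt (g x0 v P1 / e) (g x0 v P2 / e)" for v
  have bllin: "bounded_linear lin"
  proof -
    have "linear (\<lambda>v. g x0 v Q)" for Q using b0 by (simp add: bilinear_def)
    then have "bounded_linear (\<lambda>v. g x0 v Q)" for Q using linear_conv_bounded_linear by blast
    then show ?thesis unfolding lin_def[abs_def] divide_inverse
      by (intro bounded_linear_add bounded_linear_scaleR_const bounded_linear_mult_const)
  qed
  define A where "A x = lin (x - x0)" for x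
  have smA: "smooth_on UNIV A" unfolding A_def[abs_def]
    by (intro smooth_linear_comp[OF bllin] smooth_diff smooth_id smooth_const) auto
  have dA: "(A has_derivative lin) (at x)" for x
    unfolding A_def[abs_def]
  proof (rule bounded_linear.has_derivative[OF bllin])
    show "((\<lambda>x. x - x0) has_derivative (\<lambda>v. v)) (at x)"
      by (auto intro!: derivative_eq_intros)
  qed
  define V0 where "V0 = U \<inter> A -` {s. \<bar>s $ 1\<bar> < 1 \<and> \<bar>s $ 2\<bar> < 1}"
  have V0: "open V0" "V0 \<subseteq> U" "x0 \<in> V0"
  proof -
    have "open {s::real^2. \<bar>s $ 1\<bar> < 1 \<and> \<bar>s $ 2\<bar> < 1}"
      by (intro open_Collect_conj open_Collect_less continuous_intros)
    then have "open (A -` {s. \<bar>s $ 1\<bar> < 1 \<and> \<bar>s $ 2\<bar> < 1})"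
      using smooth_continuous[OF smA] by (rule open_vimage)
    then show "open V0" unfolding V0_def using U by (rule open_Int[rotated])
    show "V0 \<subseteq> U" by (simp add: V0_def)
    have "A x0 = 0" using linear_0[OF bounded_linear.linear[OF bllin]] by (simp add: A_def)
    then show "x0 \<in> V0" using x0 by (simp add: V0_def)
  qed
  have \<mu>A: "torus_series m (A x) = \<mu> x" if x: "x \<in> V0" for x
  proof -
    have "sawtooth (A x $ 1) = A x $ 1" "sawtooth (A x $ 2) = A x $ 2"
      using x by (auto simp: V0_def intro!: sawtooth_near_0)
    then have "periodic_chart x0 P1 P2 e (A x) = x0 + e *\<^sub>R (A x $ 1 *\<^sub>R P1 + A x $ 2 *\<^sub>R P2)"
      by (simp only: periodic_chart_def)
    also have "\<dots> = x0 + (g x0 (x - x0) P1 *\<^sub>R P1 + g x0 (x - x0) P2 *\<^sub>R P2)"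
      using e(1) by (simp add: A_def lin_def axis_def scaleR_add_right)
    also have "\<dots> = x" using exp2[of "x - x0"] by simp
    finally show ?thesis by (simp add: mser)
  qed
  define H where "H x = plane_of (W (A x))" for x
  have smWA: "smooth_on UNIV (\<lambda>x. W (A x))"
    by (rule smooth_compose[OF _ _ smA W(1)]) auto
  have smH: "smooth_on V0 H" unfolding H_def[abs_def]
    by (rule smooth_linear_comp[OF plane_of_bounded_linear V0(1) smooth_subset[OF smWA]]) simp
  have dH: "dd H x u = plane_of (dd W (A x) (lin u))" for x u
  proof -
    have "((\<lambda>x. W (A x)) has_derivative (\<lambda>u. dd W (A x) (lin u))) (at x)"
      by (rule has_derivative_compose[OF dA smooth_derivative[OF W(1)]]) simp
    from bounded_linear.has_derivative[OF plane_of_bounded_linear this]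
    show ?thesis unfolding H_def[abs_def] by (rule dd_eq)
  qed
  \<comment> \<open>twice the value of \<open>W\<^sub>z\<close>\<close>
  define R where "R x = dd W (A x) (axis 1 1) - \<i> * dd W (A x) (axis 2 1)" for x
  have R0: "R x \<noteq> 0" for x using W(3) by (simp add: R_def)
  define \<rho> where "\<rho> x = e\<^sup>2 * N x / (norm (R x))\<^sup>2" for x
  have \<rho>0: "\<rho> x > 0" if "x \<in> V0" for x
    using N0[of x] that V0(2) e(1) R0[of x] by (auto simp: \<rho>_def)
  have conf: "g x u v = \<rho> x * (dd H x u \<bullet> dd H x v)" if x: "x \<in> V0" for x u v
  proof -
    have xU: "x \<in> U" using x V0 by auto
    note b = gD(4)[OF xU]
    define p r where "p = (E x - G x) / N x" and "r = 2 * F x / N x"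
    define \<alpha> \<beta> where "\<alpha> u = g x0 u P1 / e" and "\<beta> u = g x0 u P2 / e" for u
    define X Y where "X u = (1 + p) * \<alpha> u + r * \<beta> u" and "Y u = r * \<alpha> u + (1 - p) * \<beta> u" for u
    have dW: "dd W (A x) (lin u) = R x / 2 * Complex (X u) (Y u)" for u
    proof -
      have W0: "dd W (A x) (lin u) = of_real (\<alpha> u) * dd W (A x) (axis 1 1) + of_real (\<beta> u) * dd W (A x) (axis 2 1)"
      proof -
        have l: "linear (dd W (A x))" using smooth_linear_dd[OF W(1)] by simp
        show ?thesis
          by (simp only: lin_def linear_add[OF l] linear_cmul[OF l]) (simp add: \<alpha>_def \<beta>_def scaleR_conv_of_real)
      qed
      have W12: "dd W (A x) (axis 1 1) = (1 + \<mu> x) * R x / 2" "dd W (A x) (axis 2 1) = \<i> * (1 - \<mu> x) * R x / 2"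
      proof -
        let ?S = "dd W (A x) (axis 1 1) + \<i> * dd W (A x) (axis 2 1)"
        have S: "?S = \<mu> x * R x" using W(2)[of "A x"] unfolding \<mu>A[OF x] R_def[symmetric] .
        have "dd W (A x) (axis 1 1) = (?S + R x) / 2" "dd W (A x) (axis 2 1) = \<i> * (R x - ?S) / 2"
          by (simp_all add: R_def right_diff_distrib distrib_left)
        then show "dd W (A x) (axis 1 1) = (1 + \<mu> x) * R x / 2" "dd W (A x) (axis 2 1) = \<i> * (1 - \<mu> x) * R x / 2"
          unfolding S by (simp_all add: algebra_simps)
      qed
      have "dd W (A x) (lin u) = R x / 2 * (of_real (\<alpha> u) * (1 + \<mu> x) + of_real (\<beta> u) * (\<i> * (1 - \<mu> x)))"
        unfolding W0 W12 by (simp add: algebra_simps add_divide_distrib diff_divide_distrib)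
      also have "of_real (\<alpha> u) * (1 + \<mu> x) + of_real (\<beta> u) * (\<i> * (1 - \<mu> x)) = Complex (X u) (Y u)"
      proof -
        have "\<mu> x = of_real p + \<i> * of_real r" by (simp add: \<mu>_def p_def r_def)
        then show ?thesis by (simp add: complex_eq_iff X_def Y_def algebra_simps)
      qed
      finally show ?thesis .
    qed
    have dd2: "dd H x u \<bullet> dd H x v = (norm (R x))\<^sup>2 / 4 * (X u * X v + Y u * Y v)"
    proof -
      have n: "Re (c * z) * Re (c * w) + Im (c * z) * Im (c * w) = (norm c)\<^sup>2 * (Re z * Re w + Im z * Im w)" for c z w :: complex
        unfolding cmod_power2 by (simp add: algebra_simps power2_eq_square)
      show ?thesis unfolding dH plane_of_inner dW n by (simp add: norm_divide power_divide)
    qed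
    have "\<rho> x * (dd H x u \<bullet> dd H x v) = e\<^sup>2 * (N x / 4 * (X u * X v + Y u * Y v))"
      unfolding dd2 using R0[of x] by (simp add: \<rho>_def)
    also have "N x / 4 * (X u * X v + Y u * Y v) =
        \<alpha> u * \<alpha> v * E x + (\<alpha> u * \<beta> v + \<alpha> v * \<beta> u) * F x + \<beta> u * \<beta> v * G x"
      unfolding X_def Y_def p_def r_def
      by (rule beltrami_form[symmetric, OF _ N_def N0[OF xU]])
         (use disc[OF xU] in \<open>simp add: D_def power2_eq_square\<close>)
    also have "e\<^sup>2 * \<dots> = g x u v"
    proof -
      have "g x u v = g x (g x0 u P1 *\<^sub>R P1 + g x0 u P2 *\<^sub>R P2) (g x0 v P1 *\<^sub>R P1 + g x0 v P2 *\<^sub>R P2)"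
        using exp2 by metis
      also have "\<dots> = g x0 u P1 * g x0 v P1 * E x + (g x0 u P1 * g x0 v P2 + g x0 v P1 * g x0 u P2) * F x
          + g x0 u P2 * g x0 v P2 * G x"
        using gD(5)[OF xU, of P2 P1]
        by (simp add: bilinear_ladd[OF b] bilinear_lmul[OF b] bilinear_radd[OF b] bilinear_rmul[OF b]
          E_def F_def G_def algebra_simps)
      also have "\<dots> = e\<^sup>2 * (\<alpha> u * \<alpha> v * E x + (\<alpha> u * \<beta> v + \<alpha> v * \<beta> u) * F x + \<beta> u * \<beta> v * G x)"
        using e(1) by (simp add: \<alpha>_def \<beta>_def field_simps power2_eq_square)
      finally show ?thesis by simp
    qed
    finally show ?thesis by simp
  qed
  have injH: "inj (dd H x)" if x: "x \<in> V0" for x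
  proof -
    have l: "linear (dd H x)" by (rule smooth_linear_dd[OF smH x])
    have "u = 0" if "dd H x u = 0" for u
      using conf[OF x, of u u] that inner_formD(4)[OF gD(3)] x V0(2) by auto
    then show ?thesis using linear_injective_0[OF l] by blast
  qed
  obtain r where r: "r > 0" "ball x0 r \<subseteq> V0" "inj_on H (ball x0 r)"
    by (rule locally_injective_smooth[OF V0(1,3) smH injH[OF V0(3)]]) blast
  show ?thesis
  proof (rule that[of "ball x0 r" H \<rho>])
    show "smooth_on (ball x0 r) H" using smH r(2) by (rule smooth_subset)
  qed (use r V0(2) injH \<rho>0 conf in auto)
qed


section \<open>The Levi-Civita connection and the second fundamental form\<close>

lemma bilinear_dd:
  fixes \<beta> :: "'a::real_normed_vector \<Rightarrow> 'b::real_vector \<Rightarrow> 'd::real_vector \<Rightarrow> 'c::real_normed_vector"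
  assumes U: "open U" "x \<in> U" and b: "\<And>y. y \<in> U \<Longrightarrow> bilinear (\<beta> y)"
    and d: "\<And>u v. (\<lambda>y. \<beta> y u v) differentiable (at x)"
  shows "bilinear (\<lambda>u v. dd (\<lambda>y. \<beta> y u v) x w)"
proof -
  have add: "dd (\<lambda>y. \<beta> y (u + u') v) x w = dd (\<lambda>y. \<beta> y u v) x w + dd (\<lambda>y. \<beta> y u' v) x w"
    "dd (\<lambda>y. \<beta> y p (q + q')) x w = dd (\<lambda>y. \<beta> y p q) x w + dd (\<lambda>y. \<beta> y p q') x w" for u u' v p q q'
    using dd_cong_open(1)[OF U, of "\<lambda>y. \<beta> y (u + u') v" "\<lambda>y. \<beta> y u v + \<beta> y u' v"]
      dd_cong_open(1)[OF U, of "\<lambda>y. \<beta> y p (q + q')" "\<lambda>y. \<beta> y p q + \<beta> y p q'"] b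
    by (simp_all add: bilinear_ladd bilinear_radd dd_add d)
  have mul: "dd (\<lambda>y. \<beta> y (c *\<^sub>R u) v) x w = c *\<^sub>R dd (\<lambda>y. \<beta> y u v) x w"
    "dd (\<lambda>y. \<beta> y u (c *\<^sub>R v)) x w = c *\<^sub>R dd (\<lambda>y. \<beta> y u v) x w" for c u v
    using dd_cong_open(1)[OF U, of "\<lambda>y. \<beta> y (c *\<^sub>R u) v" "\<lambda>y. c *\<^sub>R \<beta> y u v"]
      dd_cong_open(1)[OF U, of "\<lambda>y. \<beta> y u (c *\<^sub>R v)" "\<lambda>y. c *\<^sub>R \<beta> y u v"] b
    by (simp_all add: bilinear_lmul bilinear_rmul dd_linear_comp[OF bounded_linear_scaleR_right d])
  show ?thesis unfolding bilinear_def by (auto intro!: linearI simp: add mul)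
qed

context
  fixes U :: "(real^'n) set" and g :: "'n::finite lmetric"
  assumes g: "metric_on U g"
begin

lemma metric_dd_bilinear: "x \<in> U \<Longrightarrow> bilinear (\<lambda>u v. dd (\<lambda>y. g y u v) x w)"
  by (rule bilinear_dd[OF metric_onD(1)[OF g]])
     (use metric_onD(4)[OF g] smooth_diff_at[OF metric_onD(2)[OF g]] in auto)

lemma metric_dd_sym: "x \<in> U \<Longrightarrow> dd (\<lambda>y. g y u v) x w = dd (\<lambda>y. g y v u) x w"
  using dd_cong_open(1)[OF metric_onD(1)[OF g], of x "\<lambda>y. g y u v" "\<lambda>y. g y v u"] metric_onD(5)[OF g] by simp

lemma metric_dd_linear: "x \<in> U \<Longrightarrow> linear (dd (\<lambda>y. g y u v) x)"
  by (rule smooth_linear_dd[OF metric_onD(2)[OF g]])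

lemma koszul:
  assumes x: "x \<in> U"
  shows "g x (christoffel g x u v) t =
    (dd (\<lambda>y. g y v t) x u + dd (\<lambda>y. g y u t) x v - dd (\<lambda>y. g y u v) x t) / 2"
  unfolding christoffel_def
proof (rule sharp_works[where x=x and g=g])
  show "inner_form (g x)" by (rule metric_onD(3)[OF g x])
  show "linear (\<lambda>t. (dd (\<lambda>y. g y v t) x u + dd (\<lambda>y. g y u t) x v - dd (\<lambda>y. g y u v) x t) / 2)"
  proof (rule linearI)
    fix s t and c :: real
    show "(dd (\<lambda>y. g y v (s + t)) x u + dd (\<lambda>y. g y u (s + t)) x v - dd (\<lambda>y. g y u v) x (s + t)) / 2 =
      (dd (\<lambda>y. g y v s) x u + dd (\<lambda>y. g y u s) x v - dd (\<lambda>y. g y u v) x s) / 2 +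
      (dd (\<lambda>y. g y v t) x u + dd (\<lambda>y. g y u t) x v - dd (\<lambda>y. g y u v) x t) / 2"
      by (simp add: bilinear_radd[OF metric_dd_bilinear[OF x]] linear_add[OF metric_dd_linear[OF x]] field_simps)
    show "(dd (\<lambda>y. g y v (c *\<^sub>R t)) x u + dd (\<lambda>y. g y u (c *\<^sub>R t)) x v - dd (\<lambda>y. g y u v) x (c *\<^sub>R t)) / 2 =
      c *\<^sub>R ((dd (\<lambda>y. g y v t) x u + dd (\<lambda>y. g y u t) x v - dd (\<lambda>y. g y u v) x t) / 2)"
      by (simp add: bilinear_rmul[OF metric_dd_bilinear[OF x]] linear_cmul[OF metric_dd_linear[OF x]] field_simps)
  qed
qed

lemma christoffel_bilinear:
  assumes x: "x \<in> U" shows "bilinear (christoffel g x)"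
proof -
  note I = inner_form_eqI[OF metric_onD(3)[OF g x]] and b = metric_onD(4)[OF g x]
  note B = metric_dd_bilinear[OF x] and L = metric_dd_linear[OF x]
  have "christoffel g x (u + u') v = christoffel g x u v + christoffel g x u' v"
    "christoffel g x v (u + u') = christoffel g x v u + christoffel g x v u'" for u u' v
    by (rule I, simp add: bilinear_ladd[OF b] koszul[OF x] bilinear_ladd[OF B] bilinear_radd[OF B] linear_add[OF L] field_simps)+
  moreover have "christoffel g x (c *\<^sub>R u) v = c *\<^sub>R christoffel g x u v"
    "christoffel g x v (c *\<^sub>R u) = c *\<^sub>R christoffel g x v u" for c u v
    by (rule I, simp add: bilinear_lmul[OF b] koszul[OF x] bilinear_lmul[OF B] bilinear_rmul[OF B] linear_cmul[OF L] field_simps)+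
  ultimately show ?thesis unfolding bilinear_def by (auto intro!: linearI)
qed

lemma christoffel_sym:
  assumes x: "x \<in> U" shows "christoffel g x u v = christoffel g x v u"
  by (rule inner_form_eqI[OF metric_onD(3)[OF g x]])
     (simp add: koszul[OF x] metric_dd_sym[OF x, of u v])

lemma metric_compatible:
  assumes x: "x \<in> U"
  shows "dd (\<lambda>y. g y u v) x w = g x (christoffel g x w u) v + g x u (christoffel g x w v)"
  unfolding metric_onD(5)[OF g x, of u] koszul[OF x]
  using metric_dd_sym[OF x, of u v] metric_dd_sym[OF x, of w v] metric_dd_sym[OF x, of w u]
  by (simp add: field_simps)

lemma christoffel_smooth: "smooth_on U (\<lambda>x. christoffel g x u v)"
  unfolding christoffel_def
  by (intro sharp_smooth[OF g] smooth_divide smooth_diff smooth_add smooth_dd smooth_const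
      metric_onD(1)[OF g] metric_onD(2)[OF g]) simp

end

lemma hess_bilinear:
  assumes U: "open U" "x \<in> U" and f: "smooth_on U f"
  shows "bilinear (\<lambda>u v. dd (\<lambda>y. dd f y v) x u)"
proof -
  have l: "linear (dd f y)" if "y \<in> U" for y by (rule smooth_linear_dd[OF f that])
  have d: "(\<lambda>y. dd f y v) differentiable (at x)" for v by (rule smooth_diff_at[OF smooth_dd[OF f] U(2)])
  have "linear (\<lambda>v. dd (\<lambda>y. dd f y v) x u)" for u
  proof (rule linearI)
    fix v v' and c :: real
    show "dd (\<lambda>y. dd f y (v + v')) x u = dd (\<lambda>y. dd f y v) x u + dd (\<lambda>y. dd f y v') x u"
      using dd_cong_open(1)[OF U, of "\<lambda>y. dd f y (v + v')" "\<lambda>y. dd f y v + dd f y v'"] l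
      by (simp add: linear_add dd_add d)
    show "dd (\<lambda>y. dd f y (c *\<^sub>R v)) x u = c *\<^sub>R dd (\<lambda>y. dd f y v) x u"
      using dd_cong_open(1)[OF U, of "\<lambda>y. dd f y (c *\<^sub>R v)" "\<lambda>y. c *\<^sub>R dd f y v"] l
      by (simp add: linear_cmul dd_linear_comp[OF bounded_linear_scaleR_right d])
  qed
  moreover have "linear (\<lambda>u. dd (\<lambda>y. dd f y v) x u)" for v
    by (rule smooth_linear_dd[OF smooth_dd[OF f] U(2)])
  ultimately show ?thesis unfolding bilinear_def by blast
qed

lemma sff_eq:
  "sff g h f x u v = dd (\<lambda>y. dd f y v) x u + christoffel h (f x) (dd f x u) (dd f x v)
     - dd f x (christoffel g x u v)"
proof -
  have "dd (\<lambda>_. v) x u = 0" by (rule dd_eq) simp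
  then show ?thesis by (simp add: sff_def cov_along_def cov_def)
qed

text \<open>For such a map, isometric or not, \<open>sff\<close> is the covariant Hessian \<open>\<nabla>df\<close>.\<close>

definition metric_map :: "(real^'m) set \<Rightarrow> 'm::finite lmetric \<Rightarrow> (real^'n) set \<Rightarrow> 'n::finite lmetric \<Rightarrow>
    (real^'m \<Rightarrow> real^'n) \<Rightarrow> bool" where
  "metric_map U g V h f \<longleftrightarrow> metric_on U g \<and> metric_on V h \<and> smooth_on U f \<and> f ` U \<subseteq> V"

definition isometric_map :: "(real^'m) set \<Rightarrow> 'm::finite lmetric \<Rightarrow> (real^'n) set \<Rightarrow> 'n::finite lmetric \<Rightarrow>
    (real^'m \<Rightarrow> real^'n) \<Rightarrow> bool" where
  "isometric_map U g V h f \<longleftrightarrow> metric_map U g V h f \<and>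
     (\<forall>x\<in>U. \<forall>u v. g x u v = h (f x) (dd f x u) (dd f x v))"

lemma metric_mapD:
  assumes "metric_map U g V h f"
  shows "metric_on U g" "metric_on V h" "smooth_on U f" "x \<in> U \<Longrightarrow> f x \<in> V" "open U" "open V"
    "x \<in> U \<Longrightarrow> linear (dd f x)" "x \<in> U \<Longrightarrow> f differentiable (at x)"
  using assms metric_onD(1) smooth_linear_dd smooth_diff_at unfolding metric_map_def by blast+

lemma isometric_mapD:
  assumes "isometric_map U g V h f"
  shows "metric_map U g V h f" "x \<in> U \<Longrightarrow> h (f x) (dd f x u) (dd f x v) = g x u v"
  using assms unfolding isometric_map_def by auto

context
  fixes U :: "(real^'m) set" and g :: "'m::finite lmetric" and V :: "(real^'n) set"
    and h :: "'n::finite lmetric" and f :: "real^'m \<Rightarrow> real^'n"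
  assumes f: "metric_map U g V h f"
begin

lemma sff_bilinear:
  assumes x: "x \<in> U" shows "bilinear (sff g h f x)"
proof -
  note fD = metric_mapD[OF f]
  note l = fD(7)[OF x] and H = hess_bilinear[OF fD(5) x fD(3)]
    and Cg = christoffel_bilinear[OF fD(1) x] and Ch = christoffel_bilinear[OF fD(2) fD(4)[OF x]]
  have "linear (\<lambda>u. sff g h f x u v)" "linear (\<lambda>v. sff g h f x u v)" for u v
    unfolding sff_eq
    by (auto intro!: linearI simp: linear_add[OF l] linear_cmul[OF l] bilinear_ladd[OF H] bilinear_radd[OF H]
        bilinear_lmul[OF H] bilinear_rmul[OF H] bilinear_ladd[OF Cg] bilinear_radd[OF Cg] bilinear_lmul[OF Cg]
        bilinear_rmul[OF Cg] bilinear_ladd[OF Ch] bilinear_radd[OF Ch] bilinear_lmul[OF Ch] bilinear_rmul[OF Ch]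
        algebra_simps)
  then show ?thesis unfolding bilinear_def by blast
qed

lemma sff_sym:
  assumes x: "x \<in> U" shows "sff g h f x u v = sff g h f x v u"
  unfolding sff_eq
  using hess_sym[OF metric_mapD(5,3)[OF f] x, of v u] christoffel_sym[OF metric_mapD(1)[OF f] x, of u v]
    christoffel_sym[OF metric_mapD(2)[OF f] metric_mapD(4)[OF f x], of "dd f x u" "dd f x v"] by simp

lemma sff_smooth: "smooth_on U (\<lambda>x. sff g h f x u v)"
proof -
  note fD = metric_mapD[OF f]
  have 1: "smooth_on U (\<lambda>x. dd f x w)" for w by (rule smooth_dd[OF fD(3)])
  have 2: "smooth_on U (\<lambda>x. christoffel h (f x) (dd f x u) (dd f x v))"
  proof (rule smooth_bilinear_field[where \<beta>="\<lambda>x. christoffel h (f x)", OF fD(5) _ _ 1 1])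
    show "bilinear (christoffel h (f x))" if "x \<in> U" for x
      by (rule christoffel_bilinear[OF fD(2) fD(4)[OF that]])
    show "smooth_on U (\<lambda>x. christoffel h (f x) a b)" for a b
      by (rule smooth_compose[OF fD(5) fD(6) fD(3) christoffel_smooth[OF fD(2)]]) (use fD(4) in auto)
  qed
  have 3: "smooth_on U (\<lambda>x. dd f x (christoffel g x u v))"
  proof -
    have "smooth_on U (\<lambda>x. \<Sum>i\<in>UNIV. (christoffel g x u v $ i) *\<^sub>R dd f x (axis i 1))"
      by (intro smooth_sum smooth_scaleR smooth_vec_nth christoffel_smooth[OF fD(1)] fD(5) 1)
    moreover have "dd f x (christoffel g x u v) = (\<Sum>i\<in>UNIV. (christoffel g x u v $ i) *\<^sub>R dd f x (axis i 1))"
      if "x \<in> U" for x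
    proof -
      have "dd f x (\<Sum>i\<in>UNIV. (christoffel g x u v $ i) *\<^sub>R axis i 1) = (\<Sum>i\<in>UNIV. (christoffel g x u v $ i) *\<^sub>R dd f x (axis i 1))"
        by (simp add: linear_sum[OF fD(7)[OF that]] linear_cmul[OF fD(7)[OF that]])
      then show ?thesis using basis_expansion[of "christoffel g x u v"] by (simp add: scalar_mult_eq_scaleR)
    qed
    ultimately show ?thesis using smooth_cong[OF fD(5), of "\<lambda>x. dd f x (christoffel g x u v)"
      "\<lambda>x. \<Sum>i\<in>UNIV. (christoffel g x u v $ i) *\<^sub>R dd f x (axis i 1)"] by simp
  qed
  show ?thesis unfolding sff_eq
    by (intro smooth_diff smooth_add fD(5) 2 3 smooth_dd fD(3))
qed

lemma hess_compose:
  fixes p :: "real^'n \<Rightarrow> real^'k"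
  assumes p: "smooth_on V p" and x: "x \<in> U"
  shows "dd (\<lambda>y. dd (\<lambda>z. p (f z)) y v) x u =
    dd (\<lambda>y. dd p y (dd f x v)) (f x) (dd f x u) + dd p (f x) (dd (\<lambda>y. dd f y v) x u)"
proof -
  note fD = metric_mapD[OF f]
  note fx = fD(4)[OF x]
  let ?b = "\<lambda>i. axis i (1::real) :: real^'n"
  have ex: "(\<Sum>i\<in>UNIV. w $ i *\<^sub>R ?b i) = w" for w
    using basis_expansion[of w] by (simp add: scalar_mult_eq_scaleR)
  have first: "dd (\<lambda>z. p (f z)) y v = (\<Sum>i\<in>UNIV. (dd f y v $ i) *\<^sub>R dd p (f y) (?b i))" if y: "y \<in> U" for y
  proof -
    have l: "linear (dd p (f y))" by (rule smooth_linear_dd[OF p fD(4)[OF y]])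
    have "dd (\<lambda>z. p (f z)) y v = dd p (f y) (dd f y v)"
      by (rule dd_compose[OF fD(8)[OF y] smooth_diff_at[OF p fD(4)[OF y]]])
    also have "\<dots> = dd p (f y) (\<Sum>i\<in>UNIV. (dd f y v $ i) *\<^sub>R ?b i)" by (simp only: ex)
    finally show ?thesis by (simp add: linear_sum[OF l] linear_cmul[OF l])
  qed
  have d1: "((\<lambda>y. dd f y v $ i) has_derivative (\<lambda>u. dd (\<lambda>y. dd f y v) x u $ i)) (at x)" for i
    by (rule bounded_linear.has_derivative[OF bounded_linear_vec_nth smooth_derivative[OF smooth_dd[OF fD(3)] x]])
  have d2: "((\<lambda>y. dd p (f y) (?b i)) has_derivative (\<lambda>u. dd (\<lambda>z. dd p z (?b i)) (f x) (dd f x u))) (at x)" for i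
    by (rule has_derivative_compose[OF smooth_derivative[OF fD(3) x] smooth_derivative[OF smooth_dd[OF p] fx]])
  have D: "((\<lambda>y. \<Sum>i\<in>UNIV. (dd f y v $ i) *\<^sub>R dd p (f y) (?b i)) has_derivative
      (\<lambda>u. \<Sum>i\<in>UNIV. (dd f x v $ i) *\<^sub>R dd (\<lambda>z. dd p z (?b i)) (f x) (dd f x u)
         + (dd (\<lambda>y. dd f y v) x u $ i) *\<^sub>R dd p (f x) (?b i))) (at x)"
    by (intro has_derivative_sum has_derivative_scaleR d1 d2)
  note lp = smooth_linear_dd[OF p fx]
  have lh: "linear (\<lambda>w. dd (\<lambda>z. dd p z w) (f x) (dd f x u))"
    using hess_bilinear[OF fD(6) fx p] by (simp add: bilinear_def)
  have "dd (\<lambda>y. dd (\<lambda>z. p (f z)) y v) x u = dd (\<lambda>y. \<Sum>i\<in>UNIV. (dd f y v $ i) *\<^sub>R dd p (f y) (?b i)) x u"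
    using dd_cong_open(1)[OF fD(5) x first] by simp
  also have "\<dots> = (\<Sum>i\<in>UNIV. (dd f x v $ i) *\<^sub>R dd (\<lambda>z. dd p z (?b i)) (f x) (dd f x u))
      + (\<Sum>i\<in>UNIV. (dd (\<lambda>y. dd f y v) x u $ i) *\<^sub>R dd p (f x) (?b i))"
    unfolding dd_eq[OF D] by (simp add: sum.distrib)
  also have "(\<Sum>i\<in>UNIV. (dd f x v $ i) *\<^sub>R dd (\<lambda>z. dd p z (?b i)) (f x) (dd f x u)) =
      dd (\<lambda>z. dd p z (\<Sum>i\<in>UNIV. (dd f x v $ i) *\<^sub>R ?b i)) (f x) (dd f x u)"
    by (simp add: linear_sum[OF lh] linear_cmul[OF lh])
  also have "(\<Sum>i\<in>UNIV. (dd (\<lambda>y. dd f y v) x u $ i) *\<^sub>R dd p (f x) (?b i)) =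
      dd p (f x) (\<Sum>i\<in>UNIV. (dd (\<lambda>y. dd f y v) x u $ i) *\<^sub>R ?b i)"
    by (simp add: linear_sum[OF lp] linear_cmul[OF lp])
  finally show ?thesis by (simp only: ex)
qed

text \<open>The chain rule for covariant Hessians: the connection of the middle space enters the two
  terms on the right with opposite signs.\<close>

lemma sff_compose:
  fixes p :: "real^'n \<Rightarrow> real^'k"
  assumes p: "metric_map V h W k p" and x: "x \<in> U"
  shows "sff g k (\<lambda>x. p (f x)) x u v = sff h k p (f x) (dd f x u) (dd f x v) + dd p (f x) (sff g h f x u v)"
proof -
  note fx = metric_mapD(4)[OF f x]
  have c: "dd (\<lambda>z. p (f z)) x w = dd p (f x) (dd f x w)" for w
    by (rule dd_compose[OF metric_mapD(8)[OF f x] metric_mapD(8)[OF p fx]])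
  note l = metric_mapD(7)[OF p fx]
  show ?thesis unfolding sff_eq c hess_compose[OF metric_mapD(3)[OF p] x]
    by (simp add: linear_add[OF l] linear_diff[OF l])
qed

end

text \<open>The second fundamental form of an isometric map is normal: differentiating
  \<open>g(u, v) = h(df u, df v)\<close> and combining three such identities as in the Koszul formula gives
  \<open>h(\<nabla>df(u, v), df w) = 0\<close>.\<close>

lemma sff_normal:
  assumes f: "isometric_map U g V h f" and x: "x \<in> U"
  shows "h (f x) (sff g h f x u v) (dd f x w) = 0"
proof -
  note iso = isometric_mapD[OF f]
  note fD = metric_mapD[OF iso(1)]
  note fx = fD(4)[OF x]
  note b = metric_onD(4)[OF fD(2) fx] and sym = metric_onD(5)[OF fD(2) fx]
  let ?D2 = "\<lambda>u v. dd (\<lambda>y. dd f y v) x u"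
  have dh: "dd (\<lambda>y. h (f y) p q) x w = dd (\<lambda>z. h z p q) (f x) (dd f x w)" for p q w
    by (rule dd_compose[OF fD(8)[OF x] smooth_diff_at[OF metric_onD(2)[OF fD(2)] fx]])
  have diff: "(\<lambda>y. h (f y) p q) differentiable (at x)" for p q
    by (rule differentiable_compose[OF smooth_diff_at[OF metric_onD(2)[OF fD(2)] fx] fD(8)[OF x]])
  have der: "dd (\<lambda>y. g y u v) x w =
      dd (\<lambda>z. h z (dd f x u) (dd f x v)) (f x) (dd f x w) + h (f x) (?D2 w u) (dd f x v) + h (f x) (dd f x u) (?D2 w v)" for u v w
  proof -
    have "dd (\<lambda>y. g y u v) x w = dd (\<lambda>y. h (f y) (dd f y u) (dd f y v)) x w"
      using dd_cong_open(1)[OF fD(5) x, of "\<lambda>y. g y u v" "\<lambda>y. h (f y) (dd f y u) (dd f y v)"] iso(2) by simp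
    also have "\<dots> = dd (\<lambda>y. h (f y) (dd f x u) (dd f x v)) x w + h (f x) (?D2 w u) (dd f x v) + h (f x) (dd f x u) (?D2 w v)"
      by (rule dd_eq[OF has_derivative_bilinear_field[where \<beta>="\<lambda>y. h (f y)", OF fD(5) x]])
         (use metric_onD(4)[OF fD(2) fD(4)] diff smooth_diff_at[OF smooth_dd[OF fD(3)] x] in auto)
    finally show ?thesis by (simp only: dh)
  qed
  have s2: "?D2 p q = ?D2 q p" for p q by (rule hess_sym[OF fD(5,3) x])
  have "h (f x) (dd f x (christoffel g x u v)) (dd f x w) = g x (christoffel g x u v) w" by (rule iso(2)[OF x])
  also have "\<dots> = (dd (\<lambda>y. g y v w) x u + dd (\<lambda>y. g y u w) x v - dd (\<lambda>y. g y u v) x w) / 2"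
    by (rule koszul[OF fD(1) x])
  also have "\<dots> = h (f x) (christoffel h (f x) (dd f x u) (dd f x v)) (dd f x w) + h (f x) (?D2 u v) (dd f x w)"
    unfolding der koszul[OF fD(2) fx]
    using s2[of u v] s2[of u w] s2[of v w] sym[of "dd f x v" "?D2 u w"] sym[of "dd f x u" "?D2 v w"]
    by (simp add: field_simps)
  finally show ?thesis unfolding sff_eq by (simp add: bilinear_lsub[OF b] bilinear_ladd[OF b])
qed

lemma isometric_inj:
  assumes f: "isometric_map U g V h f" and x: "x \<in> U"
  shows "inj (dd f x)"
proof -
  note iso = isometric_mapD[OF f]
  note fD = metric_mapD[OF iso(1)]
  have "u = 0" if "dd f x u = 0" for u
    using iso(2)[OF x, of u u] that inner_formD(4)[OF metric_onD(3)[OF fD(1) x], of u]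
      bilinear_lzero[OF metric_onD(4)[OF fD(2) fD(4)[OF x]]] by simp
  then show ?thesis using linear_injective_0[OF fD(7)[OF x]] by blast
qed

lemma sff_isometry_zero:
  fixes f :: "real^'n \<Rightarrow> real^'n"
  assumes f: "isometric_map U g V h f" and x: "x \<in> U"
  shows "sff g h f x u v = 0"
proof -
  note fD = metric_mapD[OF isometric_mapD(1)[OF f]]
  have "surj (dd f x)" by (rule linear_injective_imp_surjective[OF fD(7)[OF x] isometric_inj[OF f x] refl])
  then obtain w where w: "sff g h f x u v = dd f x w" by blast
  have "h (f x) (sff g h f x u v) (sff g h f x u v) = 0"
    using sff_normal[OF f x, of u v w] w by simp
  then show ?thesis using inner_formD(4)[OF metric_onD(3)[OF fD(2) fD(4)[OF x]]] by blast
qed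

section \<open>Mean curvature in different charts\<close>

lemma orthonormal_basis_exists:
  fixes g :: "2 lmetric"
  assumes "metric_on U g" "x \<in> U"
  obtains E :: "2 \<Rightarrow> real^2" where "orthonormal (g x) E"
proof -
  obtain E where "orthonormal_frame_on g U E" using exists_orthonormal_frame[OF assms(1)] by blast
  then show ?thesis using assms(2) that[of "\<lambda>i. E i x"] by (simp add: orthonormal_def orthonormal_frame_on_def)
qed

lemma mean_curv_frame:
  fixes E :: "2 \<Rightarrow> real^2"
  assumes f: "metric_map U g V h f" and x: "x \<in> U" and E: "orthonormal (g x) E"
  shows "mean_curv g h f x = (1/2) *\<^sub>R (\<Sum>i\<in>UNIV. sff g h f x (E i) (E i))"
  unfolding mean_curv_def
  using ginv_trace[of g x E "sff g h f x"] metric_onD(3)[OF metric_mapD(1)[OF f] x] E sff_bilinear[OF f x] by simp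

text \<open>A change of charts gives \<open>f' \<circ> \<tau> = \<sigma> \<circ> f\<close> with isometries \<open>\<tau>\<close>, \<open>\<sigma>\<close>. The covariant Hessian
  satisfies a chain rule and vanishes for isometries between spaces of equal dimension. Hence
  \<open>\<sigma>\<close> carries one second fundamental form to the other, and the trace may be taken over
  corresponding orthonormal bases.\<close>

lemma mean_curv_norm_invariant:
  fixes f :: "real^2 \<Rightarrow> real^'n" and \<tau> :: "real^2 \<Rightarrow> real^2" and \<sigma> :: "real^'n \<Rightarrow> real^'n"
  assumes f: "metric_map U g V h f" and f': "metric_map U' g' V' h' f'"
    and \<tau>: "isometric_map U g U' g' \<tau>" and \<sigma>: "isometric_map V h V' h' \<sigma>"
    and comm: "\<And>y. y \<in> U \<Longrightarrow> f' (\<tau> y) = \<sigma> (f y)" and x: "x \<in> U"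
  shows "mean_curv_norm g' h' f' (\<tau> x) = mean_curv_norm g h f x"
proof -
  note \<tau>D = isometric_mapD[OF \<tau>] and \<sigma>D = isometric_mapD[OF \<sigma>] and fD = metric_mapD[OF f]
  note fx = fD(4)[OF x] and \<tau>x = metric_mapD(4)[OF \<tau>D(1) x]
  have sff: "sff g' h' f' (\<tau> x) (dd \<tau> x u) (dd \<tau> x v) = dd \<sigma> (f x) (sff g h f x u v)" for u v
  proof -
    have dl: "dd (\<lambda>y. f' (\<tau> y)) y = dd (\<lambda>y. \<sigma> (f y)) y" if "y \<in> U" for y
      by (rule dd_cong_open(1)[OF fD(5) that comm])
    have "sff g h' (\<lambda>y. f' (\<tau> y)) x u v = sff g h' (\<lambda>y. \<sigma> (f y)) x u v"
      unfolding sff_eq using dl[OF x] comm[OF x]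
        dd_cong_open(1)[OF fD(5) x, of "\<lambda>y. dd (\<lambda>y. f' (\<tau> y)) y v" "\<lambda>y. dd (\<lambda>y. \<sigma> (f y)) y v"] dl by simp
    then show ?thesis
      unfolding sff_compose[OF \<tau>D(1) f' x] sff_compose[OF f \<sigma>D(1) x]
      using sff_isometry_zero[OF \<tau> x, of u v] sff_isometry_zero[OF \<sigma> fx]
        linear_0[OF metric_mapD(7)[OF f' \<tau>x]] by simp
  qed
  obtain E :: "2 \<Rightarrow> real^2" where E: "orthonormal (g x) E" using orthonormal_basis_exists[OF fD(1) x] by blast
  have E': "orthonormal (g' (\<tau> x)) (\<lambda>i. dd \<tau> x (E i))"
    using E \<tau>D(2)[OF x] by (simp add: orthonormal_def)
  note l = metric_mapD(7)[OF \<sigma>D(1) fx]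
  have H: "mean_curv g' h' f' (\<tau> x) = dd \<sigma> (f x) (mean_curv g h f x)"
    unfolding mean_curv_frame[OF f' \<tau>x E'] mean_curv_frame[OF f x E] sff
    by (simp add: linear_cmul[OF l] linear_sum[OF l])
  show ?thesis unfolding mean_curv_norm_def H comm[OF x] \<sigma>D(2)[OF fx] ..
qed


section \<open>Symmetric tensors: divergence, trace and the Codazzi equation\<close>

definition tensor_on :: "(real^'n) set \<Rightarrow> 'n::finite lmetric \<Rightarrow> bool" where
  "tensor_on U T \<longleftrightarrow> (\<forall>u v. smooth_on U (\<lambda>x. T x u v)) \<and>
     (\<forall>x\<in>U. bilinear (T x) \<and> (\<forall>u v. T x u v = T x v u))"

text \<open>The components of \<open>\<nabla>T\<close> at a point, with constant coordinate vectors as arguments.\<close>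

definition nabla :: "'n::finite lmetric \<Rightarrow> 'n lmetric \<Rightarrow> real^'n \<Rightarrow> real^'n \<Rightarrow> real^'n \<Rightarrow> real^'n \<Rightarrow> real" where
  "nabla g T x u v w = dd (\<lambda>y. T y v w) x u - T x (christoffel g x u v) w - T x v (christoffel g x u w)"

lemma tensor_onD:
  assumes "tensor_on U T"
  shows "smooth_on U (\<lambda>x. T x u v)" "x \<in> U \<Longrightarrow> bilinear (T x)" "x \<in> U \<Longrightarrow> T x u v = T x v u"
  using assms unfolding tensor_on_def by blast+

lemma frameD:
  assumes "orthonormal_frame_on g U E"
  shows "smooth_on U (E i)" "x \<in> U \<Longrightarrow> g x (E i x) (E j x) = (if i = j then 1 else 0)"
    "x \<in> U \<Longrightarrow> orthonormal (g x) (\<lambda>i. E i x)"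
  using assms unfolding orthonormal_frame_on_def orthonormal_def by blast+

lemma minus_self_zero: "(a::real) = - a \<Longrightarrow> a = 0" by simp

context
  fixes U :: "(real^'n) set" and g T :: "'n::finite lmetric"
  assumes g: "metric_on U g" and T: "tensor_on U T"
begin

lemma tensor_field_derivative:
  assumes x: "x \<in> U" and Y: "Y differentiable (at x)" and Z: "Z differentiable (at x)"
  shows "dd (\<lambda>y. T y (Y y) (Z y)) x w = nabla g T x w (Y x) (Z x)
    + T x (dd Y x w + christoffel g x w (Y x)) (Z x) + T x (Y x) (dd Z x w + christoffel g x w (Z x))"
proof -
  note b = tensor_onD(2)[OF T x]
  have "dd (\<lambda>y. T y (Y y) (Z y)) x w =
      dd (\<lambda>y. T y (Y x) (Z x)) x w + T x (dd Y x w) (Z x) + T x (Y x) (dd Z x w)"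
    by (rule dd_eq[OF has_derivative_bilinear_field[where \<beta>=T, OF metric_onD(1)[OF g] x]])
       (use tensor_onD(2)[OF T] smooth_diff_at[OF tensor_onD(1)[OF T] x] Y Z in auto)
  then show ?thesis by (simp add: nabla_def bilinear_ladd[OF b] bilinear_radd[OF b])
qed

lemma cov_tensor_eq:
  assumes x: "x \<in> U" and Y: "Y differentiable (at x)" and Z: "Z differentiable (at x)"
  shows "cov_tensor g T X Y Z x = nabla g T x (X x) (Y x) (Z x)"
  unfolding cov_tensor_def cov_def tensor_field_derivative[OF assms] by simp

lemma nabla_sym: "x \<in> U \<Longrightarrow> nabla g T x u v w = nabla g T x u w v"
  unfolding nabla_def
  using dd_cong_open(1)[OF metric_onD(1)[OF g], of x "\<lambda>y. T y v w" "\<lambda>y. T y w v"]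
    tensor_onD(3)[OF T] by simp

lemma nabla_linear:
  assumes x: "x \<in> U"
  shows "linear (\<lambda>u. nabla g T x u v w)" "bilinear (nabla g T x u)"
proof -
  note b = tensor_onD(2)[OF T x] and C = christoffel_bilinear[OF g x]
  have L: "linear (dd (\<lambda>y. T y v w) x)" for v w by (rule smooth_linear_dd[OF tensor_onD(1)[OF T] x])
  have B: "bilinear (\<lambda>v w. dd (\<lambda>y. T y v w) x u)" for u
    by (rule bilinear_dd[OF metric_onD(1)[OF g] x])
       (use tensor_onD(2)[OF T] smooth_diff_at[OF tensor_onD(1)[OF T] x] in auto)
  note simps = bilinear_ladd[OF b] bilinear_radd[OF b] bilinear_lmul[OF b] bilinear_rmul[OF b]
    bilinear_ladd[OF C] bilinear_radd[OF C] bilinear_lmul[OF C] bilinear_rmul[OF C]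
    bilinear_ladd[OF B] bilinear_radd[OF B] bilinear_lmul[OF B] bilinear_rmul[OF B]
    linear_add[OF L] linear_cmul[OF L]
  show "linear (\<lambda>u. nabla g T x u v w)" unfolding nabla_def
    by (rule linearI) (simp_all add: simps algebra_simps)
  show "bilinear (nabla g T x u)" unfolding bilinear_def nabla_def
    by (auto intro!: linearI simp: simps algebra_simps)
qed

text \<open>The trace commutes with \<open>\<nabla>\<close>: the connection coefficients \<open>g(\<nabla>\<^sub>u E\<^sub>i, E\<^sub>j)\<close> of an
  orthonormal frame are antisymmetric in \<open>i, j\<close>, hence cancel against the symmetric \<open>T\<close>.\<close>

lemma trace_derivative:
  assumes E: "orthonormal_frame_on g U E" and x: "x \<in> U"
  shows "dd (\<lambda>y. \<Sum>i\<in>UNIV. T y (E i y) (E i y)) x u = (\<Sum>i\<in>UNIV. nabla g T x u (E i x) (E i x))"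
proof -
  note U = metric_onD(1)[OF g]
  note b = tensor_onD(2)[OF T x] and bg = metric_onD(4)[OF g x]
  have dE: "E i differentiable (at x)" for i by (rule smooth_diff_at[OF frameD(1)[OF E] x])
  define W where "W i = dd (E i) x u + christoffel g x u (E i x)" for i
  define \<omega> where "\<omega> i j = g x (W i) (E j x)" for i j
  have anti: "\<omega> i j = - \<omega> j i" for i j
  proof -
    have "dd (\<lambda>y. g y (E i y) (E j y)) x u = dd (\<lambda>y. if i = j then 1 else 0) x u"
      using dd_cong_open(1)[OF U x, of "\<lambda>y. g y (E i y) (E j y)" "\<lambda>y. if i = j then 1 else 0"]
        frameD(2)[OF E] by simp
    also have "\<dots> = 0" by (rule dd_eq) simp
    finally have 0: "dd (\<lambda>y. g y (E i y) (E j y)) x u = 0" .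
    have "dd (\<lambda>y. g y (E i y) (E j y)) x u =
        dd (\<lambda>y. g y (E i x) (E j x)) x u + g x (dd (E i) x u) (E j x) + g x (E i x) (dd (E j) x u)"
      by (rule dd_eq[OF has_derivative_bilinear_field[where \<beta>=g, OF U x]])
         (use metric_onD(4)[OF g] smooth_diff_at[OF metric_onD(2)[OF g] x] dE in auto)
    then show ?thesis using 0 metric_onD(5)[OF g x, of "E i x"]
      by (simp add: \<omega>_def W_def metric_compatible[OF g x] bilinear_ladd[OF bg])
  qed
  have T0: "(\<Sum>i\<in>UNIV. T x (W i) (E i x)) = 0"
  proof (rule minus_self_zero)
    have lT: "linear (\<lambda>v. T x v w)" for w using b by (simp add: bilinear_def)
    have "T x (W i) (E i x) = (\<Sum>j\<in>UNIV. \<omega> i j * T x (E j x) (E i x))" for i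
    proof -
      have e: "W i = (\<Sum>j\<in>UNIV. \<omega> i j *\<^sub>R E j x)"
        unfolding \<omega>_def by (rule orthonormal_expand[OF metric_onD(3)[OF g x] frameD(3)[OF E x]])
      show ?thesis by (subst e) (simp add: linear_sum[OF lT] linear_cmul[OF lT])
    qed
    then have s: "(\<Sum>i\<in>UNIV. T x (W i) (E i x)) = (\<Sum>i\<in>UNIV. \<Sum>j\<in>UNIV. \<omega> i j * T x (E j x) (E i x))" by simp
    also have "\<dots> = (\<Sum>j\<in>UNIV. \<Sum>i\<in>UNIV. \<omega> i j * T x (E j x) (E i x))" by (rule sum.swap)
    also have "\<dots> = (\<Sum>j\<in>UNIV. \<Sum>i\<in>UNIV. - (\<omega> j i * T x (E i x) (E j x)))"
    proof (intro sum.cong refl)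
      fix i j show "\<omega> i j * T x (E j x) (E i x) = - (\<omega> j i * T x (E i x) (E j x))"
        using anti[of i j] tensor_onD(3)[OF T x, of "E i x" "E j x"] by simp
    qed
    also have "\<dots> = - (\<Sum>i\<in>UNIV. T x (W i) (E i x))" by (simp add: s sum_negf)
    finally show "(\<Sum>i\<in>UNIV. T x (W i) (E i x)) = - (\<Sum>i\<in>UNIV. T x (W i) (E i x))" .
  qed
  have each: "dd (\<lambda>y. T y (E i y) (E i y)) x u = nabla g T x u (E i x) (E i x) + 2 * T x (W i) (E i x)" for i
    using tensor_field_derivative[OF x dE dE, of i i u] tensor_onD(3)[OF T x, of "E i x" "W i"]
    by (simp add: W_def)
  have sm: "smooth_on U (\<lambda>y. T y (E i y) (E i y))" for i
    by (rule smooth_bilinear_field[where \<beta>=T, OF U tensor_onD(2)[OF T] tensor_onD(1)[OF T] frameD(1)[OF E] frameD(1)[OF E]])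
  have "dd (\<lambda>y. \<Sum>i\<in>UNIV. T y (E i y) (E i y)) x u = (\<Sum>i\<in>UNIV. dd (\<lambda>y. T y (E i y) (E i y)) x u)"
    by (rule dd_eq[OF has_derivative_sum]) (rule smooth_derivative[OF sm x])
  also have "\<dots> = (\<Sum>i\<in>UNIV. nabla g T x u (E i x) (E i x)) + 2 * (\<Sum>i\<in>UNIV. T x (W i) (E i x))"
    unfolding each by (simp add: sum.distrib sum_distrib_left)
  finally show ?thesis by (simp add: T0)
qed

lemma div_tensor_eq:
  assumes E: "orthonormal_frame_on g U E" and x: "x \<in> U" and Y: "Y differentiable (at x)"
  shows "div_tensor g E T Y x = (\<Sum>i\<in>UNIV. nabla g T x (E i x) (E i x) (Y x))"
  unfolding div_tensor_def
  by (intro sum.cong refl cov_tensor_eq[OF x] Y smooth_diff_at[OF frameD(1)[OF E] x])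

end

text \<open>In dimension two the Codazzi defect \<open>C(u, v, w) = (\<nabla>\<^sub>u T)(v, w) - (\<nabla>\<^sub>v T)(u, w)\<close> is alternating
  in \<open>u, v\<close>, so it is determined by its contraction, which is the divergence of \<open>T\<close> minus the
  differential of its trace.\<close>

lemma codazzi_iff_trace_derivative_zero:
  fixes g T :: "2 lmetric" and E :: "2 \<Rightarrow> real^2"
  assumes g: "metric_on U g" and T: "tensor_on U T" and x: "x \<in> U"
    and E: "orthonormal (g x) E"
    and div: "\<And>w. (\<Sum>i\<in>UNIV. nabla g T x (E i) (E i) w) = 0"
  shows "(\<forall>u v w. nabla g T x u v w = nabla g T x v u w) \<longleftrightarrow>
    (\<forall>u. (\<Sum>i\<in>UNIV. nabla g T x u (E i) (E i)) = 0)" (is "?C \<longleftrightarrow> ?D")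
proof
  let ?n = "nabla g T x"
  note sym = nabla_sym[OF g T x]
  assume ?C
  show ?D
  proof
    fix u
    have "?n u (E i) (E i) = ?n (E i) (E i) u" for i using \<open>?C\<close> sym by metis
    then show "(\<Sum>i\<in>UNIV. ?n u (E i) (E i)) = 0" using div[of u] by simp
  qed
next
  let ?n = "nabla g T x"
  note sym = nabla_sym[OF g T x]
  assume D: ?D
  have d: "?n (E 1) (E 1) w = - ?n (E 2) (E 2) w" "?n u (E 1) (E 1) = - ?n u (E 2) (E 2)" for u w
    using div[of w] D[rule_format, of u] by (simp_all add: sum_2)
  have c1: "?n (E 1) (E 2) (E 1) = ?n (E 2) (E 1) (E 1)"
    using d(1)[of "E 2"] d(2)[of "E 2"] sym[of "E 1" "E 1" "E 2"] by simp
  have c2: "?n (E 1) (E 2) (E 2) = ?n (E 2) (E 1) (E 2)"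
    using d(1)[of "E 1"] d(2)[of "E 1"] sym[of "E 2" "E 1" "E 2"] by simp
  note L1 = nabla_linear(1)[OF g T x] and B = nabla_linear(2)[OF g T x]
  have ex: "v = g x v (E 1) *\<^sub>R E 1 + g x v (E 2) *\<^sub>R E 2" for v
    using orthonormal_expand[OF metric_onD(3)[OF g x] E, of v] by (simp only: sum_2)
  have c: "?n (E 1) (E 2) w = ?n (E 2) (E 1) w" for w
    by (subst (1 2) ex[of w]) (simp add: bilinear_radd[OF B] bilinear_rmul[OF B] c1 c2)
  show ?C
  proof (intro allI)
    fix u v w
    show "?n u v w = ?n v u w"
      apply (subst (1 2) ex[of u], subst (1 2) ex[of v])
      by (simp add: linear_add[OF L1] linear_cmul[OF L1] bilinear_ladd[OF B] bilinear_lmul[OF B] c algebra_simps)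
  qed
qed

text \<open>In isothermal coordinates \<open>\<Gamma>(e\<^sub>1, e\<^sub>1) + \<Gamma>(e\<^sub>2, e\<^sub>2) = 0\<close>, that is \<open>\<nabla>\<close> of \<open>\<partial>\<^sub>z\<close> in direction
  \<open>\<partial>\<^sub>z\<^sub>b\<^sub>a\<^sub>r\<close> vanishes. Therefore \<open>\<partial>\<^sub>z\<^sub>b\<^sub>a\<^sub>r (T(\<partial>\<^sub>z, \<partial>\<^sub>z))\<close> is a component of \<open>\<nabla> T\<close>, and for a
  divergence free \<open>T\<close> it is a multiple of \<open>\<partial>\<^sub>z (tr T)\<close>.\<close>

lemma isothermal_divfree:
  fixes g T :: "2 lmetric"
  assumes g: "metric_on U g" and T: "tensor_on U T" and x: "x \<in> U"
    and iso: "\<And>y u v. y \<in> U \<Longrightarrow> g y u v = r y * (u \<bullet> v)"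
    and div: "\<And>w. nabla g T x (axis 1 1) (axis 1 1) w + nabla g T x (axis 2 1) (axis 2 1) w = 0"
  defines "P \<equiv> \<lambda>y. T y (axis 1 1) (axis 1 1) - T y (axis 2 1) (axis 2 1)"
    and "S \<equiv> \<lambda>y. T y (axis 1 1) (axis 2 1)"
    and "t \<equiv> \<lambda>u. nabla g T x u (axis 1 1) (axis 1 1) + nabla g T x u (axis 2 1) (axis 2 1)"
  shows "dd P x (axis 1 1) + 2 * dd S x (axis 2 1) = - t (axis 1 1)"
    "dd P x (axis 2 1) - 2 * dd S x (axis 1 1) = t (axis 2 1)"
proof -
  note U = metric_onD(1)[OF g]
  let ?e1 = "axis 1 (1::real) :: real^2" and ?e2 = "axis 2 (1::real) :: real^2"
  let ?G = "christoffel g x"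
  note b = tensor_onD(2)[OF T x] and bg = metric_onD(4)[OF g x]
  have inn: "?e1 \<bullet> ?e1 = 1" "?e2 \<bullet> ?e2 = 1" "?e1 \<bullet> ?e2 = 0" "?e2 \<bullet> ?e1 = 0"
    by (simp_all add: inner_axis_axis)
  have dg: "dd (\<lambda>y. g y u v) x w = (u \<bullet> v) * dd (\<lambda>y. g y ?e1 ?e1) x w" for u v w
  proof -
    have "dd (\<lambda>y. g y u v) x w = dd (\<lambda>y. (u \<bullet> v) * g y ?e1 ?e1) x w"
      using dd_cong_open(1)[OF U x, of "\<lambda>y. g y u v" "\<lambda>y. (u \<bullet> v) * g y ?e1 ?e1"] iso inn
      by (simp add: mult.commute)
    then show ?thesis
      by (simp add: dd_linear_comp[OF bounded_linear_mult_right] smooth_diff_at[OF metric_onD(2)[OF g] x])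
  qed
  have G0: "?G ?e1 ?e1 + ?G ?e2 ?e2 = 0"
  proof (rule inner_form_eqI[OF metric_onD(3)[OF g x]])
    fix v :: "real^2"
    let ?r = "dd (\<lambda>y. g y ?e1 ?e1) x"
    have l: "linear ?r" by (rule metric_dd_linear[OF g x])
    have v: "v = (v $ 1) *\<^sub>R ?e1 + (v $ 2) *\<^sub>R ?e2" using plane_pt_eq[of v] by simp
    have rv: "?r v = v $ 1 * ?r ?e1 + v $ 2 * ?r ?e2"
      by (subst v) (simp add: linear_add[OF l] linear_cmul[OF l])
    have iv: "?e1 \<bullet> v = v $ 1" "?e2 \<bullet> v = v $ 2" by (simp_all add: inner_axis' )
    have "g x (?G ?e1 ?e1) v + g x (?G ?e2 ?e2) v = 0"
      unfolding koszul[OF g x] dg[of _ v] dg[of ?e2 ?e2] inn iv rv by (simp add: field_simps)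
    then show "g x (?G ?e1 ?e1 + ?G ?e2 ?e2) v = g x 0 v"
      by (simp add: bilinear_ladd[OF bg] bilinear_lzero[OF bg])
  qed
  then have G2: "?G ?e2 ?e2 = - ?G ?e1 ?e1" by (simp add: add_eq_0_iff)
  have G12: "?G ?e2 ?e1 = ?G ?e1 ?e2" by (rule christoffel_sym[OF g x])
  have dT: "dd (\<lambda>y. T y u v) x w = nabla g T x w u v + T x (?G w u) v + T x u (?G w v)" for u v w
    by (simp add: nabla_def)
  have df: "(\<lambda>y. T y u v) differentiable (at x)" for u v by (rule smooth_diff_at[OF tensor_onD(1)[OF T] x])
  have P: "dd P x w = dd (\<lambda>y. T y ?e1 ?e1) x w - dd (\<lambda>y. T y ?e2 ?e2) x w" for w
    unfolding P_def by (rule dd_diff[OF df df])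
  note sym = nabla_sym[OF g T x] and Ts = tensor_onD(3)[OF T x]
  have n1: "nabla g T x ?e1 ?e1 w = - nabla g T x ?e2 ?e2 w" for w using div[of w] by simp
  show "dd P x ?e1 + 2 * dd S x ?e2 = - t ?e1"
    unfolding P S_def t_def dT G2 G12
    using Ts[of ?e1 "?G ?e1 ?e1"] Ts[of ?e2 "?G ?e1 ?e2"] n1[of ?e1] sym[of ?e2 ?e1 ?e2]
    by (simp add: bilinear_lneg[OF b] bilinear_rneg[OF b])
  show "dd P x ?e2 - 2 * dd S x ?e1 = t ?e2"
    unfolding P S_def t_def dT G2 G12
    using Ts[of ?e1 "?G ?e1 ?e2"] Ts[of ?e2 "?G ?e1 ?e1"] n1[of ?e2] 
    by (simp add: bilinear_lneg[OF b] bilinear_rneg[OF b])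
qed

section \<open>The stress-bienergy tensor of a surface\<close>

context
  fixes U :: "(real^2) set" and g :: "2 lmetric" and V :: "(real^'n) set"
    and h :: "'n::finite lmetric" and f :: "real^2 \<Rightarrow> real^'n"
  assumes f: "metric_map U g V h f"
begin

lemma mean_curv_smooth: "smooth_on U (mean_curv g h f)"
proof -
  note fD = metric_mapD[OF f]
  obtain E where E: "orthonormal_frame_on g U E" using exists_orthonormal_frame[OF fD(1)] by blast
  have "smooth_on U (\<lambda>x. (1/2) *\<^sub>R (\<Sum>i\<in>UNIV. sff g h f x (E i x) (E i x)))"
    by (intro smooth_scaleR smooth_const smooth_sum fD(5)
        smooth_bilinear_field[where \<beta>="sff g h f", OF fD(5) sff_bilinear[OF f] sff_smooth[OF f] frameD(1)[OF E] frameD(1)[OF E]])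
  then show ?thesis
    using smooth_cong[OF fD(5), of "mean_curv g h f"] mean_curv_frame[OF f _ frameD(3)[OF E]] by auto
qed

lemma mean_curv_norm_sq:
  assumes x: "x \<in> U"
  shows "(mean_curv_norm g h f x)\<^sup>2 = h (f x) (mean_curv g h f x) (mean_curv g h f x)"
proof -
  note fD = metric_mapD[OF f]
  note i = metric_onD(3)[OF fD(2) fD(4)[OF x]]
  show ?thesis by (simp add: mean_curv_norm_def inner_form_nonneg[OF i])
qed

lemma stress_bienergy_eq:
  assumes x: "x \<in> U"
  shows "stress_bienergy g h f x u v = - 2 * (mean_curv_norm g h f x)\<^sup>2 * g x u v
    + 4 * h (f x) (sff g h f x u v) (mean_curv g h f x)"
proof -
  note fD = metric_mapD[OF f]
  note bs = sff_bilinear[OF f x] and bh = metric_onD(4)[OF fD(2) fD(4)[OF x]]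
  have "linear (\<lambda>v. h (f x) (sff g h f x u v) (mean_curv g h f x))"
    by (rule linearI) (simp_all add: bilinear_radd[OF bs] bilinear_rmul[OF bs] bilinear_ladd[OF bh] bilinear_lmul[OF bh])
  from sharp_works[where x=x and g=g, OF metric_onD(3)[OF fD(1) x] this]
  show ?thesis by (simp add: stress_bienergy_def shape_op_H_def)
qed

lemma stress_bienergy_tensor: "tensor_on U (stress_bienergy g h f)"
proof -
  note fD = metric_mapD[OF f]
  have sh: "smooth_on U (\<lambda>x. h (f x) (X x) (Y x))" if "smooth_on U X" "smooth_on U Y" for X Y
  proof (rule smooth_bilinear_field[where \<beta>="\<lambda>x. h (f x)", OF fD(5) _ _ that])
    show "bilinear (h (f x))" if "x \<in> U" for x by (rule metric_onD(4)[OF fD(2) fD(4)[OF that]])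
    show "smooth_on U (\<lambda>x. h (f x) u v)" for u v
      by (rule smooth_compose[OF fD(5) fD(6) fD(3) metric_onD(2)[OF fD(2)]]) (use fD(4) in auto)
  qed
  have "smooth_on U (\<lambda>x. stress_bienergy g h f x u v)" for u v
  proof -
    have "smooth_on U (\<lambda>x. - 2 * h (f x) (mean_curv g h f x) (mean_curv g h f x) * g x u v
        + 4 * h (f x) (sff g h f x u v) (mean_curv g h f x))"
      by (intro smooth_add smooth_mult smooth_const sh mean_curv_smooth sff_smooth[OF f] metric_onD(2)[OF fD(1)] fD(5))
    then show ?thesis
      by (rule smooth_cong[OF fD(5), THEN iffD2, rotated]) (simp add: stress_bienergy_eq mean_curv_norm_sq)
  qed
  moreover have "bilinear (stress_bienergy g h f x)" if x: "x \<in> U" for x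
  proof -
    note bs = sff_bilinear[OF f x] and bh = metric_onD(4)[OF fD(2) fD(4)[OF x]] and bg = metric_onD(4)[OF fD(1) x]
    show ?thesis unfolding bilinear_def
      by (auto intro!: linearI simp: stress_bienergy_eq[OF x] bilinear_ladd[OF bs] bilinear_radd[OF bs] bilinear_lmul[OF bs]
          bilinear_rmul[OF bs] bilinear_ladd[OF bh] bilinear_lmul[OF bh] bilinear_ladd[OF bg] bilinear_radd[OF bg]
          bilinear_lmul[OF bg] bilinear_rmul[OF bg] algebra_simps)
  qed
  moreover have "stress_bienergy g h f x u v = stress_bienergy g h f x v u" if x: "x \<in> U" for x u v
    unfolding stress_bienergy_eq[OF x] sff_sym[OF f x, of u v] metric_onD(5)[OF fD(1) x, of u v] ..
  ultimately show ?thesis unfolding tensor_on_def by blast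
qed

text \<open>The trace of \<open>A\<^sub>H\<close> is \<open>2 |H|\<^sup>2\<close>, so that of \<open>S\<^sub>2\<close> is \<open>-4 |H|\<^sup>2 + 8 |H|\<^sup>2\<close>.\<close>

lemma stress_bienergy_trace:
  fixes E :: "2 \<Rightarrow> real^2"
  assumes x: "x \<in> U" and E: "orthonormal (g x) E"
  shows "(\<Sum>i\<in>UNIV. stress_bienergy g h f x (E i) (E i)) = 4 * (mean_curv_norm g h f x)\<^sup>2"
proof -
  note fD = metric_mapD[OF f]
  note bh = metric_onD(4)[OF fD(2) fD(4)[OF x]]
  have E1: "g x (E i) (E i) = 1" for i using E by (simp add: orthonormal_def)
  have H2: "sff g h f x (E 1) (E 1) + sff g h f x (E 2) (E 2) = 2 *\<^sub>R mean_curv g h f x"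
    unfolding mean_curv_frame[OF f x E] by (simp add: sum_2)
  have "h (f x) (sff g h f x (E 1) (E 1)) (mean_curv g h f x) + h (f x) (sff g h f x (E 2) (E 2)) (mean_curv g h f x)
      = 2 * (mean_curv_norm g h f x)\<^sup>2"
    unfolding bilinear_ladd[OF bh, symmetric] H2 mean_curv_norm_sq[OF x] by (simp add: bilinear_lmul[OF bh])
  then show ?thesis by (simp add: sum_2 stress_bienergy_eq[OF x] E1)
qed

lemma hopf_Q_eq:
  assumes x: "x \<in> U"
  shows "hopf_Q g h f x = (of_real (h (f x) (sff g h f x (axis 1 1) (axis 1 1)) (mean_curv g h f x))
    - of_real (h (f x) (sff g h f x (axis 2 1) (axis 2 1)) (mean_curv g h f x))
    - 2 * \<i> * of_real (h (f x) (sff g h f x (axis 1 1) (axis 2 1)) (mean_curv g h f x))) / 4"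
proof -
  note fD = metric_mapD[OF f]
  note bh = metric_onD(4)[OF fD(2) fD(4)[OF x]]
  let ?B = "\<lambda>i j. sff g h f x (axis i 1) (axis j 1)" and ?H = "mean_curv g h f x"
  have comp: "complex_of_real (h (f x) v ?H) =
      (\<Sum>a\<in>UNIV. \<Sum>b\<in>UNIV. of_real (v $ a) * of_real (?H $ b) * of_real (h (f x) (axis a 1) (axis b 1)))" for v
    by (subst bilinear_expand[OF bh]) simp
  let ?t = "\<lambda>i j a b. complex_of_real (?B i j $ a) * of_real (?H $ b) * of_real (h (f x) (axis a 1) (axis b 1))"
  have B21: "?B 2 1 = ?B 1 2" by (rule sff_sym[OF f x])
  have dz: "del_z $ 1 = 1/2" "del_z $ 2 = - \<i>/2" by (simp_all add: del_z_def)
  have vec: "cext_vec (sff g h f x) del_z del_z $ a =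
      (of_real (?B 1 1 $ a) - of_real (?B 2 2 $ a) - 2 * \<i> * of_real (?B 1 2 $ a)) / 4" for a
    unfolding cext_vec_def cext_def by (simp add: sum_2 dz B21 field_simps)
  have "hopf_Q g h f x = (\<Sum>a\<in>UNIV. \<Sum>b\<in>UNIV. (of_real (?B 1 1 $ a) - of_real (?B 2 2 $ a) - 2 * \<i> * of_real (?B 1 2 $ a)) / 4
      * of_real (?H $ b) * of_real (h (f x) (axis a 1) (axis b 1)))"
    unfolding hopf_Q_def cext_def[of "h (f x)"] vec by (simp add: cvec_def)
  also have "\<dots> = (\<Sum>a\<in>UNIV. \<Sum>b\<in>UNIV. ?t 1 1 a b / 4 - ?t 2 2 a b / 4 - \<i> / 2 * ?t 1 2 a b)"
    by (intro sum.cong refl) (simp add: field_simps)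
  also have "\<dots> = (\<Sum>a\<in>UNIV. \<Sum>b\<in>UNIV. ?t 1 1 a b) / 4 - (\<Sum>a\<in>UNIV. \<Sum>b\<in>UNIV. ?t 2 2 a b) / 4
      - \<i> / 2 * (\<Sum>a\<in>UNIV. \<Sum>b\<in>UNIV. ?t 1 2 a b)"
    by (simp only: sum_subtractf sum_distrib_left sum_divide_distrib)
  also have "\<dots> = (of_real (h (f x) (?B 1 1) ?H) - of_real (h (f x) (?B 2 2) ?H) - 2 * \<i> * of_real (h (f x) (?B 1 2) ?H)) / 4"
    unfolding comp by (simp add: diff_divide_distrib)
  finally show ?thesis .
qed

end


text \<open>The hypothesis \<open>div S\<^sub>2 = 0\<close> is tested on frames and vector fields defined on all of \<open>U\<close>;
  with constant fields it becomes an identity for tangent vectors at each point.\<close>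

context
  fixes U :: "(real^2) set" and g :: "2 lmetric" and V :: "(real^'n) set"
    and h :: "'n::finite lmetric" and f :: "real^2 \<Rightarrow> real^'n"
  assumes f: "metric_map U g V h f"
    and div: "\<And>E Y x. orthonormal_frame_on g U E \<Longrightarrow> smooth_on U Y \<Longrightarrow> x \<in> U \<Longrightarrow>
      div_tensor g E (stress_bienergy g h f) Y x = 0"
begin

abbreviation "\<H>2 \<equiv> \<lambda>y. (mean_curv_norm g h f y)\<^sup>2"

lemma mean_curv_sq_smooth: "smooth_on U \<H>2"
proof -
  note fD = metric_mapD[OF f]
  obtain E where E: "orthonormal_frame_on g U E" using exists_orthonormal_frame[OF fD(1)] by blast
  let ?T = "stress_bienergy g h f"
  note T = stress_bienergy_tensor[OF f]
  have "smooth_on U (\<lambda>y. (1/4) * (\<Sum>i\<in>UNIV. ?T y (E i y) (E i y)))"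
    by (intro smooth_mult smooth_const smooth_sum fD(5)
        smooth_bilinear_field[where \<beta>="?T", OF fD(5) tensor_onD(2)[OF T] tensor_onD(1)[OF T] frameD(1)[OF E] frameD(1)[OF E]])
  then show ?thesis
    by (rule smooth_cong[OF fD(5), THEN iffD2, rotated]) (simp add: stress_bienergy_trace[OF f _ frameD(3)[OF E]])
qed

lemma stress_bienergy_frame:
  assumes E: "orthonormal_frame_on g U E" and x: "x \<in> U"
  shows "(\<Sum>i\<in>UNIV. nabla g (stress_bienergy g h f) x (E i x) (E i x) w) = 0"
    and "(\<Sum>i\<in>UNIV. nabla g (stress_bienergy g h f) x w (E i x) (E i x)) = 4 * dd \<H>2 x w"
proof -
  note fD = metric_mapD[OF f] and T = stress_bienergy_tensor[OF f]
  have "div_tensor g E (stress_bienergy g h f) (\<lambda>_. w) x = 0"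
    by (rule div[OF E smooth_const x])
  then show "(\<Sum>i\<in>UNIV. nabla g (stress_bienergy g h f) x (E i x) (E i x) w) = 0"
    using div_tensor_eq[OF fD(1) T E x, of "\<lambda>_. w"] by simp
  have "(\<Sum>i\<in>UNIV. nabla g (stress_bienergy g h f) x w (E i x) (E i x)) =
      dd (\<lambda>y. \<Sum>i\<in>UNIV. stress_bienergy g h f y (E i y) (E i y)) x w"
    by (rule trace_derivative[OF fD(1) T E x, symmetric])
  also have "\<dots> = dd (\<lambda>y. 4 * \<H>2 y) x w"
    using dd_cong_open(1)[OF fD(5) x, of "\<lambda>y. \<Sum>i\<in>UNIV. stress_bienergy g h f y (E i y) (E i y)" "\<lambda>y. 4 * \<H>2 y"]
      stress_bienergy_trace[OF f _ frameD(3)[OF E]] by simp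
  also have "\<dots> = 4 * dd \<H>2 x w"
    by (rule dd_linear_comp[OF bounded_linear_mult_right smooth_diff_at[OF mean_curv_sq_smooth x]])
  finally show "(\<Sum>i\<in>UNIV. nabla g (stress_bienergy g h f) x w (E i x) (E i x)) = 4 * dd \<H>2 x w" .
qed

lemma codazzi_iff_mean_curv_stationary:
  assumes x: "x \<in> U"
  shows "(\<forall>u v w. nabla g (stress_bienergy g h f) x u v w = nabla g (stress_bienergy g h f) x v u w)
    \<longleftrightarrow> (\<forall>u. dd \<H>2 x u = 0)"
proof -
  note fD = metric_mapD[OF f] and T = stress_bienergy_tensor[OF f]
  obtain E where E: "orthonormal_frame_on g U E" using exists_orthonormal_frame[OF fD(1)] by blast
  show ?thesis
    using codazzi_iff_trace_derivative_zero[OF fD(1) T x frameD(3)[OF E x] stress_bienergy_frame(1)[OF E x]]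
    by (simp add: stress_bienergy_frame(2)[OF E x])
qed

text \<open>Here \<open>16 Q = T\<^sub>1\<^sub>1 - T\<^sub>2\<^sub>2 - 2 i T\<^sub>1\<^sub>2\<close> for \<open>T = S\<^sub>2\<close>: the metric part of \<open>S\<^sub>2\<close> cancels in this
  combination. Thus the real and imaginary parts of \<open>\<partial>\<^sub>z\<^sub>b\<^sub>a\<^sub>r Q\<close> are, up to nonzero factors, the
  partial derivatives of \<open>|H|\<^sup>2\<close>.\<close>

lemma hopf_holomorphic_iff_mean_curv_stationary:
  assumes x: "x \<in> U" and iso: "\<And>y u v. y \<in> U \<Longrightarrow> g y u v = r y * (u \<bullet> v)"
  shows "dbar (hopf_Q g h f) x = 0 \<longleftrightarrow> (\<forall>u. dd \<H>2 x u = 0)"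
proof -
  note fD = metric_mapD[OF f] and T = stress_bienergy_tensor[OF f]
  let ?T = "stress_bienergy g h f"
  let ?e1 = "axis 1 (1::real) :: real^2" and ?e2 = "axis 2 (1::real) :: real^2"
  have r: "r y = g y ?e1 ?e1" if "y \<in> U" for y using iso[OF that] by (simp add: inner_axis_axis)
  have r0: "r y > 0" if "y \<in> U" for y
    unfolding r[OF that] by (rule inner_formD(3)[OF metric_onD(3)[OF fD(1) that]]) (simp add: axis_eq_0_iff)
  define E where "E i y = (1 / sqrt (g y ?e1 ?e1)) *\<^sub>R axis i (1::real)" for i :: 2 and y
  have E: "orthonormal_frame_on g U E"
    unfolding orthonormal_frame_on_def
  proof (intro conjI allI ballI)
    show "smooth_on U (E i)" for i unfolding E_def[abs_def]
      by (intro smooth_scaleR smooth_divide smooth_sqrt smooth_const metric_onD(2)[OF fD(1)] fD(5))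
         (use r r0 in fastforce)+
    show "g y (E i y) (E j y) = (if i = j then 1 else 0)" if "y \<in> U" for y i j
      using r0[OF that] by (simp add: E_def iso[OF that] inner_axis_axis)
  qed
  define s where "s = 1 / sqrt (r x)"
  have s: "s \<noteq> 0" "E i x = s *\<^sub>R axis i 1" for i using r0[OF x] by (simp_all add: s_def E_def r[OF x])
  note L1 = nabla_linear(1)[OF fD(1) T x] and B = nabla_linear(2)[OF fD(1) T x]
  have divx: "nabla g ?T x ?e1 ?e1 w + nabla g ?T x ?e2 ?e2 w = 0" for w
  proof -
    have "s * (s * (nabla g ?T x ?e1 ?e1 w + nabla g ?T x ?e2 ?e2 w)) = 0"
      using stress_bienergy_frame(1)[OF E x, of w]
      by (simp add: sum_2 s(2) linear_cmul[OF L1] bilinear_lmul[OF B] algebra_simps)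
    then show ?thesis using s(1) by simp
  qed
  have tr: "nabla g ?T x w ?e1 ?e1 + nabla g ?T x w ?e2 ?e2 = 4 / (s * s) * dd \<H>2 x w" for w
  proof -
    have "s * s * (nabla g ?T x w ?e1 ?e1 + nabla g ?T x w ?e2 ?e2) = 4 * dd \<H>2 x w"
      using stress_bienergy_frame(2)[OF E x, of w]
      by (simp add: sum_2 s(2) bilinear_lmul[OF B] bilinear_rmul[OF B] algebra_simps)
    then show ?thesis using s(1) by (simp add: field_simps)
  qed
  define P where "P y = ?T y ?e1 ?e1 - ?T y ?e2 ?e2" for y
  define S where "S y = ?T y ?e1 ?e2" for y
  have PS: "dd P x ?e1 + 2 * dd S x ?e2 = - (4 / (s * s) * dd \<H>2 x ?e1)"
    "dd P x ?e2 - 2 * dd S x ?e1 = 4 / (s * s) * dd \<H>2 x ?e2"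
    using isothermal_divfree[OF fD(1) T x iso divx] unfolding tr P_def[abs_def] S_def[abs_def] by auto
  have Q: "hopf_Q g h f y = of_real (P y / 16) - \<i> * of_real (S y / 8)" if y: "y \<in> U" for y
    unfolding hopf_Q_eq[OF f y] P_def S_def stress_bienergy_eq[OF f y] iso[OF y]
    by (simp add: inner_axis_axis field_simps)
  have dP: "P differentiable (at x)" and dS: "S differentiable (at x)"
    unfolding P_def[abs_def] S_def[abs_def]
    by (intro differentiable_diff smooth_diff_at[OF tensor_onD(1)[OF T] x])+
  have dQ: "dd (hopf_Q g h f) x u = of_real (dd P x u / 16) - \<i> * of_real (dd S x u / 8)" for u
  proof -
    have "((\<lambda>y. of_real (P y / 16) - \<i> * of_real (S y / 8) :: complex) has_derivative
        (\<lambda>u. of_real (dd P x u / 16) - \<i> * of_real (dd S x u / 8))) (at x)"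
      unfolding divide_inverse
      by (intro has_derivative_diff has_derivative_mult_right has_derivative_mult_left
          has_derivative_of_real dd_has_derivative dP dS)
    from dd_eq[OF this, of u] show ?thesis
      using dd_cong_open(1)[OF fD(5) x Q] by simp
  qed
  have "dbar (hopf_Q g h f) x =
      Complex ((dd P x ?e1 + 2 * dd S x ?e2) / 32) ((dd P x ?e2 - 2 * dd S x ?e1) / 32)"
    unfolding dbar_def dQ by (simp add: complex_eq_iff)
  also have "\<dots> = 0 \<longleftrightarrow> dd \<H>2 x ?e1 = 0 \<and> dd \<H>2 x ?e2 = 0"
    unfolding PS using s(1) by (simp add: complex_eq_iff)
  also have "\<dots> \<longleftrightarrow> (\<forall>u. dd \<H>2 x u = 0)"
  proof
    note l = smooth_linear_dd[OF mean_curv_sq_smooth x]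
    assume z: "dd \<H>2 x ?e1 = 0 \<and> dd \<H>2 x ?e2 = 0"
    show "\<forall>u. dd \<H>2 x u = 0"
    proof
      fix u :: "real^2"
      have "dd \<H>2 x (plane_pt (u $ 1) (u $ 2)) = 0" using z by (simp add: linear_add[OF l] linear_cmul[OF l])
      then show "dd \<H>2 x u = 0" by (simp only: plane_pt_eq)
    qed
  qed simp
  finally show ?thesis .
qed

end

section \<open>Charts\<close>

lemma is_chartD:
  assumes "is_chart T c"
  shows "openin T (cdom c)" "open (cimg c)" "inj_on (cmap c) (cdom c)"
    "homeomorphic_map (subtopology T (cdom c)) (top_of_set (cimg c)) (cmap c)"
proof -
  show 1: "openin T (cdom c)" "open (cimg c)"
    and 2: "homeomorphic_map (subtopology T (cdom c)) (top_of_set (cimg c)) (cmap c)"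
    using assms by (auto simp: is_chart_def)
  have "topspace (subtopology T (cdom c)) = cdom c"
    using openin_subset[OF 1(1)] by auto
  then show "inj_on (cmap c) (cdom c)" using homeomorphic_imp_injective_map[OF 2] by simp
qed

lemma cinv_cmap: "is_chart T c \<Longrightarrow> p \<in> cdom c \<Longrightarrow> cinv c (cmap c p) = p"
  unfolding cinv_def by (rule inv_into_f_f[OF is_chartD(3)])

lemma chart_image_open:
  assumes c: "is_chart T c" and W: "openin T W" "W \<subseteq> cdom c"
  shows "open (cmap c ` W)"
proof -
  have "openin (subtopology T (cdom c)) W"
    using W by (simp add: openin_open_subtopology is_chartD(1)[OF c])
  then have "openin (top_of_set (cimg c)) (cmap c ` W)"
    using homeomorphic_imp_open_map[OF is_chartD(4)[OF c]] by (simp add: open_map_def)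
  then show ?thesis using is_chartD(2)[OF c] openin_open_eq by blast
qed

lemma chart_preimage_open:
  assumes c: "is_chart T c" and B: "open B"
  shows "openin T {p \<in> cdom c. cmap c p \<in> B}"
proof -
  have "continuous_map (subtopology T (cdom c)) euclidean (cmap c)"
    using homeomorphic_imp_continuous_map[OF is_chartD(4)[OF c]] continuous_map_into_fulltopology by blast
  then have "openin (subtopology T (cdom c)) {p \<in> topspace (subtopology T (cdom c)). cmap c p \<in> B}"
    using B openin_continuous_map_preimage open_openin by blast
  moreover have "topspace (subtopology T (cdom c)) = cdom c"
    using openin_subset[OF is_chartD(1)[OF c]] by auto
  ultimately have "openin (subtopology T (cdom c)) {p \<in> cdom c. cmap c p \<in> B}" by (simp only:)
  then show ?thesis unfolding openin_open_subtopology[OF is_chartD(1)[OF c]] by (rule conjunct1)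
qed

context
  fixes M :: "('p, 'm::finite) riem_mfd"
  assumes M: "riemannian_manifold M"
begin

lemma atlas_chart: "c \<in> atlas M \<Longrightarrow> is_chart (top_of M) c"
  using M by (simp add: riemannian_manifold_def smooth_manifold_def)

lemma atlas_covers: "p \<in> topspace (top_of M) \<Longrightarrow> \<exists>c\<in>atlas M. p \<in> cdom c"
proof -
  assume "p \<in> topspace (top_of M)"
  moreover have "(\<Union>c\<in>atlas M. cdom c) = topspace (top_of M)"
    using M by (simp add: riemannian_manifold_def smooth_manifold_def)
  ultimately show ?thesis by blast
qed

lemma cdom_topspace: "c \<in> atlas M \<Longrightarrow> cdom c \<subseteq> topspace (top_of M)"
  using is_chartD(1)[OF atlas_chart] openin_subset by blast

lemma chart_metric_on: "c \<in> atlas M \<Longrightarrow> metric_on (cimg c) (metric M c)"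
  using M is_chartD(2)[OF atlas_chart]
  unfolding metric_on_def inner_form_def riemannian_manifold_def riemannian_metric_def by blast

lemma metric_transition:
  assumes "c \<in> atlas M" "c' \<in> atlas M" "p \<in> cdom c" "p \<in> cdom c'"
  shows "metric M c (cmap c p) u v =
    metric M c' (cmap c' p) (dd (transition c c') (cmap c p) u) (dd (transition c c') (cmap c p) v)"
  using M assms unfolding riemannian_manifold_def riemannian_metric_def by blast

lemma transition_smooth:
  "c \<in> atlas M \<Longrightarrow> c' \<in> atlas M \<Longrightarrow> smooth_on (cmap c ` (cdom c \<inter> cdom c')) (transition c c')"
  using M unfolding riemannian_manifold_def smooth_manifold_def compatible_def by blast

lemma transition_isometric:
  assumes c: "c \<in> atlas M" and c': "c' \<in> atlas M"
    and W: "openin (top_of M) W" "W \<subseteq> cdom c \<inter> cdom c'"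
    and V: "open V" "cmap c' ` W \<subseteq> V" "V \<subseteq> cimg c'"
  shows "isometric_map (cmap c ` W) (metric M c) V (metric M c') (transition c c')"
proof -
  have t: "transition c c' (cmap c p) = cmap c' p" if "p \<in> W" for p
    using that W(2) cinv_cmap[OF atlas_chart[OF c], of p] by (auto simp: transition_def)
  have o: "open (cmap c ` W)" by (rule chart_image_open[OF atlas_chart[OF c] W(1)]) (use W in auto)
  have "cmap c ` W \<subseteq> cimg c" using W(2) by (auto simp: cimg_def)
  then have "metric_on (cmap c ` W) (metric M c)" by (rule metric_on_subset[OF chart_metric_on[OF c] o])
  moreover have "metric_on V (metric M c')" by (rule metric_on_subset[OF chart_metric_on[OF c'] V(1,3)])
  moreover have "smooth_on (cmap c ` W) (transition c c')"
    by (rule smooth_subset[OF transition_smooth[OF c c']]) (use W in auto)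
  moreover have "metric M c x u v = metric M c' (transition c c' x) (dd (transition c c') x u) (dd (transition c c') x v)"
    if x: "x \<in> cmap c ` W" for x u v
  proof -
    obtain p where p: "p \<in> W" "x = cmap c p" using x by blast
    then show ?thesis using metric_transition[OF c c', of p u v] W(2) t by auto
  qed
  ultimately show ?thesis unfolding isometric_map_def metric_map_def using t V by auto
qed

end

text \<open>Composing a chart with isothermal coordinates on part of its image gives a chart which is
  compatible with the atlas, so it belongs to the atlas by maximality.\<close>

lemma isothermal_chart_exists:
  fixes M :: "('p, 2) riem_mfd"
  assumes M: "riemannian_manifold M" and p: "p \<in> topspace (top_of M)"
  shows "\<exists>c. isothermal M c \<and> p \<in> cdom c"
proof -
  obtain c0 where c0: "c0 \<in> atlas M" "p \<in> cdom c0" using atlas_covers[OF M p] by blast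
  note ch = atlas_chart[OF M c0(1)]
  have "cmap c0 p \<in> cimg c0" using c0(2) by (simp add: cimg_def)
  from isothermal_coordinates[OF chart_metric_on[OF M c0(1)] this]
  obtain V and G :: "real^2 \<Rightarrow> real^2" and \<rho> where V: "open V" "cmap c0 p \<in> V" "V \<subseteq> cimg c0"
    and G: "smooth_on V G" "inj_on G V" "\<And>x. x \<in> V \<Longrightarrow> inj (dd G x)"
    and \<rho>: "\<And>x. x \<in> V \<Longrightarrow> \<rho> x > 0" "\<And>x u v. x \<in> V \<Longrightarrow> metric M c0 x u v = \<rho> x * (dd G x u \<bullet> dd G x v)"
    by metis
  define D where "D = {q \<in> cdom c0. cmap c0 q \<in> V}"
  define c where "c = (D, G \<circ> cmap c0)"
  have [simp]: "cdom c = D" "cmap c = G \<circ> cmap c0" by (simp_all add: c_def)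
  have D: "openin (top_of M) D" unfolding D_def by (rule chart_preimage_open[OF ch V(1)])
  have D0: "D \<subseteq> cdom c0" by (auto simp: D_def)
  have imD: "cmap c0 ` D = V" using V(3) by (auto simp: D_def cimg_def)
  have cimg: "cimg c = G ` V" unfolding cimg_def imD[symmetric] by (simp add: image_image)
  define Gi where "Gi = inv_into V G"
  have Gi: "Gi (G x) = x" if "x \<in> V" for x unfolding Gi_def by (rule inv_into_f_f[OF G(2) that])
  have opG: "open (G ` W)" if "open W" "W \<subseteq> V" for W
    by (rule smooth_inverse_map(1)[OF that(1) smooth_subset[OF G(1) that(2)], of Gi]) (use that Gi G(3) in auto)
  have smGi: "smooth_on (G ` V) Gi"
    by (rule smooth_inverse_map(2)[OF V(1) G(1) Gi G(3)])
  have hom: "homeomorphic_map (subtopology (top_of M) D) (top_of_set (G ` V)) (G \<circ> cmap c0)"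
  proof -
    have "homeomorphic_map (subtopology (subtopology (top_of M) (cdom c0)) D) (subtopology (top_of_set (cimg c0)) V) (cmap c0)"
    proof (rule homeomorphic_map_subtopologies[OF is_chartD(4)[OF ch]])
      have "topspace (subtopology (top_of M) (cdom c0)) = cdom c0"
        using cdom_topspace[OF M c0(1)] by auto
      then show "cmap c0 ` (topspace (subtopology (top_of M) (cdom c0)) \<inter> D) = topspace (top_of_set (cimg c0)) \<inter> V"
        using imD V(3) D0 by (simp add: Int_absorb1 Int_absorb2)
    qed
    then have 1: "homeomorphic_map (subtopology (top_of M) D) (top_of_set V) (cmap c0)"
      using D0 V(3) by (simp add: subtopology_subtopology Int_absorb1 Int_absorb2)
    have "homeomorphic_maps (top_of_set V) (top_of_set (G ` V)) G Gi"
      unfolding homeomorphic_maps_def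
      using smooth_continuous[OF G(1)] smooth_continuous[OF smGi] Gi by auto
    then have 2: "homeomorphic_map (top_of_set V) (top_of_set (G ` V)) G"
      by (auto simp: homeomorphic_map_maps)
    show ?thesis by (rule homeomorphic_map_compose[OF 1 2])
  qed
  have chc: "is_chart (top_of M) c"
    unfolding is_chart_def cimg using D opG[OF V(1)] hom by simp
  have comp: "compatible c d" if d: "d \<in> atlas M" for d
  proof -
    note chd = atlas_chart[OF M d]
    have oD: "openin (top_of M) (D \<inter> cdom d)" by (rule openin_Int[OF D is_chartD(1)[OF chd]])
    have o1: "open (cmap c0 ` (D \<inter> cdom d))" by (rule chart_image_open[OF ch oD]) (use D0 in auto)
    have o2: "open (cmap d ` (D \<inter> cdom d))" by (rule chart_image_open[OF chd oD]) auto
    have sub: "cmap c0 ` (D \<inter> cdom d) \<subseteq> V" using imD by auto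
    have im: "cmap c ` (cdom c \<inter> cdom d) = G ` (cmap c0 ` (D \<inter> cdom d))" by (simp add: image_comp)
    have s1: "smooth_on (G ` (cmap c0 ` (D \<inter> cdom d))) (\<lambda>y. transition c0 d (Gi y))"
    proof (rule smooth_compose[where f=Gi and g="transition c0 d", OF opG[OF o1 sub] o1])
      show "smooth_on (G ` (cmap c0 ` (D \<inter> cdom d))) Gi" by (rule smooth_subset[OF smGi]) (use sub in auto)
      show "smooth_on (cmap c0 ` (D \<inter> cdom d)) (transition c0 d)"
        by (rule smooth_subset[OF transition_smooth[OF M c0(1) d]]) (use D0 in auto)
      show "Gi ` (G ` (cmap c0 ` (D \<inter> cdom d))) \<subseteq> cmap c0 ` (D \<inter> cdom d)" using Gi sub by force
    qed
    have e1: "transition c d y = transition c0 d (Gi y)" if "y \<in> G ` (cmap c0 ` (D \<inter> cdom d))" for y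
    proof -
      obtain q where q: "q \<in> D" "q \<in> cdom d" "y = G (cmap c0 q)" using \<open>y \<in> _\<close> by blast
      have "cinv c y = q" using cinv_cmap[OF chc, of q] q by simp
      moreover have "Gi y = cmap c0 q" using q imD Gi by blast
      moreover have "cinv c0 (cmap c0 q) = q" using cinv_cmap[OF ch, of q] q D0 by auto
      ultimately show ?thesis by (simp add: transition_def)
    qed
    have "smooth_on (cmap c ` (cdom c \<inter> cdom d)) (transition c d)"
      unfolding im by (rule smooth_cong[OF opG[OF o1 sub], THEN iffD2, OF e1 s1])
    moreover have "smooth_on (cmap d ` (cdom c \<inter> cdom d)) (transition d c)"
    proof -
      have inV: "transition d c0 y \<in> V" if "y \<in> cmap d ` (D \<inter> cdom d)" for y
        using that cinv_cmap[OF chd] imD by (auto simp: transition_def)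
      have "smooth_on (cmap d ` (D \<inter> cdom d)) (\<lambda>y. G (transition d c0 y))"
        by (rule smooth_compose[where f="transition d c0" and g=G,
              OF o2 V(1) smooth_subset[OF transition_smooth[OF M d c0(1)]] G(1)])
           (use D0 inV in auto)
      moreover have "(\<lambda>y. G (transition d c0 y)) = transition d c" by (auto simp: transition_def)
      ultimately show ?thesis by simp
    qed
    ultimately show ?thesis unfolding compatible_def by blast
  qed
  have catlas: "c \<in> atlas M"
    using M chc comp unfolding riemannian_manifold_def smooth_manifold_def by blast
  have tr: "transition c0 c x = G x" if x: "x \<in> V" for x
  proof -
    obtain q where q: "q \<in> D" "x = cmap c0 q" using x imD by blast
    then show ?thesis using cinv_cmap[OF ch, of q] D0 by (auto simp: transition_def)
  qed
  have metc: "metric M c (G x) a b = \<rho> x * (a \<bullet> b)" if x: "x \<in> V" for x a b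
  proof -
    obtain q where q: "q \<in> D" "x = cmap c0 q" using x imD by blast
    have dt: "dd (transition c0 c) x = dd G x" by (rule dd_cong_open(1)[OF V(1) x tr])
    have "surj (dd G x)"
      by (rule linear_injective_imp_surjective[OF smooth_linear_dd[OF G(1) x] G(3)[OF x] refl])
    then obtain u v where uv: "a = dd G x u" "b = dd G x v" by (metis surjD)
    have "metric M c0 x u v = metric M c (G x) (dd (transition c0 c) x u) (dd (transition c0 c) x v)"
      using metric_transition[OF M c0(1) catlas, of q u v] q D0 by auto
    then have "metric M c0 x u v = metric M c (G x) a b" by (simp only: dt uv)
    then show ?thesis using \<rho>(2)[OF x, of u v] uv by simp
  qed
  have "isothermal M c"
    unfolding isothermal_def
  proof (intro conjI catlas exI[of _ "\<lambda>y. sqrt (\<rho> (Gi y))"] ballI allI)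
    fix y assume "y \<in> cimg c"
    then obtain x where x: "x \<in> V" "y = G x" using cimg by blast
    show "0 < sqrt (\<rho> (Gi y))" using x Gi \<rho>(1) by simp
    show "metric M c y u v = (sqrt (\<rho> (Gi y)))\<^sup>2 * (u \<bullet> v)" for u v
      using x Gi \<rho>(1)[OF x(1)] metc[OF x(1)] by simp
  qed
  moreover have "p \<in> cdom c" using c0(2) V(2) by (simp add: D_def)
  ultimately show ?thesis by blast
qed


section \<open>From local to global\<close>

lemma locally_constant_imp_constant:
  assumes X: "connected_space X"
    and loc: "\<And>p. p \<in> topspace X \<Longrightarrow> \<exists>W. openin X W \<and> p \<in> W \<and> (\<forall>q\<in>W. F q = F p)"
  shows "\<exists>k. \<forall>p\<in>topspace X. F p = k"
proof (cases "topspace X = {}")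
  case False
  then obtain p0 where p0: "p0 \<in> topspace X" by blast
  have op: "openin X {p \<in> topspace X. F p \<in> A}" for A
  proof (subst openin_subopen, intro ballI)
    fix p assume p: "p \<in> {p \<in> topspace X. F p \<in> A}"
    then have pX: "p \<in> topspace X" by simp
    obtain W where W: "openin X W" "p \<in> W" "\<forall>q\<in>W. F q = F p" using loc[OF pX] by (elim exE conjE)
    have "W \<subseteq> {p \<in> topspace X. F p \<in> A}"
      using p W(3) openin_subset[OF W(1)] by auto
    with W show "\<exists>T. openin X T \<and> p \<in> T \<and> T \<subseteq> {p \<in> topspace X. F p \<in> A}" by (intro exI conjI)
  qed
  have "{p \<in> topspace X. F p \<in> - {F p0}} = {}"
  proof (rule ccontr)
    assume "{p \<in> topspace X. F p \<in> - {F p0}} \<noteq> {}"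
    moreover have "{p \<in> topspace X. F p \<in> {F p0}} \<noteq> {}" using p0 by blast
    moreover have "topspace X \<subseteq> {p \<in> topspace X. F p \<in> {F p0}} \<union> {p \<in> topspace X. F p \<in> - {F p0}}"
      "{p \<in> topspace X. F p \<in> {F p0}} \<inter> {p \<in> topspace X. F p \<in> - {F p0}} = {}" by auto
    ultimately show False using X op[of "{F p0}"] op[of "- {F p0}"] unfolding connected_space_def by metis
  qed
  then show ?thesis by blast
qed simp

lemma stationary_imp_locally_constant:
  fixes F :: "real^'n \<Rightarrow> real"
  assumes U: "open U" "x \<in> U" and F: "smooth_on U F" and z: "\<And>y u. y \<in> U \<Longrightarrow> dd F y u = 0"
  obtains B where "open B" "x \<in> B" "B \<subseteq> U" "\<And>y. y \<in> B \<Longrightarrow> F y = F x"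
proof -
  obtain r where r: "r > 0" "ball x r \<subseteq> U" using U open_contains_ball by blast
  have "(F has_derivative (\<lambda>h. 0)) (at y within ball x r)" if "y \<in> ball x r" for y
  proof -
    have "dd F y = (\<lambda>h. 0)" using z r(2) that by blast
    moreover have "(F has_derivative dd F y) (at y)" using smooth_derivative[OF F] r(2) that by blast
    ultimately show ?thesis by (simp add: has_derivative_at_withinI)
  qed
  then obtain k where "\<And>y. y \<in> ball x r \<Longrightarrow> F y = k"
    using has_derivative_zero_constant[OF convex_ball] by metis
  then show ?thesis using that[of "ball x r"] r by simp
qed

context
  fixes M :: "('p, 2) riem_mfd" and N :: "('q, 'n::finite) riem_mfd" and \<phi> :: "'p \<Rightarrow> 'q"
  assumes M: "riemannian_manifold M" and N: "riemannian_manifold N"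
    and \<phi>: "isometric_immersion \<phi> M N"
begin

abbreviation chart_mean_curv :: "('p, 2) chart \<Rightarrow> ('q, 'n) chart \<Rightarrow> real^2 \<Rightarrow> real" where
  "chart_mean_curv c d \<equiv> mean_curv_norm (metric M c) (metric N d) (local_rep \<phi> c d)"

lemma local_rep_cmap: "c \<in> atlas M \<Longrightarrow> p \<in> cdom c \<Longrightarrow> local_rep \<phi> c d (cmap c p) = cmap d (\<phi> p)"
  by (simp add: local_rep_def cinv_cmap[OF atlas_chart[OF M]])

lemma immersion_preimage_open:
  assumes c: "openin (top_of M) C" and d: "openin (top_of N) D"
  shows "openin (top_of M) {p \<in> C. \<phi> p \<in> D}"
proof -
  have "continuous_map (top_of M) (top_of N) \<phi>"
    using \<phi> by (simp add: isometric_immersion_def immersion_def smooth_map_def)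
  then have "openin (top_of M) {p \<in> topspace (top_of M). \<phi> p \<in> D}"
    using d openin_continuous_map_preimage by blast
  from openin_Int[OF c this] have "openin (top_of M) (C \<inter> {p \<in> topspace (top_of M). \<phi> p \<in> D})" .
  moreover have "C \<inter> {p \<in> topspace (top_of M). \<phi> p \<in> D} = {p \<in> C. \<phi> p \<in> D}"
    using openin_subset[OF c] by auto
  ultimately show ?thesis by (simp only:)
qed

lemma local_metric_map:
  assumes c: "c \<in> atlas M" and d: "d \<in> atlas N"
    and W: "openin (top_of M) W" "W \<subseteq> cdom c" and V: "open V" "V \<subseteq> cimg d" "\<And>p. p \<in> W \<Longrightarrow> \<phi> p \<in> cdom d"
      "\<And>p. p \<in> W \<Longrightarrow> cmap d (\<phi> p) \<in> V"
  shows "metric_map (cmap c ` W) (metric M c) V (metric N d) (local_rep \<phi> c d)"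
proof -
  have o: "open (cmap c ` W)" by (rule chart_image_open[OF atlas_chart[OF M c] W])
  have "cmap c ` W \<subseteq> cimg c" using W(2) by (auto simp: cimg_def)
  then have "metric_on (cmap c ` W) (metric M c)" by (rule metric_on_subset[OF chart_metric_on[OF M c] o])
  moreover have "metric_on V (metric N d)" by (rule metric_on_subset[OF chart_metric_on[OF N d] V(1,2)])
  moreover have "smooth_on (cmap c ` W) (local_rep \<phi> c d)"
  proof (rule smooth_subset)
    show "smooth_on (local_dom \<phi> c d) (local_rep \<phi> c d)"
      using \<phi> c d by (simp add: isometric_immersion_def immersion_def smooth_map_def)
    show "cmap c ` W \<subseteq> local_dom \<phi> c d" using W(2) V(3) by (auto simp: local_dom_def)
  qed
  moreover have "local_rep \<phi> c d ` (cmap c ` W) \<subseteq> V"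
  proof (intro image_subsetI)
    fix x assume "x \<in> cmap c ` W"
    then obtain p where p: "p \<in> W" "x = cmap c p" by blast
    then have "p \<in> cdom c" using W(2) by blast
    then show "local_rep \<phi> c d x \<in> V" unfolding p(2) local_rep_cmap[OF c \<open>p \<in> cdom c\<close>] by (intro V(4) p(1))
  qed
  ultimately show ?thesis unfolding metric_map_def by blast
qed

lemma local_dom_metric_map:
  assumes c: "c \<in> atlas M" and d: "d \<in> atlas N"
  shows "metric_map (local_dom \<phi> c d) (metric M c) (cimg d) (metric N d) (local_rep \<phi> c d)"
  unfolding local_dom_def
proof (rule local_metric_map[OF c d])
  show "openin (top_of M) {p \<in> cdom c. \<phi> p \<in> cdom d}"
    by (rule immersion_preimage_open[OF is_chartD(1)[OF atlas_chart[OF M c]] is_chartD(1)[OF atlas_chart[OF N d]]])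
  show "open (cimg d)" by (rule is_chartD(2)[OF atlas_chart[OF N d]])
qed (auto simp: cimg_def)

lemma chart_mean_curv_invariant:
  assumes c: "c \<in> atlas M" "c' \<in> atlas M" and d: "d \<in> atlas N" "d' \<in> atlas N"
    and p: "p \<in> cdom c" "p \<in> cdom c'" "\<phi> p \<in> cdom d" "\<phi> p \<in> cdom d'"
  shows "chart_mean_curv c' d' (cmap c' p) = chart_mean_curv c d (cmap c p)"
proof -
  note cM = is_chartD(1)[OF atlas_chart[OF M c(1)]] is_chartD(1)[OF atlas_chart[OF M c(2)]]
  note dN = is_chartD(1)[OF atlas_chart[OF N d(1)]] is_chartD(1)[OF atlas_chart[OF N d(2)]]
  define D where "D = cdom d \<inter> cdom d'"
  define W where "W = {q \<in> cdom c \<inter> cdom c'. \<phi> q \<in> D}"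
  have D: "openin (top_of N) D" unfolding D_def by (rule openin_Int[OF dN])
  have W: "openin (top_of M) W" unfolding W_def
    by (rule immersion_preimage_open[OF openin_Int[OF cM] D])
  have oD: "open (cmap d ` D)" by (rule chart_image_open[OF atlas_chart[OF N d(1)] D]) (simp add: D_def)
  have f: "metric_map (cmap c ` W) (metric M c) (cmap d ` D) (metric N d) (local_rep \<phi> c d)"
    by (rule local_metric_map[OF c(1) d(1) W _ oD]) (auto simp: W_def D_def cimg_def)
  have f': "metric_map (local_dom \<phi> c' d') (metric M c') (cimg d') (metric N d') (local_rep \<phi> c' d')"
    by (rule local_dom_metric_map[OF c(2) d(2)])
  have \<tau>: "isometric_map (cmap c ` W) (metric M c) (local_dom \<phi> c' d') (metric M c') (transition c c')"
    by (rule transition_isometric[OF M c W _ metric_mapD(5)[OF f']])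
       (auto simp: W_def D_def local_dom_def cimg_def)
  have \<sigma>: "isometric_map (cmap d ` D) (metric N d) (cimg d') (metric N d') (transition d d')"
    by (rule transition_isometric[OF N d D _ is_chartD(2)[OF atlas_chart[OF N d(2)]]])
       (auto simp: D_def cimg_def)
  have t: "transition c c' (cmap c q) = cmap c' q" if "q \<in> W" for q
    using that cinv_cmap[OF atlas_chart[OF M c(1)], of q] by (simp add: transition_def W_def)
  have s: "transition d d' (cmap d r) = cmap d' r" if "r \<in> D" for r
    using that cinv_cmap[OF atlas_chart[OF N d(1)], of r] by (simp add: transition_def D_def)
  have pW: "p \<in> W" using p by (simp add: W_def D_def)
  have "chart_mean_curv c' d' (transition c c' (cmap c p)) = chart_mean_curv c d (cmap c p)"
  proof (rule mean_curv_norm_invariant[OF f f' \<tau> \<sigma>])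
    show "cmap c p \<in> cmap c ` W" using pW by blast
    fix y assume "y \<in> cmap c ` W"
    then obtain q where q: "q \<in> W" "y = cmap c q" by blast
    then have qq: "q \<in> cdom c" "q \<in> cdom c'" "\<phi> q \<in> D" by (auto simp: W_def)
    show "local_rep \<phi> c' d' (transition c c' y) = transition d d' (local_rep \<phi> c d y)"
      unfolding q(2) t[OF q(1)] local_rep_cmap[OF c(1) qq(1)] local_rep_cmap[OF c(2) qq(2)] s[OF qq(3)] ..
  qed
  then show ?thesis by (simp only: t[OF pW])
qed

lemma immersion_charts:
  assumes p: "p \<in> topspace (top_of M)"
  shows "\<exists>d\<in>atlas N. \<phi> p \<in> cdom d"
proof -
  have "continuous_map (top_of M) (top_of N) \<phi>"
    using \<phi> by (simp add: isometric_immersion_def immersion_def smooth_map_def)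
  then have "\<phi> p \<in> topspace (top_of N)" using p by (auto simp: continuous_map_def)
  then show ?thesis by (rule atlas_covers[OF N])
qed

text \<open>\<open>|H|\<close> as a function on the surface; its value does not depend on the charts chosen.\<close>

definition mean_curv_at :: "'p \<Rightarrow> real" where
  "mean_curv_at p = (SOME r. \<exists>c\<in>atlas M. \<exists>d\<in>atlas N. p \<in> cdom c \<and> \<phi> p \<in> cdom d \<and> r = chart_mean_curv c d (cmap c p))"

lemma mean_curv_at_eq:
  assumes "c \<in> atlas M" "d \<in> atlas N" "p \<in> cdom c" "\<phi> p \<in> cdom d"
  shows "chart_mean_curv c d (cmap c p) = mean_curv_at p"
proof -
  have "\<exists>c\<in>atlas M. \<exists>d\<in>atlas N. p \<in> cdom c \<and> \<phi> p \<in> cdom d \<and> mean_curv_at p = chart_mean_curv c d (cmap c p)"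
    unfolding mean_curv_at_def by (rule someI_ex) (use assms in blast)
  then show ?thesis using chart_mean_curv_invariant assms by metis
qed

text \<open>Stationarity is needed in one chart around each point only, for instance an isothermal one.
  Chart independence of \<open>|H|\<close> then makes it a locally constant function on a connected space.\<close>

lemma H_norm_constant_if_stationary:
  assumes conn: "connected_space (top_of M)"
    and st: "\<And>p. p \<in> topspace (top_of M) \<Longrightarrow> \<exists>c\<in>atlas M. p \<in> cdom c \<and>
      (\<forall>d\<in>atlas N. \<forall>x\<in>local_dom \<phi> c d. \<forall>u. dd (\<lambda>y. (chart_mean_curv c d y)\<^sup>2) x u = 0)"
    and sm: "\<And>c d. c \<in> atlas M \<Longrightarrow> d \<in> atlas N \<Longrightarrow> smooth_on (local_dom \<phi> c d) (\<lambda>y. (chart_mean_curv c d y)\<^sup>2)"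
  shows "H_norm_constant \<phi> M N"
proof -
  have "\<exists>k. \<forall>p\<in>topspace (top_of M). mean_curv_at p = k"
  proof (rule locally_constant_imp_constant[OF conn])
    fix p assume p: "p \<in> topspace (top_of M)"
    obtain c where c: "c \<in> atlas M" "p \<in> cdom c"
      and z: "\<And>d x u. d \<in> atlas N \<Longrightarrow> x \<in> local_dom \<phi> c d \<Longrightarrow> dd (\<lambda>y. (chart_mean_curv c d y)\<^sup>2) x u = 0"
      using st[OF p] by metis
    obtain d where d: "d \<in> atlas N" "\<phi> p \<in> cdom d" using immersion_charts[OF p] by blast
    let ?x = "cmap c p"
    have x: "?x \<in> local_dom \<phi> c d" using c d by (auto simp: local_dom_def)
    note o = metric_mapD(5)[OF local_dom_metric_map[OF c(1) d(1)]]
    obtain B where B: "open B" "?x \<in> B" "B \<subseteq> local_dom \<phi> c d"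
      "\<And>y. y \<in> B \<Longrightarrow> (chart_mean_curv c d y)\<^sup>2 = (chart_mean_curv c d ?x)\<^sup>2"
      using stationary_imp_locally_constant[OF o x sm[OF c(1) d(1)] z[OF d(1)]] by metis
    note f = local_dom_metric_map[OF c(1) d(1)]
    have nn: "chart_mean_curv c d y \<ge> 0" if "y \<in> local_dom \<phi> c d" for y
      by (simp add: mean_curv_norm_def
          inner_form_nonneg[OF metric_onD(3)[OF metric_mapD(2)[OF f] metric_mapD(4)[OF f that]]])
    show "\<exists>W. openin (top_of M) W \<and> p \<in> W \<and> (\<forall>q\<in>W. mean_curv_at q = mean_curv_at p)"
    proof (intro exI conjI ballI)
      show "openin (top_of M) {q \<in> cdom c. cmap c q \<in> B}"
        by (rule chart_preimage_open[OF atlas_chart[OF M c(1)] B(1)])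
      show "p \<in> {q \<in> cdom c. cmap c q \<in> B}" using c(2) B(2) by simp
      fix q assume q: "q \<in> {q \<in> cdom c. cmap c q \<in> B}"
      then have qd: "cmap c q \<in> local_dom \<phi> c d" using B(3) by blast
      then obtain q' where q': "q' \<in> cdom c" "\<phi> q' \<in> cdom d" "cmap c q = cmap c q'" by (auto simp: local_dom_def)
      then have "q = q'" using is_chartD(3)[OF atlas_chart[OF M c(1)]] q by (auto dest: inj_onD)
      then have "\<phi> q \<in> cdom d" using q'(2) by simp
      then have "mean_curv_at q = chart_mean_curv c d (cmap c q)"
        using mean_curv_at_eq[OF c(1) d(1)] q by simp
      also have "\<dots> = chart_mean_curv c d ?x"
        using B(4)[of "cmap c q"] q nn[OF qd] nn[OF x] by (simp add: power2_eq_iff_nonneg)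
      also have "\<dots> = mean_curv_at p" by (rule mean_curv_at_eq[OF c(1) d(1) c(2) d(2)])
      finally show "mean_curv_at q = mean_curv_at p" .
    qed
  qed
  then obtain k where k: "\<And>p. p \<in> topspace (top_of M) \<Longrightarrow> mean_curv_at p = k" by blast
  show ?thesis
    unfolding H_norm_constant_def
  proof (intro exI[of _ k] ballI)
    fix c d x assume c: "c \<in> atlas M" and d: "d \<in> atlas N" and x: "x \<in> local_dom \<phi> c d"
    then obtain p where p: "p \<in> cdom c" "\<phi> p \<in> cdom d" "x = cmap c p" by (auto simp: local_dom_def)
    have "p \<in> topspace (top_of M)" using cdom_topspace[OF M c] p(1) by blast
    then show "chart_mean_curv c d x = k" using mean_curv_at_eq[OF c d p(1,2)] k p(3) by simp
  qed
qed

end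

theorem theorem4p2:
  fixes M :: "('p, 2) riem_mfd"
    and N :: "('q, 'n::finite) riem_mfd"
    and \<phi> :: "'p \<Rightarrow> 'q"
  assumes "riemannian_manifold M" and "connected_space (top_of M)"
    and "riemannian_manifold N"
    and "isometric_immersion \<phi> M N"
    and "biconservative \<phi> M N"
  shows "(Q_holomorphic \<phi> M N \<longleftrightarrow> H_norm_constant \<phi> M N) \<and>
         (S2_codazzi \<phi> M N \<longleftrightarrow> H_norm_constant \<phi> M N)"
proof -
  let ?U = "\<lambda>c d. local_dom \<phi> c d" and ?f = "\<lambda>c d. local_rep \<phi> c d"
  let ?H2 = "\<lambda>c d y. (mean_curv_norm (metric M c) (metric N d) (?f c d) y)\<^sup>2"
  note f = local_dom_metric_map[OF assms(1,3,4)]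
  have div: "div_tensor (metric M c) E (stress_bienergy (metric M c) (metric N d) (?f c d)) Y x = 0"
    if "c \<in> atlas M" "d \<in> atlas N" "orthonormal_frame_on (metric M c) (?U c d) E" "smooth_on (?U c d) Y" "x \<in> ?U c d"
    for c d E Y x
    using assms(5) that metric_mapD(5)[OF f[OF that(1,2)]]
    unfolding biconservative_def S2_def by blast
  have sm: "smooth_on (?U c d) (?H2 c d)" if "c \<in> atlas M" "d \<in> atlas N" for c d
    by (rule mean_curv_sq_smooth[OF f[OF that] div[OF that]])
  note global = H_norm_constant_if_stationary[OF assms(1,3,4,2) _ sm]
  have stationary: "dd (?H2 c d) x u = 0"
    if H: "H_norm_constant \<phi> M N" and c: "c \<in> atlas M" and d: "d \<in> atlas N" and x: "x \<in> ?U c d" for c d x u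
  proof -
    obtain k where k: "\<And>y. y \<in> ?U c d \<Longrightarrow> mean_curv_norm (metric M c) (metric N d) (?f c d) y = k"
      using H c d unfolding H_norm_constant_def by blast
    have "dd (?H2 c d) x u = dd (\<lambda>y. k\<^sup>2) x u"
      using dd_cong_open(1)[OF metric_mapD(5)[OF f[OF c d]] x, of "?H2 c d" "\<lambda>y. k\<^sup>2"] k by simp
    also have "\<dots> = 0" by (rule dd_eq) simp
    finally show ?thesis .
  qed
  have hopf: "dbar (hopf_Q (metric M c) (metric N d) (?f c d)) x = 0 \<longleftrightarrow> (\<forall>u. dd (?H2 c d) x u = 0)"
    if c: "isothermal M c" and d: "d \<in> atlas N" and x: "x \<in> ?U c d" for c d x
  proof -
    have cM: "c \<in> atlas M" using c by (simp add: isothermal_def)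
    obtain \<rho> where \<rho>: "\<And>y u v. y \<in> cimg c \<Longrightarrow> metric M c y u v = (\<rho> y)\<^sup>2 * (u \<bullet> v)"
      using c unfolding isothermal_def by metis
    have sub: "?U c d \<subseteq> cimg c" by (auto simp: local_dom_def cimg_def)
    show ?thesis
      by (rule hopf_holomorphic_iff_mean_curv_stationary[OF f[OF cM d] div[OF cM d] x, where r="\<lambda>y. (\<rho> y)\<^sup>2"])
         (use \<rho> sub in auto)
  qed
  have codazzi: "(\<forall>u v w. nabla (metric M c) (stress_bienergy (metric M c) (metric N d) (?f c d)) x u v w =
      nabla (metric M c) (stress_bienergy (metric M c) (metric N d) (?f c d)) x v u w)
      \<longleftrightarrow> (\<forall>u. dd (?H2 c d) x u = 0)"
    if c: "c \<in> atlas M" and d: "d \<in> atlas N" and x: "x \<in> ?U c d" for c d x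
    by (rule codazzi_iff_mean_curv_stationary[OF f[OF c d] div[OF c d] x])
  have "H_norm_constant \<phi> M N" if Q: "Q_holomorphic \<phi> M N"
  proof (rule global)
    fix p assume "p \<in> topspace (top_of M)"
    then obtain c where c: "isothermal M c" "p \<in> cdom c" using isothermal_chart_exists[OF assms(1)] by blast
    then show "\<exists>c\<in>atlas M. p \<in> cdom c \<and> (\<forall>d\<in>atlas N. \<forall>x\<in>?U c d. \<forall>u. dd (?H2 c d) x u = 0)"
      using Q hopf[OF c(1)] unfolding Q_holomorphic_def isothermal_def by metis
  qed
  moreover have "Q_holomorphic \<phi> M N" if H: "H_norm_constant \<phi> M N"
    unfolding Q_holomorphic_def
  proof (intro allI impI ballI)
    fix c d x assume c: "isothermal M c" and d: "d \<in> atlas N" and x: "x \<in> ?U c d"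
    have cM: "c \<in> atlas M" using c by (simp add: isothermal_def)
    show "dbar (hopf_Q (metric M c) (metric N d) (?f c d)) x = 0"
      unfolding hopf[OF c d x] using stationary[OF H cM d x] by blast
  qed
  moreover have "H_norm_constant \<phi> M N" if C: "S2_codazzi \<phi> M N"
  proof (rule global)
    fix p assume "p \<in> topspace (top_of M)"
    then obtain c where c: "c \<in> atlas M" "p \<in> cdom c" using atlas_covers[OF assms(1)] by blast
    have "\<forall>u. dd (?H2 c d) x u = 0" if d: "d \<in> atlas N" and x: "x \<in> ?U c d" for d x
    proof -
      note fc = f[OF c(1) d]
      note ct = cov_tensor_eq[OF metric_mapD(1)[OF fc] stress_bienergy_tensor[OF fc] x]
      have "nabla (metric M c) (stress_bienergy (metric M c) (metric N d) (?f c d)) x u v w =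
          nabla (metric M c) (stress_bienergy (metric M c) (metric N d) (?f c d)) x v u w" for u v w
      proof -
        have "cov_tensor (metric M c) (S2 \<phi> M N c d) (\<lambda>_. u) (\<lambda>_. v) (\<lambda>_. w) x =
            cov_tensor (metric M c) (S2 \<phi> M N c d) (\<lambda>_. v) (\<lambda>_. u) (\<lambda>_. w) x"
          using C c(1) d x metric_mapD(5)[OF fc] smooth_const unfolding S2_codazzi_def by blast
        then show ?thesis unfolding S2_def by (simp add: ct)
      qed
      then show ?thesis using codazzi[OF c(1) d x] by blast
    qed
    then show "\<exists>c\<in>atlas M. p \<in> cdom c \<and> (\<forall>d\<in>atlas N. \<forall>x\<in>?U c d. \<forall>u. dd (?H2 c d) x u = 0)"
      using c by blast
  qed
  moreover have "S2_codazzi \<phi> M N" if H: "H_norm_constant \<phi> M N"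
    unfolding S2_codazzi_def
  proof (intro ballI allI impI)
    fix c d V and X Y Z :: "real^2 \<Rightarrow> real^2" and x
    assume c: "c \<in> atlas M" and d: "d \<in> atlas N" and x: "x \<in> V"
      and V: "open V \<and> V \<subseteq> ?U c d \<and> smooth_on V X \<and> smooth_on V Y \<and> smooth_on V Z"
    have xU: "x \<in> ?U c d" using V x by blast
    note fc = f[OF c d]
    note ct = cov_tensor_eq[OF metric_mapD(1)[OF fc] stress_bienergy_tensor[OF fc] xU]
    have diff: "X differentiable (at x)" "Y differentiable (at x)" "Z differentiable (at x)"
      using V smooth_diff_at x by blast+
    have "\<forall>u. dd (?H2 c d) x u = 0" using stationary[OF H c d xU] by blast
    then have "nabla (metric M c) (stress_bienergy (metric M c) (metric N d) (?f c d)) x (X x) (Y x) (Z x) =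
        nabla (metric M c) (stress_bienergy (metric M c) (metric N d) (?f c d)) x (Y x) (X x) (Z x)"
      using codazzi[OF c d xU] by blast
    then show "cov_tensor (metric M c) (S2 \<phi> M N c d) X Y Z x = cov_tensor (metric M c) (S2 \<phi> M N c d) Y X Z x"
      unfolding S2_def by (simp add: ct diff)
  qed
  ultimately show ?thesis by blast
qed

end
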